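(* Let $X$ be a Banach space with a partial ordering $\le$. Let $-A$ have compact resolvent and be the infinitesimal generator of an analytic semigroup $\{e^{-At}:t\ge0\}$ on $X$, and let $\alpha\in(0,1)$. Assume that the positive cones $C_\gamma=\{x\in X^\gamma:0\le x\}$, $\gamma\ge 0$, are closed, and that $-A$ has positive resolvent, that is, $A^{-1}C_\gamma\subset C_\gamma$. Let $g^{+},g^{-}:X^\alpha\to X$ be continuous maps such that $g^-\le g^+$ and, for some $k\in\mathbb{R}$, $u\mapsto g^+(u)+ku$ is an increasing function. For $g\in\{g^+,g^-\}$ and $w_0\in X^\alpha$, write $u(\cdot,w_0,g)$ for a (not necessarily unique) mild solution of $$\dot u=-Au+g(u),\quad t>0,\qquad u(0)=w_0 .$$ Then: (i) For each solution $u(\cdot,w_0,g^+)$ there exists a solution $u(\cdot,w_0,g^-)$ such that $u(t,w_0,g^-)\le u(t,w_0,g^+)$ as long as both are defined. (ii) Given a solution $u(\cdot,u^+,g^+)$ and $u^-\in X^\alpha$ with $u^-\le u^+$, there exists a solution $u(\cdot,u^-,g^+)$ such that $u(t,u^-,g^+)\le u(t,u^+,g^+)$ as long as both are defined. An analogous result holds if instead $u\mapsto g^-(u)+ku$ is an increasing function: for each solution $u(\cdot,w_0,g^-)$ there exists a solution $u(\cdot,w_0,g^+)$ with $u(t,w_0,g^-)\le u(t,w_0,g^+)$ as long as both are defined; and given a solution $u(\cdot,u^-,g^-)$ and $u^+\in X^\alpha$ with $u^-\le u^+$, there exists a solution $u(\cdot,u^+,g^-)$ with $u(t,u^-,g^-)\le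 u(t,u^+,g^-)$ as long as both are defined.
   Context: $X^\gamma$, $\gamma\ge0$, are the fractional power spaces associated with $A$. The typical setting is that of function spaces on a domain $\Omega\subset\mathbb{R}^N$, such as $X=L^2(\Omega)$ and $X^{1/2}=H^1_0(\Omega)$, with the ordering $u\le v$ if and only if $u(x)\le v(x)$ for a.e. $x\in\Omega$. The inequality $g^-\le g^+$ means $g^-(u)\le g^+(u)$ for all $u\in X^\alpha$. A map $G:X^\alpha\to X$ is increasing if $u\le v$ implies $G(u)\le G(v)$. A mild solution of $\dot u=-Au+g(u)$, $u(0)=w_0$, on $[0,T]$ is a function $u\in C([0,T];X^\alpha)$ with $u(t)=e^{-At}w_0+\int_0^te^{-A(t-s)}g(u(s))\,ds$ for $0\le t\le T$.
   Formalization: "Positive resolvent" is taken to mean that (μ+A)^{-1} maps each C_γ into itself for μ=0 and for all large real μ; with A^{-1}C_γ ⊂ C_γ alone the claim fails, e.g. X=ℝ², A^{-1} with rows (1,2),(2,1), g^±=0. *)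

theory Defs
  imports "HOL-Analysis.Analysis"
begin

section \<open>Analytic semigroups\<close>

definition C0_semigroup :: "(real \<Rightarrow> 'a::banach \<Rightarrow>\<^sub>L 'a) \<Rightarrow> bool" where
  "C0_semigroup T \<longleftrightarrow>
     T 0 = id_blinfun \<and>
     (\<forall>s\<ge>0. \<forall>t\<ge>0. T (s + t) = T s o\<^sub>L T t) \<and>
     (\<forall>x. ((\<lambda>t. T t x) \<longlongrightarrow> x) (at_right 0))"

text \<open>
  The base space is real, so holomorphy in a sector is a statement about its complexification.
  The pair \<open>(x, y)\<close> stands for \<open>x + \<i> y\<close>, and \<open>cscale\<close> is the complex scalar multiplication.
\<close>

definition cscale :: "complex \<Rightarrow> 'a::real_vector \<times> 'a \<Rightarrow> 'a \<times> 'a" where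
  "cscale c p = (Re c *\<^sub>R fst p - Im c *\<^sub>R snd p, Re c *\<^sub>R snd p + Im c *\<^sub>R fst p)"

definition sector :: "real \<Rightarrow> complex set" where
  "sector \<theta> = {z. z \<noteq> 0 \<and> \<bar>Arg z\<bar> < \<theta>}"

text \<open>
  \<open>S\<close> is a semigroup of bounded complex-linear operators on the complexification, holomorphic in
  the open sector and strongly continuous at 0. Holomorphy is required strongly: the derivative
  of \<open>S(\<cdot>) p\<close> at \<open>z\<close> is complex multiplication by some vector \<open>q\<close>.
\<close>

definition holomorphic_semigroup ::
    "real \<Rightarrow> (complex \<Rightarrow> ('a::banach \<times> 'a) \<Rightarrow>\<^sub>L ('a \<times> 'a)) \<Rightarrow> bool" where
  "holomorphic_semigroup \<theta> S \<longleftrightarrow>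
     (\<forall>z\<in>sector \<theta>. \<forall>c p. S z (cscale c p) = cscale c (S z p)) \<and>
     (\<forall>z\<in>sector \<theta>. \<forall>w\<in>sector \<theta>. S (z + w) = S z o\<^sub>L S w) \<and>
     (\<forall>z\<in>sector \<theta>. \<forall>p. \<exists>q. ((\<lambda>w. S w p) has_derivative (\<lambda>h. cscale h q)) (at z)) \<and>
     (\<forall>p. ((\<lambda>z. S z p) \<longlongrightarrow> p) (at 0 within sector \<theta>))"

definition analytic_semigroup :: "(real \<Rightarrow> 'a::banach \<Rightarrow>\<^sub>L 'a) \<Rightarrow> bool" where
  "analytic_semigroup T \<longleftrightarrow> C0_semigroup T \<and>
     (\<exists>\<theta> S. 0 < \<theta> \<and> \<theta> \<le> pi / 2 \<and> holomorphic_semigroup \<theta> S \<and>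
        (\<forall>t>0. \<forall>x y. blinfun_apply (S (complex_of_real t)) (x, y) = (T t x, T t y)))"

text \<open>An unbounded operator is given by its domain \<open>D\<close> and a function \<open>B\<close>, of which only the
  values on \<open>D\<close> matter.\<close>

definition infinitesimal_generator ::
    "(real \<Rightarrow> 'a::banach \<Rightarrow>\<^sub>L 'a) \<Rightarrow> 'a set \<Rightarrow> ('a \<Rightarrow> 'a) \<Rightarrow> bool" where
  "infinitesimal_generator T D B \<longleftrightarrow>
     D = {x. \<exists>y. ((\<lambda>h. (1 / h) *\<^sub>R (T h x - x)) \<longlongrightarrow> y) (at_right 0)} \<and>
     (\<forall>x\<in>D. ((\<lambda>h. (1 / h) *\<^sub>R (T h x - x)) \<longlongrightarrow> B x) (at_right 0))"

section \<open>Resolvents\<close>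

text \<open>\<open>\<mu>\<close> is in the resolvent set of \<open>B\<close> and \<open>R = (\<mu> - B)\<^sup>-\<^sup>1\<close>.\<close>

definition is_resolvent ::
    "'a::banach set \<Rightarrow> ('a \<Rightarrow> 'a) \<Rightarrow> real \<Rightarrow> ('a \<Rightarrow>\<^sub>L 'a) \<Rightarrow> bool" where
  "is_resolvent D B \<mu> R \<longleftrightarrow>
     (\<forall>x. R x \<in> D \<and> \<mu> *\<^sub>R R x - B (R x) = x) \<and>
     (\<forall>x\<in>D. R (\<mu> *\<^sub>R x - B x) = x)"

definition compact_operator :: "('a::banach \<Rightarrow>\<^sub>L 'a) \<Rightarrow> bool" where
  "compact_operator K \<longleftrightarrow> (\<forall>S. bounded S \<longrightarrow> compact (closure (blinfun_apply K ` S)))"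

text \<open>By the resolvent identity, compactness at one point of the resolvent set is compactness
  at all of them.\<close>

definition compact_resolvent :: "'a::banach set \<Rightarrow> ('a \<Rightarrow> 'a) \<Rightarrow> bool" where
  "compact_resolvent D B \<longleftrightarrow> (\<exists>\<mu> R. is_resolvent D B \<mu> R \<and> compact_operator R)"

section \<open>Fractional power spaces\<close>

text \<open>
  The fractional powers are those of \<open>A\<^sub>1 = A + a\<close>, where \<open>a\<close> is any shift for which
  \<open>e\<^bsup>-A\<^sub>1 t\<^esup> = e\<^bsup>-a t\<^esup> T(t)\<close> decays exponentially. The spaces \<open>X\<^sup>\<gamma>\<close> do not depend on \<open>a\<close>, and
  the norms for different \<open>a\<close> are equivalent; \<open>a = 0\<close> is allowed when \<open>T\<close> itself decays.
\<close>

definition admissible_shift :: "(real \<Rightarrow> 'a::banach \<Rightarrow>\<^sub>L 'a) \<Rightarrow> real \<Rightarrow> bool" where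
  "admissible_shift T a \<longleftrightarrow>
     (\<exists>M. \<exists>\<delta>>0. \<forall>t\<ge>0. norm (exp (- a * t) *\<^sub>R T t) \<le> M * exp (- \<delta> * t))"

text \<open>\<open>A\<^sub>1\<^bsup>-\<gamma>\<^esup> x = \<Gamma>(\<gamma>)\<^sup>-\<^sup>1 \<integral>\<^sub>0\<^sup>\<infinity> t\<^bsup>\<gamma>-1\<^esup> e\<^bsup>-A\<^sub>1 t\<^esup> x dt\<close> for \<open>\<gamma> > 0\<close>; \<open>A\<^sub>1\<^sup>0\<close> is the identity.\<close>

definition neg_frac_power ::
    "(real \<Rightarrow> 'a::banach \<Rightarrow>\<^sub>L 'a) \<Rightarrow> real \<Rightarrow> real \<Rightarrow> 'a \<Rightarrow> 'a" where
  "neg_frac_power T a \<gamma> x =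
     (if \<gamma> = 0 then x
      else (1 / Gamma \<gamma>) *\<^sub>R
        integral {0<..} (\<lambda>t. (t powr (\<gamma> - 1) * exp (- a * t)) *\<^sub>R T t x))"

definition frac_space :: "(real \<Rightarrow> 'a::banach \<Rightarrow>\<^sub>L 'a) \<Rightarrow> real \<Rightarrow> real \<Rightarrow> 'a set" where
  "frac_space T a \<gamma> = range (neg_frac_power T a \<gamma>)"

text \<open>\<open>A\<^sub>1\<^sup>\<gamma>\<close> is the inverse of the injective operator \<open>A\<^sub>1\<^bsup>-\<gamma>\<^esup>\<close>; its values outside
  \<open>frac_space T a \<gamma>\<close> are meaningless.\<close>

definition frac_power ::
    "(real \<Rightarrow> 'a::banach \<Rightarrow>\<^sub>L 'a) \<Rightarrow> real \<Rightarrow> real \<Rightarrow> 'a \<Rightarrow> 'a" where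
  "frac_power T a \<gamma> = inv (neg_frac_power T a \<gamma>)"

definition frac_norm ::
    "(real \<Rightarrow> 'a::banach \<Rightarrow>\<^sub>L 'a) \<Rightarrow> real \<Rightarrow> real \<Rightarrow> 'a \<Rightarrow> real" where
  "frac_norm T a \<gamma> x = norm (frac_power T a \<gamma> x)"

definition frac_topology ::
    "(real \<Rightarrow> 'a::banach \<Rightarrow>\<^sub>L 'a) \<Rightarrow> real \<Rightarrow> real \<Rightarrow> 'a topology" where
  "frac_topology T a \<gamma> =
     Metric_space.mtopology (frac_space T a \<gamma>) (\<lambda>x y. frac_norm T a \<gamma> (x - y))"

definition positive_cone ::
    "(real \<Rightarrow> 'a::{banach, ordered_real_vector} \<Rightarrow>\<^sub>L 'a) \<Rightarrow> real \<Rightarrow> real \<Rightarrow> 'a set" where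
  "positive_cone T a \<gamma> = {x \<in> frac_space T a \<gamma>. 0 \<le> x}"

text \<open>
  \<open>B = -A\<close> has positive resolvent: \<open>(\<mu> + A)\<^sup>-\<^sup>1\<close> exists and preserves all cones \<open>C\<^sub>\<gamma>\<close> for
  \<open>\<mu> = 0\<close> and for all large real \<open>\<mu>\<close>. Positivity at \<open>\<mu> = 0\<close> alone would not make the
  semigroup positive: for the \<open>2 \<times> 2\<close> matrix \<open>A\<close> whose inverse has rows \<open>(1, 2)\<close> and \<open>(2, 1)\<close>,
  \<open>e\<^bsup>-At\<^esup>\<close> is not positive for small \<open>t > 0\<close>.
\<close>

definition positive_resolvent ::
    "(real \<Rightarrow> 'a::{banach, ordered_real_vector} \<Rightarrow>\<^sub>L 'a) \<Rightarrow> real \<Rightarrow> 'a set \<Rightarrow> ('a \<Rightarrow> 'a) \<Rightarrow> bool"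
    where
  "positive_resolvent T a D B \<longleftrightarrow>
     (\<exists>R. is_resolvent D B 0 R \<and>
        (\<forall>\<gamma>\<ge>0. blinfun_apply R ` positive_cone T a \<gamma> \<subseteq> positive_cone T a \<gamma>)) \<and>
     (\<exists>\<omega>. \<forall>\<mu>>\<omega>. \<exists>R. is_resolvent D B \<mu> R \<and>
        (\<forall>\<gamma>\<ge>0. blinfun_apply R ` positive_cone T a \<gamma> \<subseteq> positive_cone T a \<gamma>))"

section \<open>Mild solutions\<close>

definition mild_solution ::
    "(real \<Rightarrow> 'a::banach \<Rightarrow>\<^sub>L 'a) \<Rightarrow> real \<Rightarrow> real \<Rightarrow> ('a \<Rightarrow> 'a) \<Rightarrow> 'a \<Rightarrow> real \<Rightarrow> (real \<Rightarrow> 'a) \<Rightarrow> bool"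
    where
  "mild_solution T a \<alpha> g w \<tau> u \<longleftrightarrow>
     continuous_map (top_of_set {0..\<tau>}) (frac_topology T a \<alpha>) u \<and>
     (\<forall>t\<in>{0..\<tau>}. u t = T t w + integral {0..t} (\<lambda>s. T (t - s) (g (u s))))"

text \<open>
  \<open>J\<close> is one of \<open>[0, \<tau>]\<close>, \<open>[0, \<tau>)\<close> with \<open>\<tau> > 0\<close>, or \<open>[0, \<infinity>)\<close>; the degenerate interval
  \<open>{0}\<close> is excluded.
\<close>

definition mild_solution_on ::
    "(real \<Rightarrow> 'a::banach \<Rightarrow>\<^sub>L 'a) \<Rightarrow> real \<Rightarrow> real \<Rightarrow> ('a \<Rightarrow> 'a) \<Rightarrow> 'a \<Rightarrow> real set \<Rightarrow> (real \<Rightarrow> 'a) \<Rightarrow> bool"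
    where
  "mild_solution_on T a \<alpha> g w J u \<longleftrightarrow>
     is_interval J \<and> 0 \<in> J \<and> J \<subseteq> {0..} \<and> J \<noteq> {0} \<and>
     (\<forall>\<tau>\<in>J. mild_solution T a \<alpha> g w \<tau> u)"

definition maximal_mild_solution_on ::
    "(real \<Rightarrow> 'a::banach \<Rightarrow>\<^sub>L 'a) \<Rightarrow> real \<Rightarrow> real \<Rightarrow> ('a \<Rightarrow> 'a) \<Rightarrow> 'a \<Rightarrow> real set \<Rightarrow> (real \<Rightarrow> 'a) \<Rightarrow> bool"
    where
  "maximal_mild_solution_on T a \<alpha> g w J u \<longleftrightarrow>
     mild_solution_on T a \<alpha> g w J u \<and>
     \<not> (\<exists>J' u'. J \<subset> J' \<and> mild_solution_on T a \<alpha> g w J' u' \<and> (\<forall>t\<in>J. u' t = u t))"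

lemma mild_solution_on_Icc:
  assumes "0 < \<tau>"
  shows "mild_solution_on T a \<alpha> g w {0..\<tau>} u \<longleftrightarrow> mild_solution T a \<alpha> g w \<tau> u"
proof
  assume "mild_solution_on T a \<alpha> g w {0..\<tau>} u"
  then show "mild_solution T a \<alpha> g w \<tau> u"
    using assms by (auto simp: mild_solution_on_def)
next
  assume u: "mild_solution T a \<alpha> g w \<tau> u"
  have "mild_solution T a \<alpha> g w \<sigma> u" if "\<sigma> \<in> {0..\<tau>}" for \<sigma>
  proof -
    have "{0..\<sigma>} \<subseteq> {0..\<tau>}"
      using that by auto
    then show ?thesis
      using u continuous_map_from_subtopology_mono
      unfolding mild_solution_def by blast
  qed
  moreover have "{0..\<tau>} \<noteq> {0}"
    using assms by (metis atLeastAtMost_iff less_eq_real_def order_refl singletonD less_irrefl)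
  ultimately show "mild_solution_on T a \<alpha> g w {0..\<tau>} u"
    using assms by (auto simp: mild_solution_on_def is_interval_cc)
qed

end

theory Submission
  imports Defs "HOL-Complex_Analysis.Complex_Analysis"
begin

text \<open>
  Write \<open>P = A\<^sub>1\<^bsup>-\<alpha>\<^esup>\<close>, so that \<open>u = P y\<close> identifies \<open>X\<^sup>\<alpha>\<close> with \<open>X\<close> and a mild solution becomes a
  solution of a Volterra equation with the kernel \<open>K(t) = A\<^sub>1\<^sup>\<alpha> T(t)\<close>. Analyticity gives
  \<open>norm (K t) = O(t\<^bsup>-\<alpha>\<^esup>)\<close>, and the compact resolvent makes \<open>T(t)\<close> compact for \<open>t > 0\<close>; the
  exponential formula turns positivity of the resolvent into positivity of \<open>T(t)\<close>.

  Replacing \<open>A\<close> by \<open>A + k\<close> we may assume that the larger nonlinearity is increasing. Given a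
  solution \<open>u\<close>, a solution below it is the limit of explicit approximations \<open>v\<close> in which the
  nonlinearity is evaluated at \<open>v(s - d) + u(s) - u(s - d)\<close>. This argument is at most \<open>u(s)\<close> if
  \<open>v \<le> u\<close> at time \<open>s - d\<close>, so positivity of the semigroup propagates \<open>v \<le> u\<close>, and compactness
  allows \<open>d\<close> to tend to 0. A maximal one among the solutions below \<open>u\<close> is a maximal solution, because
  at any time before the end of the domain of \<open>u\<close> the local construction can be restarted. The
  results with the order reversed follow from \<open>u \<mapsto> -u\<close>.
\<close>

section \<open>Norming functionals, integrals and compactness in Banach spaces\<close>

text \<open>The nonlinearities are merely continuous, so solutions need not be unique and comparison
  means construction: the second solution has to be produced together with the inequality. The order
  need not be a lattice, so a nonlinearity cannot be truncated at the minimum of \<open>v\<close>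
  and \<open>u\<close>, and order intervals need not be bounded, so monotone iteration has no reason
  to converge. The delayed argument takes the place of truncation: \<open>v (s - d)\<close> alone is
  comparable only with \<open>u (s - d)\<close>, and the increment \<open>u s - u (s - d)\<close>
  moves the comparison to time \<open>s\<close> while vanishing with \<open>d\<close>. Monotonicity
  is asked of the nonlinearity of the given solution because the chain gv(v) \<le> gu(v) \<le>
  gu(u), up to the shift by k, passes through it. Existence rests on compactness, and analyticity
  serves it twice: T(t) factors through a resolvent for t > 0, and the kernel has an integrable
  singularity. Identities and estimates for vectors are reduced to scalar ones by bounded
  functionals, whence the Hahn-Banach argument.\<close>

definition sublinear :: "('a::real_vector \<Rightarrow> real) \<Rightarrow> bool" where
  "sublinear p \<longleftrightarrow> (\<forall>x y. p (x + y) \<le> p x + p y) \<and> (\<forall>c\<ge>0. \<forall>x. p (c *\<^sub>R x) = c * p x)"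

lemma sublinear_0: "sublinear p \<Longrightarrow> p 0 = 0"
  unfolding sublinear_def by (metis mult_zero_left order_refl scaleR_zero_left)

lemma sublinear_neg_le: "sublinear p \<Longrightarrow> - p (- x) \<le> p x"
proof -
  assume p: "sublinear p"
  then have "p (x + - x) \<le> p x + p (- x)" unfolding sublinear_def by blast
  then show "- p (- x) \<le> p x" using sublinear_0[OF p] by simp
qed

text \<open>Auxiliary functional of the Hahn-Banach argument: t = 0 places \<open>q\<close> below
  \<open>p\<close>, and t = 1 gives q (- y) \<le> - p y, so that \<open>q\<close> is pushed down in
  the direction \<open>- y\<close>. The infimum is finite because subadditivity bounds every term
  below by - p (- x).\<close>

lemma sublinear_directional:
  fixes p :: "'a::real_vector \<Rightarrow> real" and y :: 'a
  assumes p: "sublinear p"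
  defines "q \<equiv> \<lambda>x. INF t\<in>{0..}. p (x + t *\<^sub>R y) - t * p y"
  shows "sublinear q" "\<And>x t. 0 \<le> t \<Longrightarrow> q x \<le> p (x + t *\<^sub>R y) - t * p y"
proof -
  have sub: "p (x + z) \<le> p x + p z" and hom: "0 \<le> c \<Longrightarrow> p (c *\<^sub>R x) = c * p x" for x z c
    using p unfolding sublinear_def by auto
  have lb: "- p (- x) \<le> p (x + t *\<^sub>R y) - t * p y" if "0 \<le> t" for x t
    using sub[of "x + t *\<^sub>R y" "- x"] hom[OF that, of y] by simp
  then have bdd: "bdd_below ((\<lambda>t. p (x + t *\<^sub>R y) - t * p y) ` {0..})" for x
    by (auto simp: bdd_below_def)
  show le: "q x \<le> p (x + t *\<^sub>R y) - t * p y" if "0 \<le> t" for x t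
    unfolding q_def by (rule cINF_lower[OF bdd]) (use that in auto)
  have add: "q (x + z) \<le> q x + q z" for x z
  proof -
    have 1: "q (x + z) \<le> (p (x + s *\<^sub>R y) - s * p y) + (p (z + t *\<^sub>R y) - t * p y)"
      if "0 \<le> s" "0 \<le> t" for s t
      using le[of "s + t" "x + z"] sub[of "x + s *\<^sub>R y" "z + t *\<^sub>R y"] that
      by (simp add: algebra_simps)
    have 2: "q (x + z) - (p (z + t *\<^sub>R y) - t * p y) \<le> q x" if "0 \<le> t" for t
      unfolding q_def[abs_def] by (rule cINF_greatest) (use 1 that in \<open>auto simp: q_def algebra_simps\<close>)
    have "q (x + z) - q x \<le> q z"
      using 2 by (subst (2) q_def, intro cINF_greatest) (auto simp: algebra_simps)
    then show ?thesis by simp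
  qed
  have hom1: "c * q x \<le> q (c *\<^sub>R x)" if "0 < c" for c x
    unfolding q_def
  proof (rule cINF_greatest)
    fix t :: real assume t: "t \<in> {0..}"
    have "p (c *\<^sub>R x + t *\<^sub>R y) = c * p (x + (t / c) *\<^sub>R y)"
      using hom[of c "x + (t / c) *\<^sub>R y"] that by (simp add: algebra_simps)
    then have "p (c *\<^sub>R x + t *\<^sub>R y) - t * p y = c * (p (x + (t / c) *\<^sub>R y) - (t / c) * p y)"
      using that by (simp add: algebra_simps)
    moreover have "q x \<le> p (x + (t / c) *\<^sub>R y) - (t / c) * p y"
      using le[of "t / c" x] t that by simp
    ultimately show "c * (INF t\<in>{0..}. p (x + t *\<^sub>R y) - t * p y) \<le> p (c *\<^sub>R x + t *\<^sub>R y) - t * p y"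
      using that by (simp add: q_def)
  qed simp
  have hom2: "q (c *\<^sub>R x) = c * q x" if "0 < c" for c x
  proof -
    have "(1 / c) * q (c *\<^sub>R x) \<le> q x"
      using hom1[of "1 / c" "c *\<^sub>R x"] that by simp
    then have "q (c *\<^sub>R x) \<le> c * q x"
      using that by (simp add: field_simps)
    with hom1[OF that, of x] show ?thesis by simp
  qed
  have "q 0 = 0"
  proof (rule antisym)
    show "q 0 \<le> 0" using le[of 0 0] sublinear_0[OF p] by simp
    show "0 \<le> q 0" unfolding q_def by (rule cINF_greatest) (use hom in auto)
  qed
  then have "q (c *\<^sub>R x) = c * q x" if "0 \<le> c" for c x
    using hom2[of c x] that by (cases "c = 0") auto
  with add show "sublinear q"
    unfolding sublinear_def by blast
qed

text \<open>Minimal sublinear functionals are linear, because replacing \<open>p\<close> by its directional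
  infimum along \<open>y\<close> must not decrease it.\<close>

lemma sublinear_dominates_linear:
  fixes p :: "'a::real_vector \<Rightarrow> real"
  assumes "sublinear p"
  obtains f where "linear f" "\<And>x. f x \<le> p x"
proof -
  define S where "S = {q. sublinear q \<and> q \<le> p}"
  \<comment> \<open>The order is reversed, so that Zorn's lemma yields a minimal sublinear
    functional below \<open>p\<close>.\<close>
  have po: "partial_order_on S (relation_of (\<lambda>q r. r \<le> q) S)"
    by (rule partial_order_on_relation_ofI) auto
  have "\<exists>m\<in>S. \<forall>q\<in>S. q \<le> m \<longrightarrow> q = m"
  proof (rule predicate_Zorn[OF po])
    fix C assume C: "C \<in> Chains (relation_of (\<lambda>q r. r \<le> q) S)"
    then have CS: "C \<subseteq> S" and ch: "\<And>q r. q \<in> C \<Longrightarrow> r \<in> C \<Longrightarrow> q \<le> r \<or> r \<le> q"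
      by (auto simp: Chains_def relation_of_def)
    show "\<exists>u\<in>S. \<forall>q\<in>C. u \<le> q"
    proof (cases "C = {}")
      case True
      then show ?thesis using assms by (auto simp: S_def)
    next
      case False
      define u where "u x = (INF q\<in>C. q x)" for x
      have lb: "- p (- x) \<le> q x" if "q \<in> C" for q x
      proof -
        have "sublinear q" "q (- x) \<le> p (- x)" using that CS by (auto simp: S_def le_fun_def)
        with sublinear_neg_le[of q x] show ?thesis by linarith
      qed
      then have le: "u x \<le> q x" if "q \<in> C" for q x
        unfolding u_def by (intro cINF_lower[OF _ that]) (auto simp: bdd_below_def)
      have sub: "q (x + z) \<le> q x + q z" and hom: "0 \<le> c \<Longrightarrow> q (c *\<^sub>R x) = c * q x"
        if "q \<in> C" for q x z c
        using that CS unfolding sublinear_def S_def by auto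
      have "u (x + z) \<le> u x + u z" for x z
      proof -
        have 1: "u (x + z) \<le> q x + r z" if q: "q \<in> C" and r: "r \<in> C" for q r
        proof -
          \<comment> \<open>The smaller of \<open>q\<close> and \<open>r\<close> bounds both values
            at once; this makes the infimum over a chain subadditive.\<close>
          obtain s where "s \<in> C" "s \<le> q" "s \<le> r"
            using ch[OF q r] q r by auto
          then have "s x \<le> q x" "s z \<le> r z" by (auto simp: le_fun_def)
          then show ?thesis using le[OF \<open>s \<in> C\<close>, of "x + z"] sub[OF \<open>s \<in> C\<close>, of x z] by linarith
        qed
        have 2: "u (x + z) - r z \<le> u x" if "r \<in> C" for r
          unfolding u_def[of x] by (rule cINF_greatest) (use 1 that False in \<open>auto simp: algebra_simps\<close>)
        have "u (x + z) - u x \<le> u z"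
          unfolding u_def[of z] by (rule cINF_greatest) (use 2 False in \<open>auto simp: algebra_simps\<close>)
        then show ?thesis by simp
      qed
      moreover have hom1: "c * u x \<le> u (c *\<^sub>R x)" if "0 \<le> c" for c x
        unfolding u_def[of "c *\<^sub>R x"]
      proof (rule cINF_greatest[OF False])
        fix q assume "q \<in> C"
        then show "c * u x \<le> q (c *\<^sub>R x)"
          using hom[of q c x] le[of q x] that by (simp add: mult_left_mono)
      qed
      moreover have "u (c *\<^sub>R x) \<le> c * u x" if "0 \<le> c" for c x
      proof (cases "c = 0")
        case True
        obtain q where "q \<in> C" using False by auto
        then show ?thesis using le[of q 0] sub hom[of q 0] True by force
      next
        case c: False
        then show ?thesis
          using hom1[of "1 / c" "c *\<^sub>R x"] that by (simp add: field_simps)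
      qed
      ultimately have "sublinear u"
        unfolding sublinear_def by (meson antisym)
      moreover have "u \<le> p"
      proof -
        obtain q where "q \<in> C" using False by auto
        then have "u x \<le> q x" "q x \<le> p x" for x
          using le CS by (auto simp: S_def le_fun_def)
        then show ?thesis unfolding le_fun_def using order_trans by blast
      qed
      ultimately show ?thesis
        using le unfolding S_def le_fun_def by blast
    qed
  qed
  then obtain m where m: "m \<in> S" and min: "\<And>q. q \<in> S \<Longrightarrow> q \<le> m \<Longrightarrow> q = m"
    by blast
  have sm: "sublinear m" and mp: "m \<le> p" using m by (auto simp: S_def)
  have "m x + m y \<le> m (x + y)" for x y
  proof -
    define q where "q = (\<lambda>x. INF t\<in>{0..}. m (x + t *\<^sub>R y) - t * m y)"
    have q: "sublinear q" and le: "\<And>x t. 0 \<le> t \<Longrightarrow> q x \<le> m (x + t *\<^sub>R y) - t * m y"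
      using sublinear_directional[OF sm, where y=y] by (auto simp: q_def)
    have "q \<le> m" using le[of 0] by (auto simp: le_fun_def)
    then have "q = m"
      using min q mp by (auto simp: S_def)
    then show ?thesis using le[of 1 x] by simp
  qed
  then have add: "m (x + y) = m x + m y" for x y
    using sm by (auto simp: sublinear_def intro: antisym)
  have neg: "m (- x) = - m x" for x
    using add[of x "- x"] sublinear_0[OF sm] by simp
  have "m (c *\<^sub>R x) = c * m x" for c x
  proof (cases "0 \<le> c")
    case True then show ?thesis using sm by (auto simp: sublinear_def)
  next
    case False
    have "\<And>c x. 0 \<le> c \<Longrightarrow> m (c *\<^sub>R x) = c * m x" using sm unfolding sublinear_def by blast
    from this[of "- c" x] have "m ((- c) *\<^sub>R x) = (- c) * m x" using False by simp
    then show ?thesis using neg[of "c *\<^sub>R x"] by simp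
  qed
  then have "linear m"
    by (intro linearI) (auto simp: add)
  with mp show thesis using that by (auto simp: le_fun_def)
qed

text \<open>A linear functional below the directional infimum of the norm along \<open>x\<close> is
  below the norm, and at \<open>- x\<close> it is at most norm (- x + x) - norm x = - norm x, which
  forces equality at \<open>x\<close>. No extension from a subspace occurs.\<close>

lemma norming_functional:
  fixes x :: "'a::real_normed_vector"
  obtains f :: "'a \<Rightarrow> real" where "bounded_linear f" "\<And>y. \<bar>f y\<bar> \<le> norm y" "f x = norm x"
proof -
  have sn: "sublinear (norm :: 'a \<Rightarrow> real)"
    by (auto simp: sublinear_def norm_triangle_ineq)
  define q where "q = (\<lambda>y. INF t\<in>{0..}. norm (y + t *\<^sub>R x) - t * norm x)"
  have q: "sublinear q" and le: "\<And>y t. 0 \<le> t \<Longrightarrow> q y \<le> norm (y + t *\<^sub>R x) - t * norm x"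
    using sublinear_directional[OF sn, where y=x] by (auto simp: q_def)
  obtain f where f: "linear f" and fq: "\<And>y. f y \<le> q y"
    using sublinear_dominates_linear[OF q] by blast
  have fn: "f y \<le> norm y" for y using fq[of y] le[of 0 y] by simp
  have b: "\<bar>f y\<bar> \<le> norm y" for y
    using fn[of y] fn[of "- y"] linear_neg[OF f, of y] by (simp add: abs_le_iff)
  have "- f x \<le> - norm x"
    using fq[of "- x"] le[of 1 "- x"] linear_neg[OF f, of x] by simp
  then have "f x = norm x" using fn[of x] by simp
  moreover have "bounded_linear f"
    by (rule bounded_linear_intro[of _ 1]) (use f b in \<open>auto simp: linear_add linear_scale\<close>)
  ultimately show thesis using that b by blast
qed

text \<open>Allows an identity between vector-valued integrals to be checked on scalar functions,
  where Fubini applies.\<close>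

lemma eq_if_functionals_eq:
  fixes x y :: "'a::real_normed_vector"
  assumes "\<And>f :: 'a \<Rightarrow> real. bounded_linear f \<Longrightarrow> f x = f y"
  shows "x = y"
proof -
  obtain f :: "'a \<Rightarrow> real" where f: "bounded_linear f" "f (x - y) = norm (x - y)"
    by (rule norming_functional[of "x - y"])
  then have "f x - f y = norm (x - y)"
    by (metis linear_diff bounded_linear.linear)
  then show ?thesis using assms[OF f(1)] by simp
qed

section \<open>Integrability of Banach-valued functions and positivity of integrals\<close>

lemma norm_diff_triangle_quarters:
  fixes u v u' v' :: "'a::real_normed_vector"
  assumes "norm (u - u') \<le> e / 4" "norm (v - v') \<le> e / 4" "norm (u' - v') < e / 4"
  shows "norm (u - v) < e"
proof -
  have "u - v = (u - u') + (u' - v') - (v - v')" by simp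
  then have "norm (u - v) \<le> norm (u - u') + norm (u' - v') + norm (v - v')"
    by (metis norm_triangle_le_diff norm_triangle_le add_mono order_refl)
  then show ?thesis using assms norm_ge_zero[of "u' - v'"] by linarith
qed

text \<open>Cauchy criterion for Riemann sums: over one fine tagged division the sums of
  \<open>f\<close> and \<open>g\<close> differ by at most the sum of \<open>h\<close>, which is
  close to its small integral. In effect integrability is closed under approximation in
  mean.\<close>

lemma integrable_approx_cbox:
  fixes f :: "'n::euclidean_space \<Rightarrow> 'a::banach"
  assumes "\<And>e. 0 < e \<Longrightarrow> \<exists>g h. g integrable_on cbox a b \<and> h integrable_on cbox a b \<and>
      (\<forall>x\<in>cbox a b. norm (f x - g x) \<le> h x) \<and> integral (cbox a b) h \<le> (e::real)"
  shows "f integrable_on cbox a b"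
  unfolding integrable_Cauchy
proof (intro allI impI)
  fix e :: real assume "0 < e"
  then obtain g h where g: "g integrable_on cbox a b" and h: "h integrable_on cbox a b"
    and fg: "\<And>x. x \<in> cbox a b \<Longrightarrow> norm (f x - g x) \<le> h x" and ih: "integral (cbox a b) h \<le> e / 8"
    using assms[of "e / 8"] by auto
  obtain \<gamma>1 where g1: "gauge \<gamma>1" and
    c1: "\<And>p1 p2. p1 tagged_division_of cbox a b \<Longrightarrow> \<gamma>1 fine p1 \<Longrightarrow>
       p2 tagged_division_of cbox a b \<Longrightarrow> \<gamma>1 fine p2 \<Longrightarrow>
       norm ((\<Sum>(x,K)\<in>p1. measure lborel K *\<^sub>R g x) - (\<Sum>(x,K)\<in>p2. measure lborel K *\<^sub>R g x)) < e / 4"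
    using g[unfolded integrable_Cauchy, rule_format, of "e / 4"] \<open>0 < e\<close> by auto
  obtain \<gamma>2 where g2: "gauge \<gamma>2" and
    c2: "\<And>p. p tagged_division_of cbox a b \<Longrightarrow> \<gamma>2 fine p \<Longrightarrow>
       norm ((\<Sum>(x,K)\<in>p. measure lborel K *\<^sub>R h x) - integral (cbox a b) h) < e / 8"
    using integrable_integral[OF h, unfolded has_integral, rule_format, of "e / 8"] \<open>0 < e\<close> by auto
  have near: "norm ((\<Sum>(x,K)\<in>p. measure lborel K *\<^sub>R f x) - (\<Sum>(x,K)\<in>p. measure lborel K *\<^sub>R g x)) < e / 4"
    if p: "p tagged_division_of cbox a b" and fine: "\<gamma>2 fine p" for p
  proof -
    have "norm ((\<Sum>(x,K)\<in>p. measure lborel K *\<^sub>R f x) - (\<Sum>(x,K)\<in>p. measure lborel K *\<^sub>R g x))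
        = norm (\<Sum>(x,K)\<in>p. measure lborel K *\<^sub>R (f x - g x))"
      by (simp add: sum_subtractf[symmetric] case_prod_unfold scaleR_diff_right)
    also have "\<dots> \<le> (\<Sum>(x,K)\<in>p. measure lborel K *\<^sub>R h x)"
    proof (rule sum_norm_le)
      fix z assume z: "z \<in> p"
      obtain x K where xK: "z = (x, K)" by force
      have "x \<in> cbox a b" using p z xK by (metis tag_in_interval)
      then show "norm (case z of (x, K) \<Rightarrow> measure lborel K *\<^sub>R (f x - g x)) \<le> (case z of (x, K) \<Rightarrow> measure lborel K *\<^sub>R h x)"
        using fg by (simp add: xK mult_left_mono)
    qed
    also have "\<dots> < e / 4" using c2[OF p fine] ih unfolding real_norm_def by linarith
    finally show ?thesis .
  qed
  show "\<exists>\<gamma>. gauge \<gamma> \<and> (\<forall>p1 p2. p1 tagged_division_of cbox a b \<and> \<gamma> fine p1 \<and>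
      p2 tagged_division_of cbox a b \<and> \<gamma> fine p2 \<longrightarrow>
      norm ((\<Sum>(x,K)\<in>p1. measure lborel K *\<^sub>R f x) - (\<Sum>(x,K)\<in>p2. measure lborel K *\<^sub>R f x)) < e)"
  proof (rule exI[of _ "\<lambda>x. \<gamma>1 x \<inter> \<gamma>2 x"], rule conjI, rule gauge_Int[OF g1 g2],
      intro allI impI, elim conjE)
    fix p1 p2
    assume p: "p1 tagged_division_of cbox a b" "p2 tagged_division_of cbox a b"
      and "(\<lambda>x. \<gamma>1 x \<inter> \<gamma>2 x) fine p1" "(\<lambda>x. \<gamma>1 x \<inter> \<gamma>2 x) fine p2"
    then have fine: "\<gamma>1 fine p1" "\<gamma>2 fine p1" "\<gamma>1 fine p2" "\<gamma>2 fine p2"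
      by (auto simp: fine_Int)
    show "norm ((\<Sum>(x,K)\<in>p1. measure lborel K *\<^sub>R f x) - (\<Sum>(x,K)\<in>p2. measure lborel K *\<^sub>R f x)) < e"
      by (rule norm_diff_triangle_quarters[OF less_imp_le[OF near[OF p(1) fine(2)]] less_imp_le[OF near[OF p(2) fine(4)]] c1[OF p(1) fine(1) p(2) fine(3)]])
  qed
qed

text \<open>Extension by zero reduces the claim to boxes. Integrals of \<open>f\<close> over two
  large boxes are compared through those of \<open>g\<close>; each exchange costs at most the
  integral of \<open>h\<close>, which is nonnegative on \<open>S\<close> as it dominates a
  norm.\<close>

lemma integrable_approx:
  fixes f :: "'n::euclidean_space \<Rightarrow> 'a::banach"
  assumes app: "\<And>e. 0 < e \<Longrightarrow> \<exists>g h. g integrable_on S \<and> h integrable_on S \<and>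
      (\<forall>x\<in>S. norm (f x - g x) \<le> h x) \<and> integral S h \<le> (e::real)"
  shows "f integrable_on S"
proof -
  define R where "R k = (\<lambda>x. if x \<in> S then k x else 0)" for k :: "'n \<Rightarrow> 'a"
  define Q where "Q k = (\<lambda>x. if x \<in> S then k x else 0)" for k :: "'n \<Rightarrow> real"
  have box: "R g integrable_on cbox a b" "Q h integrable_on cbox a b"
      "norm (R f x - R g x) \<le> Q h x" "integral (cbox a b) (Q h) \<le> e"
    if g: "g integrable_on S" and h: "h integrable_on S" and
      fg: "\<And>x. x \<in> S \<Longrightarrow> norm (f x - g x) \<le> h x" and ih: "integral S h \<le> e" for g h e a b x
  proof -
    show "R g integrable_on cbox a b" and q: "Q h integrable_on cbox a b"
      using integrable_altD(1)[OF g, of a b] integrable_altD(1)[OF h, of a b]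
      by (auto simp: R_def Q_def cong: if_cong)
    show "norm (R f x - R g x) \<le> Q h x" using fg by (auto simp: R_def Q_def)
    have pos: "0 \<le> Q h x" for x
      using fg[of x] norm_ge_zero[of "f x - g x"] by (auto simp: Q_def simp del: norm_ge_zero)
    have "integral (cbox a b) (Q h) \<le> integral UNIV (Q h)"
      using h pos by (intro integral_subset_le q) (auto simp: Q_def integrable_restrict_UNIV)
    also have "\<dots> = integral S h" unfolding Q_def by (simp add: integral_restrict_UNIV)
    finally show "integral (cbox a b) (Q h) \<le> e" using ih by simp
  qed
  have int: "R f integrable_on cbox a b" for a b
  proof (rule integrable_approx_cbox)
    fix e :: real assume "0 < e"
    from app[OF this] obtain g h where *: "g integrable_on S" "h integrable_on S"
      "\<And>x. x \<in> S \<Longrightarrow> norm (f x - g x) \<le> h x" "integral S h \<le> e" by auto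
    show "\<exists>g h. g integrable_on cbox a b \<and> h integrable_on cbox a b \<and>
      (\<forall>x\<in>cbox a b. norm (R f x - g x) \<le> h x) \<and> integral (cbox a b) h \<le> e"
      using box[OF *] by blast
  qed
  show ?thesis
  proof (subst integrable_alt, fold R_def, intro conjI allI impI int)
    fix e :: real assume "0 < e"
    then obtain g h where *: "g integrable_on S" "h integrable_on S"
      "\<And>x. x \<in> S \<Longrightarrow> norm (f x - g x) \<le> h x" "integral S h \<le> e / 4"
      using app[of "e / 4"] by auto
    note bx = box[OF *]
    obtain B where "0 < B" and B: "\<And>a b c d. ball 0 B \<subseteq> cbox a b \<Longrightarrow> ball 0 B \<subseteq> cbox c d \<Longrightarrow>
       norm (integral (cbox a b) (R g) - integral (cbox c d) (R g)) < e / 4"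
      using integrable_altD(2)[OF *(1), of "e / 4"] \<open>0 < e\<close> unfolding R_def by auto
    have near: "norm (integral (cbox a b) (R f) - integral (cbox a b) (R g)) \<le> e / 4" for a b
    proof -
      have "norm (integral (cbox a b) (R f) - integral (cbox a b) (R g))
          = norm (integral (cbox a b) (\<lambda>x. R f x - R g x))"
        using int bx(1) by (simp add: integral_diff)
      also have "\<dots> \<le> integral (cbox a b) (Q h)"
        by (rule integral_norm_bound_integral) (use int bx in \<open>auto intro: integrable_diff\<close>)
      finally show ?thesis using bx(4)[of a b] by simp
    qed
    show "\<exists>B>0. \<forall>a b c d. ball 0 B \<subseteq> cbox a b \<and> ball 0 B \<subseteq> cbox c d \<longrightarrow>
        norm (integral (cbox a b) (R f) - integral (cbox c d) (R f)) < e"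
    proof (intro exI conjI allI impI, rule \<open>0 < B\<close>, elim conjE)
      fix a b c d :: 'n assume s: "ball 0 B \<subseteq> cbox a b" "ball 0 B \<subseteq> cbox c d"
      show "norm (integral (cbox a b) (R f) - integral (cbox c d) (R f)) < e"
        by (rule norm_diff_triangle_quarters[OF near near B[OF s]])
    qed
  qed
qed

text \<open>Cutting \<open>f\<close> off outside a member of the exhaustion leaves an error
  dominated by \<open>h\<close> on the remainder, whose integral vanishes by scalar dominated
  convergence. Continuity is demanded on compact intervals only, so \<open>f\<close> may be singular
  or slowly decaying at the ends of \<open>S\<close>.\<close>

lemma
  fixes f :: "real \<Rightarrow> 'a::banach" and h :: "real \<Rightarrow> real"
  assumes f: "\<And>n. continuous_on {a n..b n} f" and h: "h integrable_on S"
    and fh: "\<And>x. x \<in> S \<Longrightarrow> norm (f x) \<le> h x"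
    and S: "S = (\<Union>n::nat. {a n..b n})" "\<And>n. {a n..b n} \<subseteq> {a (Suc n)..b (Suc n)}"
  shows dominated_integrable_continuous: "f integrable_on S"
    and dominated_integral_exhaustion: "(\<lambda>n. integral {a n..b n} f) \<longlonglongrightarrow> integral S f"
proof -
  define K where "K n = {a n..b n}" for n
  have KS: "K n \<subseteq> S" for n using S by (auto simp: K_def)
  have inc: "m \<le> n \<Longrightarrow> K m \<subseteq> K n" for m n
    using lift_Suc_mono_le[of K m n] S(2) by (auto simp: K_def)
  have hpos: "0 \<le> h x" if "x \<in> S" for x using fh[OF that] norm_ge_zero order_trans by blast
  have hK: "(\<lambda>x. if x \<in> K n then 0 else h x) integrable_on S" for n
  proof -
    have "h integrable_on K n"
      using integrable_on_subinterval[OF h] KS by (simp add: K_def)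
    then have "(\<lambda>x. if x \<in> K n then h x else 0) integrable_on S"
      using KS by (metis (no_types) integrable_restrict_Int inf.absorb1)
    then have "(\<lambda>x. h x - (if x \<in> K n then h x else 0)) integrable_on S"
      by (rule integrable_diff[OF h])
    then show ?thesis by (rule integrable_eq) auto
  qed
  have "(\<lambda>n. integral S (\<lambda>x. if x \<in> K n then 0 else h x)) \<longlonglongrightarrow> integral S (\<lambda>x. 0::real)"
  proof (rule dominated_convergence(2)[OF hK h])
    show "norm (if x \<in> K n then 0 else h x) \<le> h x" if "x \<in> S" for n x
      using hpos[OF that] by auto
    show "(\<lambda>n. if x \<in> K n then 0 else h x) \<longlonglongrightarrow> 0" if "x \<in> S" for x
    proof -
      have "x \<in> (\<Union>n. K n)" using that S(1) by (simp add: K_def)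
      then obtain m where "x \<in> K m" by blast
      then have "\<forall>\<^sub>F n in sequentially. (if x \<in> K n then 0 else h x) = 0"
        using inc by (auto simp: eventually_sequentially)
      then show ?thesis by (rule tendsto_eventually)
    qed
  qed
  then have lim: "(\<lambda>n. integral S (\<lambda>x. if x \<in> K n then 0 else h x)) \<longlonglongrightarrow> 0" by simp
  have fK: "(\<lambda>x. if x \<in> K n then f x else 0) integrable_on S" for n
  proof -
    have "f integrable_on K n"
      unfolding K_def by (rule integrable_continuous_real) (rule f)
    then show ?thesis
      using KS by (metis (no_types) integrable_restrict_Int inf.absorb1)
  qed
  have bd: "norm (f x - (if x \<in> K n then f x else 0)) \<le> (if x \<in> K n then 0 else h x)" if "x \<in> S" for x n
    using fh[OF that] by auto
  show fint: "f integrable_on S"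
  proof (rule integrable_approx)
    fix e :: real assume e: "0 < e"
    have "\<forall>\<^sub>F n in sequentially. integral S (\<lambda>x. if x \<in> K n then 0 else h x) < e"
      by (rule order_tendstoD(2)[OF lim e])
    then obtain n where n: "integral S (\<lambda>x. if x \<in> K n then 0 else h x) < e"
      by (auto simp: eventually_sequentially)
    show "\<exists>g h. g integrable_on S \<and> h integrable_on S \<and>
        (\<forall>x\<in>S. norm (f x - g x) \<le> h x) \<and> integral S h \<le> e"
      using hK fK bd n less_imp_le by blast
  qed
  have "norm (integral (K n) f - integral S f) \<le> integral S (\<lambda>x. if x \<in> K n then 0 else h x)" for n
  proof -
    have "integral (K n) f = integral S (\<lambda>x. if x \<in> K n then f x else 0)"
      using KS[of n] by (simp add: integral_restrict_Int inf.absorb1)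
    then have "norm (integral (K n) f - integral S f) = norm (integral S (\<lambda>x. f x - (if x \<in> K n then f x else 0)))"
      using fint fK by (simp add: integral_diff norm_minus_commute)
    also have "\<dots> \<le> integral S (\<lambda>x. if x \<in> K n then 0 else h x)"
      by (rule integral_norm_bound_integral) (use fint fK hK bd in \<open>auto intro: integrable_diff\<close>)
    finally show ?thesis .
  qed
  then show "(\<lambda>n. integral {a n..b n} f) \<longlonglongrightarrow> integral S f"
    unfolding K_def[symmetric]
    by (intro LIM_zero_cancel[OF Lim_null_comparison[OF _ lim]] eventuallyI)
qed

lemma Ioi_exhaustion:
  "{0<..} = (\<Union>n::nat. {1 / real (Suc n)..real (Suc n)})"
  "{1 / real (Suc n)..real (Suc n)} \<subseteq> {1 / real (Suc (Suc n))..real (Suc (Suc n))}"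
proof -
  show "{0<..} = (\<Union>n::nat. {1 / real (Suc n)..real (Suc n)})"
  proof (intro set_eqI iffI)
    fix x :: real assume "x \<in> {0<..}"
    then have "0 < x" by simp
    obtain n where n: "max x (1 / x) < real n" using reals_Archimedean2 by blast
    then have "1 / x \<le> real (Suc n)" "x \<le> real (Suc n)" by auto
    then have "x \<in> {1 / real (Suc n)..real (Suc n)}"
      using \<open>0 < x\<close> by (auto simp: field_simps)
    then show "x \<in> (\<Union>n::nat. {1 / real (Suc n)..real (Suc n)})" by blast
  next
    fix x :: real assume "x \<in> (\<Union>n::nat. {1 / real (Suc n)..real (Suc n)})"
    then obtain n where "1 / real (Suc n) \<le> x" by auto
    moreover have "0 < 1 / real (Suc n)" by simp
    ultimately show "x \<in> {0<..}" by (metis greaterThan_iff less_le_trans)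
  qed
  show "{1 / real (Suc n)..real (Suc n)} \<subseteq> {1 / real (Suc (Suc n))..real (Suc (Suc n))}"
  proof -
    have "1 / real (Suc (Suc n)) \<le> 1 / real (Suc n)" by (intro divide_left_mono) auto
    then show ?thesis by (auto simp: Icc_subset_Ici_iff)
  qed
qed

lemma dominated_integrable_Ioi:
  fixes f :: "real \<Rightarrow> 'a::banach" and h :: "real \<Rightarrow> real"
  assumes "continuous_on {0<..} f" "h integrable_on {0<..}" "\<And>x. x \<in> {0<..} \<Longrightarrow> norm (f x) \<le> h x"
  shows "f integrable_on {0<..}"
proof (rule dominated_integrable_continuous[OF _ assms(2,3) Ioi_exhaustion])
  fix n
  have "{1 / real (Suc n)..real (Suc n)} \<subseteq> {0<..}" using Ioi_exhaustion(1) by blast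
  then show "continuous_on {1 / real (Suc n)..real (Suc n)} f" by (rule continuous_on_subset[OF assms(1)])
qed

lemma Ioo_exhaustion:
  fixes a b :: real
  assumes "a < b"
  shows "{a<..<b} = (\<Union>n::nat. {a + (b - a) / real (Suc n)..b - (b - a) / real (Suc n)})"
    "{a + (b - a) / real (Suc n)..b - (b - a) / real (Suc n)}
      \<subseteq> {a + (b - a) / real (Suc (Suc n))..b - (b - a) / real (Suc (Suc n))}"
proof -
  show "{a<..<b} = (\<Union>n::nat. {a + (b - a) / real (Suc n)..b - (b - a) / real (Suc n)})"
  proof (intro set_eqI iffI)
    fix x assume x: "x \<in> {a<..<b}"
    define m where "m = min (x - a) (b - x)"
    have m: "0 < m" using x by (simp add: m_def)
    obtain n where n: "(b - a) / m < real n" using reals_Archimedean2 by blast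
    then have "(b - a) / m < real (Suc n)" by simp
    then have "(b - a) / real (Suc n) < m" using m by (simp add: divide_simps mult.commute)
    then have "x \<in> {a + (b - a) / real (Suc n)..b - (b - a) / real (Suc n)}"
      by (simp add: m_def)
    then show "x \<in> (\<Union>n::nat. {a + (b - a) / real (Suc n)..b - (b - a) / real (Suc n)})" by blast
  next
    fix x assume "x \<in> (\<Union>n::nat. {a + (b - a) / real (Suc n)..b - (b - a) / real (Suc n)})"
    then obtain n where "a + (b - a) / real (Suc n) \<le> x" "x \<le> b - (b - a) / real (Suc n)" by auto
    moreover have "0 < (b - a) / real (Suc n)" using assms by simp
    ultimately show "x \<in> {a<..<b}" unfolding greaterThanLessThan_iff by linarith
  qed
  have "(b - a) / real (Suc (Suc n)) \<le> (b - a) / real (Suc n)"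
    using assms by (intro divide_left_mono) auto
  then show "{a + (b - a) / real (Suc n)..b - (b - a) / real (Suc n)}
      \<subseteq> {a + (b - a) / real (Suc (Suc n))..b - (b - a) / real (Suc (Suc n))}"
    unfolding atLeastatMost_subset_iff by linarith
qed

text \<open>The end points form a null set, so only the open interval matters; this is the form
  suited to weakly singular kernels.\<close>

lemma dominated_integrable_Icc:
  fixes f :: "real \<Rightarrow> 'a::banach" and h :: "real \<Rightarrow> real"
  assumes f: "continuous_on {a<..<b} f" and h: "h integrable_on {a..b}"
    and fh: "\<And>x. x \<in> {a<..<b} \<Longrightarrow> norm (f x) \<le> h x"
  shows "f integrable_on {a..b}"
proof (cases "a < b")
  case True
  have "f integrable_on {a<..<b}"
  proof (rule dominated_integrable_continuous[OF _ _ fh Ioo_exhaustion[OF True]])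
    fix n
    have "{a + (b - a) / real (Suc n)..b - (b - a) / real (Suc n)} \<subseteq> {a<..<b}"
      using Ioo_exhaustion(1)[OF True] by blast
    then show "continuous_on {a + (b - a) / real (Suc n)..b - (b - a) / real (Suc n)} f"
      by (rule continuous_on_subset[OF f])
  qed (use h in \<open>simp_all add: integrable_on_Icc_iff_Ioo\<close>)
  then show ?thesis by (simp add: integrable_on_Icc_iff_Ioo)
next
  case False
  then show ?thesis
    using integrable_on_refl[of f a] by (cases "a = b") (auto simp: integrable_on_empty)
qed

text \<open>Improper fundamental theorem of calculus: it is applied on the compact intervals of the
  exhaustion, and the majorant identifies the limit with the integral over the half-line.\<close>

lemma integral_Ioi_derivative:
  fixes f :: "real \<Rightarrow> 'a::banach" and h :: "real \<Rightarrow> real"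
  assumes d: "\<And>t. 0 < t \<Longrightarrow> (f has_vector_derivative f' t) (at t)"
    and f': "continuous_on {0<..} f'" and h: "h integrable_on {0<..}"
    and fh: "\<And>x. 0 < x \<Longrightarrow> norm (f' x) \<le> h x"
    and l: "(f \<longlongrightarrow> l) (at_right 0)" and m: "(f \<longlongrightarrow> m) at_top"
  shows "integral {0<..} f' = m - l"
proof -
  have lim: "(\<lambda>n. integral {1 / real (Suc n)..real (Suc n)} f') \<longlonglongrightarrow> integral {0<..} f'"
  proof (rule dominated_integral_exhaustion[OF _ h _ Ioi_exhaustion])
    fix n
    have "{1 / real (Suc n)..real (Suc n)} \<subseteq> {0<..}" using Ioi_exhaustion(1) by blast
    then show "continuous_on {1 / real (Suc n)..real (Suc n)} f'" by (rule continuous_on_subset[OF f'])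
  qed (use fh in auto)
  have "integral {1 / real (Suc n)..real (Suc n)} f' = f (real (Suc n)) - f (1 / real (Suc n))" for n
  proof (rule integral_unique, rule fundamental_theorem_of_calculus)
    show "1 / real (Suc n) \<le> real (Suc n)" by (simp add: field_simps)
    fix x assume "x \<in> {1 / real (Suc n)..real (Suc n)}"
    moreover have "0 < 1 / real (Suc n)" by simp
    ultimately have "0 < x" by (meson atLeastAtMost_iff less_le_trans)
    then show "(f has_vector_derivative f' x) (at x within {1 / real (Suc n)..real (Suc n)})"
      using d has_vector_derivative_at_within by blast
  qed
  moreover have "(\<lambda>n. f (real (Suc n)) - f (1 / real (Suc n))) \<longlonglongrightarrow> m - l"
  proof (rule tendsto_diff)
    show "(\<lambda>n. f (real (Suc n))) \<longlonglongrightarrow> m"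
      by (rule filterlim_compose[OF m])
        (simp only: filterlim_sequentially_Suc[of real] filterlim_real_sequentially)
    have "filterlim (\<lambda>n. 1 / real (Suc n)) (at_right 0) sequentially"
      using LIMSEQ_inverse_real_of_nat by (simp add: filterlim_at inverse_eq_divide)
    then show "(\<lambda>n. f (1 / real (Suc n))) \<longlonglongrightarrow> l"
      by (rule filterlim_compose[OF l])
  qed
  ultimately show ?thesis
    using LIMSEQ_unique[OF lim] by simp
qed

text \<open>Riemann sums have nonnegative coefficients and therefore stay in the cone; the integral
  is a limit of them.\<close>

lemma integral_in_closed_cone:
  fixes f :: "'n::euclidean_space \<Rightarrow> 'a::real_normed_vector"
  assumes C: "closed C" "0 \<in> C" "\<And>x y. x \<in> C \<Longrightarrow> y \<in> C \<Longrightarrow> x + y \<in> C"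
      "\<And>c x. 0 \<le> c \<Longrightarrow> x \<in> C \<Longrightarrow> c *\<^sub>R x \<in> C"
    and f: "\<And>x. x \<in> cbox a b \<Longrightarrow> f x \<in> C"
  shows "integral (cbox a b) f \<in> C"
proof (cases "f integrable_on cbox a b")
  case False
  \<comment> \<open>The integral of a non-integrable function is 0 by convention, and 0 lies in the
    cone.\<close>
  then show ?thesis using C(2) by (simp add: not_integrable_integral)
next
  case True
  have "\<exists>y\<in>C. dist y (integral (cbox a b) f) < e" if e: "0 < e" for e
  proof -
    obtain \<gamma> where g: "gauge \<gamma>" and
      c: "\<And>p. p tagged_division_of cbox a b \<Longrightarrow> \<gamma> fine p \<Longrightarrow>
         norm ((\<Sum>(x,K)\<in>p. measure lborel K *\<^sub>R f x) - integral (cbox a b) f) < e"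
      using integrable_integral[OF True, unfolded has_integral] e by meson
    obtain p where p: "p tagged_division_of cbox a b" "\<gamma> fine p"
      using fine_division_exists[OF g] by blast
    have "(\<Sum>z\<in>q. case z of (x,K) \<Rightarrow> measure lborel K *\<^sub>R f x) \<in> C" if "q \<subseteq> p" "finite q" for q
      using that(2,1)
    proof (induction q rule: finite_induct)
      case (insert z q)
      obtain x K where z: "z = (x, K)" by force
      then have "x \<in> cbox a b" using insert.prems p(1) by (metis insert_subset tag_in_interval)
      then show ?case using insert C f by (simp add: z)
    qed (use C in simp)
    then have "(\<Sum>(x,K)\<in>p. measure lborel K *\<^sub>R f x) \<in> C"
      using p(1) by blast
    with c[OF p] show ?thesis by (auto simp: dist_norm)
  qed
  then show ?thesis
    using C(1) by (metis closure_approachable closure_closed)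
qed

section \<open>Uniform boundedness, total boundedness and Arzela-Ascoli\<close>

text \<open>Baire category: the closed sets of points with orbit bounded by \<open>m\<close> exhaust
  the space, so one of them contains a ball.\<close>

lemma uniform_boundedness:
  fixes T :: "nat \<Rightarrow> 'a::banach \<Rightarrow>\<^sub>L 'b::real_normed_vector"
  assumes "\<And>x. bounded (range (\<lambda>n. T n x))"
  obtains M where "\<And>n. norm (T n) \<le> M"
proof -
  define A where "A m = {x. \<forall>n. norm (T n x) \<le> real m}" for m
  have clA: "closed (A m)" for m
    unfolding A_def by (intro closed_Collect_all closed_Collect_le continuous_intros)
  have "x \<in> \<Union>(range A)" for x
  proof -
    obtain B where "\<And>n. norm (T n x) \<le> B"
      using assms[of x] by (auto simp: bounded_iff)
    moreover obtain m where "B \<le> real m" using real_arch_simple by blast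
    ultimately show ?thesis unfolding A_def by (auto intro: order_trans)
  qed
  then have U: "\<Union>(range A) = UNIV" by auto
  have "\<exists>m. interior (A m) \<noteq> {}"
  proof (rule ccontr)
    assume "\<not> ?thesis"
    then have "Met_TC.mtopology interior_of \<Union>(range A) = {}"
      by (intro Met_TC.metric_Baire_category_alt)
        (auto simp: clA closed_closedin[symmetric])
    then show False by (simp add: U)
  qed
  then obtain m x e where e: "0 < e" "ball x e \<subseteq> A m"
    by (meson ex_in_conv interior_subset mem_interior subset_trans open_contains_ball open_interior)
  \<comment> \<open>A vector \<open>z\<close> of norm e/2 is the difference of \<open>x + z\<close>
    and \<open>x\<close>, two points of the ball, so its image has norm at most 2m; rescaling to
    \<open>y\<close> gives the factor 4m/e.\<close>
  have "norm (T n) \<le> 4 * real m / e" for n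
  proof (rule norm_blinfun_bound)
    show "0 \<le> 4 * real m / e" using e by simp
    fix y :: 'a
    show "norm (T n y) \<le> 4 * real m / e * norm y"
    proof (cases "y = 0")
      case False
      define z where "z = (e / (2 * norm y)) *\<^sub>R y"
      have "norm z = e / 2" using False e by (simp add: z_def)
      then have "x + z \<in> A m" "x \<in> A m" using e by (auto simp: dist_norm)
      then have "norm (T n (x + z)) \<le> real m" "norm (T n x) \<le> real m"
        by (auto simp: A_def)
      moreover have "T n z = T n (x + z) - T n x" by (simp add: blinfun.add_right)
      ultimately have "norm (T n z) \<le> 2 * real m"
        using norm_triangle_ineq4[of "T n (x + z)" "T n x"] by simp
      moreover have "norm (T n z) = e / (2 * norm y) * norm (T n y)"
        using e by (simp add: z_def blinfun.scaleR_right)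
      ultimately show ?thesis using False e by (simp add: field_simps)
    qed simp
  qed
  then show thesis using that by blast
qed

text \<open>Total boundedness passes to sets that are uniformly near compact ones: a finite e/3-net
  of \<open>K\<close> is an e-net of the closure of \<open>S\<close>.\<close>

lemma compact_closure_if_near_compact:
  fixes S :: "'a::complete_space set"
  assumes "\<And>e. 0 < e \<Longrightarrow> \<exists>K. compact K \<and> (\<forall>x\<in>S. \<exists>y\<in>K. dist x y < e)"
  shows "compact (closure S)"
  unfolding compact_eq_totally_bounded
proof (intro conjI allI impI)
  show "complete (closure S)" by (simp add: complete_eq_closed)
  fix e :: real assume "0 < e"
  then obtain K where K: "compact K" "\<And>x. x \<in> S \<Longrightarrow> \<exists>y\<in>K. dist x y < e / 3"
    using assms[of "e / 3"] by auto
  obtain k where k: "finite k" "K \<subseteq> (\<Union>x\<in>k. ball x (e / 3))"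
    using K(1) \<open>0 < e\<close> unfolding compact_eq_totally_bounded by (meson divide_pos_pos zero_less_numeral)
  have "closure S \<subseteq> (\<Union>x\<in>k. ball x e)"
  proof
    fix x assume "x \<in> closure S"
    then obtain y where y: "y \<in> S" "dist y x < e / 3"
      using \<open>0 < e\<close> by (meson closure_approachable divide_pos_pos zero_less_numeral)
    obtain z where z: "z \<in> K" "dist y z < e / 3" using K(2)[OF y(1)] by blast
    obtain w where w: "w \<in> k" "dist w z < e / 3" using k(2) z(1) by auto
    have "dist w x < e"
      using y(2) z(2) w(2) dist_triangle[of w x z] dist_triangle[of z x y] by (simp add: dist_commute)
    then show "x \<in> (\<Union>x\<in>k. ball x e)" using w(1) by auto
  qed
  then show "\<exists>k. finite k \<and> closure S \<subseteq> (\<Union>x\<in>k. ball x e)" using k(1) by blast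
qed

text \<open>Arzela-Ascoli without a diagonal sequence: the values at a countable dense set of times
  form a sequence in a countable product of copies of \<open>C\<close>, which is compact by
  Tychonoff. Equicontinuity spreads convergence to all times.\<close>

lemma equicontinuous_pointwise_convergent_subseq:
  fixes f :: "nat \<Rightarrow> real \<Rightarrow> 'a::complete_space"
  assumes "0 \<le> b" and C: "compact C" and fC: "\<And>n t. t \<in> {0..b} \<Longrightarrow> f n t \<in> C"
    and eq: "\<And>e. 0 < e \<Longrightarrow> \<exists>d>0. \<forall>n. \<forall>s\<in>{0..b}. \<forall>t\<in>{0..b}. \<bar>s - t\<bar> < d \<longrightarrow> dist (f n s) (f n t) < e"
  obtains r l where "strict_mono (r :: nat \<Rightarrow> nat)" "\<And>t. t \<in> {0..b} \<Longrightarrow> (\<lambda>n. f (r n) t) \<longlonglongrightarrow> l t"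
    "continuous_on {0..b} l"
proof -
  \<comment> \<open>An enumeration of the rationals, clipped to the interval so that every index
    gives an admissible time.\<close>
  define q where "q k = max 0 (min b (real_of_rat (from_nat_into UNIV k)))" for k
  have q: "q k \<in> {0..b}" for k using \<open>0 \<le> b\<close> by (auto simp: q_def)
  have dense: "\<exists>k. \<bar>q k - t\<bar> < d" if "t \<in> {0..b}" and d: "0 < d" for t d
  proof -
    obtain x where x: "t - d < real_of_rat x" "real_of_rat x < t + d"
      using of_rat_dense[of "t - d" "t + d"] d by auto
    obtain k where "from_nat_into UNIV k = x"
      using from_nat_into_surj[of "UNIV :: rat set" x] by auto
    then have "\<bar>q k - t\<bar> < d" using x that by (auto simp: q_def)
    then show ?thesis ..
  qed
  define F where "F n = (\<lambda>k. f n (q k))" for n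
  define P where "P = Pi\<^sub>E (UNIV :: nat set) (\<lambda>_. C)"
  have "compact P"
    using C unfolding P_def compactin_euclidean_iff[symmetric] euclidean_product_topology[symmetric]
    by (simp add: compactin_PiE)
  moreover have "\<forall>n. F n \<in> P" using fC q by (auto simp: F_def P_def)
  ultimately obtain g r where r: "strict_mono (r :: nat \<Rightarrow> nat)" "(F \<circ> r) \<longlonglongrightarrow> g"
    unfolding compact_def by meson
  have conv: "(\<lambda>n. f (r n) (q k)) \<longlonglongrightarrow> g k" for k
  proof -
    have "isCont (\<lambda>x :: nat \<Rightarrow> 'a. x k) g"
      by (rule continuous_on_interior[OF continuous_on_product_coordinates]) simp
    from isCont_tendsto_compose[OF this r(2)] show ?thesis by (simp add: F_def)
  qed
  have cauchy: "Cauchy (\<lambda>n. f (r n) t)" if t: "t \<in> {0..b}" for t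
  proof (rule metric_CauchyI)
    fix e :: real assume "0 < e"
    then obtain d where d: "0 < d" "\<And>n s t. s \<in> {0..b} \<Longrightarrow> t \<in> {0..b} \<Longrightarrow> \<bar>s - t\<bar> < d \<Longrightarrow> dist (f n s) (f n t) < e / 3"
      using eq[of "e / 3"] by auto
    obtain k where k: "\<bar>q k - t\<bar> < d" using dense[OF t d(1)] by blast
    have "Cauchy (\<lambda>n. f (r n) (q k))" using conv LIMSEQ_imp_Cauchy by blast
    then obtain N where N: "\<And>m n. N \<le> m \<Longrightarrow> N \<le> n \<Longrightarrow> dist (f (r m) (q k)) (f (r n) (q k)) < e / 3"
      using \<open>0 < e\<close> unfolding Cauchy_def by (meson divide_pos_pos zero_less_numeral)
    have "dist (f (r m) t) (f (r n) t) < e" if "N \<le> m" "N \<le> n" for m n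
      using N[OF that] d(2)[OF q t k, of "r m"] d(2)[OF q t k, of "r n"]
        dist_triangle[of "f (r m) t" "f (r n) t" "f (r m) (q k)"]
        dist_triangle[of "f (r m) (q k)" "f (r n) t" "f (r n) (q k)"]
      by (simp add: dist_commute)
    then show "\<exists>N. \<forall>m\<ge>N. \<forall>n\<ge>N. dist (f (r m) t) (f (r n) t) < e" by blast
  qed
  then have "\<exists>y. (\<lambda>n. f (r n) t) \<longlonglongrightarrow> y" if "t \<in> {0..b}" for t
    using that Cauchy_convergent_iff convergent_def by blast
  then obtain l where l: "\<And>t. t \<in> {0..b} \<Longrightarrow> (\<lambda>n. f (r n) t) \<longlonglongrightarrow> l t" by metis
  have "continuous_on {0..b} l"
    unfolding continuous_on_iff
  proof (intro ballI allI impI)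
    fix t e :: real assume t: "t \<in> {0..b}" and "0 < e"
    then obtain d where d: "0 < d" "\<And>n s t. s \<in> {0..b} \<Longrightarrow> t \<in> {0..b} \<Longrightarrow> \<bar>s - t\<bar> < d \<Longrightarrow> dist (f n s) (f n t) < e / 2"
      using eq[of "e / 2"] by auto
    have "dist (l s) (l t) \<le> e / 2" if "s \<in> {0..b}" "dist s t < d" for s
    proof (rule LIMSEQ_le_const2)
      show "(\<lambda>n. dist (f (r n) s) (f (r n) t)) \<longlonglongrightarrow> dist (l s) (l t)"
        by (intro tendsto_dist l that t)
      show "\<exists>N. \<forall>n\<ge>N. dist (f (r n) s) (f (r n) t) \<le> e / 2"
        using d(2)[OF that(1) t] that(2) less_imp_le by (auto simp: dist_real_def)
    qed
    then show "\<exists>d>0. \<forall>s\<in>{0..b}. dist s t < d \<longrightarrow> dist (l s) (l t) < e"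
      using d(1) \<open>0 < e\<close> by (intro exI[of _ d]) force
  qed
  with r(1) l show thesis using that by blast
qed

section \<open>A Beta-type double integral\<close>

text \<open>The power weight is extended by zero to the whole line, so that the regions of
  integration below are encoded in the integrand and translations and scalings act on all of the
  line.\<close>

definition pos_powr :: "real \<Rightarrow> real \<Rightarrow> real" where
  "pos_powr b t = (if 0 < t then t powr (b - 1) else 0)"

lemma pos_powr_measurable [measurable]: "pos_powr b \<in> borel_measurable borel"
  unfolding pos_powr_def by measurable

lemma pos_powr_nonneg [simp]: "0 \<le> pos_powr b t"
  by (simp add: pos_powr_def)

lemma pos_powr_scale: "0 < c \<Longrightarrow> pos_powr b (c * t) = c powr (b - 1) * pos_powr b t"
  by (auto simp: pos_powr_def powr_mult zero_less_mult_iff)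

lemma has_bochner_integral_Ioi:
  fixes f :: "real \<Rightarrow> real"
  assumes "has_bochner_integral lborel (\<lambda>t. if 0 < t then f t else 0) I"
  shows "(f has_integral I) {0<..}"
proof -
  have "((\<lambda>t. if t \<in> {0<..} then f t else 0) has_integral I) UNIV"
    using has_integral_integral_lborel[of "\<lambda>t. if 0 < t then f t else 0"] assms
    by (auto simp: has_bochner_integral_iff)
  then show ?thesis by (simp only: has_integral_restrict_UNIV)
qed

lemma bochner_Gamma:
  assumes "0 < b" "0 < d"
  shows "has_bochner_integral lborel (\<lambda>t. pos_powr b t * exp (- d * t)) (Gamma b / d powr b)"
proof -
  define f where "f t = pos_powr b t * exp (- t)" for t
  have f: "has_bochner_integral lborel f (Gamma b)"
  proof (rule has_bochner_integral_nn_integral)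
    show "f \<in> borel_measurable lborel" unfolding f_def by measurable
    show "AE t in lborel. 0 \<le> f t" by (simp add: f_def)
    show "0 \<le> Gamma b" using Gamma_real_pos[OF assms(1)] by simp
    have "ennreal (f t) = ennreal (indicator {0..} t * t powr (b - 1) / exp t)" for t
      by (auto simp: f_def pos_powr_def exp_minus field_simps indicator_def)
    then show "(\<integral>\<^sup>+ t. ennreal (f t) \<partial>lborel) = ennreal (Gamma b)"
      using Gamma_conv_nn_integral_real[OF assms(1)] by simp
  qed
  then have "has_bochner_integral lborel (\<lambda>t. f (0 + d * t)) (Gamma b /\<^sub>R \<bar>d\<bar>)"
    using assms by (subst lborel_has_bochner_integral_real_affine_iff[symmetric]) auto
  then have "has_bochner_integral lborel (\<lambda>t. d powr (1 - b) * f (0 + d * t)) (d powr (1 - b) * (Gamma b /\<^sub>R \<bar>d\<bar>))"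
    by (rule has_bochner_integral_mult_right)
  moreover have "d powr (1 - b) * f (0 + d * t) = pos_powr b t * exp (- d * t)" for t
    using assms by (simp add: f_def pos_powr_scale powr_add[symmetric] mult.assoc[symmetric])
  moreover have "d powr (1 - b) * (Gamma b /\<^sub>R \<bar>d\<bar>) = Gamma b / d powr b"
    using assms by (simp add: powr_diff field_simps)
  ultimately show ?thesis by simp
qed

lemma has_integral_Gamma_scaled:
  fixes b d :: real
  assumes "0 < b" "0 < d"
  shows "((\<lambda>t. t powr (b - 1) * exp (- d * t)) has_integral (Gamma b / d powr b)) {0<..}"
proof (rule has_bochner_integral_Ioi)
  have "(\<lambda>t. if 0 < t then t powr (b - 1) * exp (- d * t) else 0) = (\<lambda>t. pos_powr b t * exp (- d * t))"
    by (auto simp: pos_powr_def)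
  then show "has_bochner_integral lborel (\<lambda>t. if 0 < t then t powr (b - 1) * exp (- d * t) else 0) (Gamma b / d powr b)"
    using bochner_Gamma[OF assms] by simp
qed

text \<open>Euler's Beta integral rescaled from the unit interval to (0, q): the two weights
  contribute q powr (b + c - 2), the substitution one more factor q.\<close>

lemma bochner_Beta:
  assumes "0 < b" "0 < c" "0 < q"
  shows "has_bochner_integral lborel (\<lambda>s. pos_powr b s * pos_powr c (q - s)) (Beta b c * q powr (b + c - 1))"
proof -
  define f where "f s = pos_powr b s * pos_powr c (1 - s)" for s
  have Bpos: "0 \<le> Beta b c"
    using assms by (simp add: Beta_def Gamma_real_pos less_imp_le)
  have f: "has_bochner_integral lborel f (Beta b c)"
  proof (rule has_bochner_integral_nn_integral)
    show "f \<in> borel_measurable lborel" unfolding f_def by measurable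
    show "AE t in lborel. 0 \<le> f t" by (simp add: f_def)
    have "ennreal (f t) = ennreal (indicator {0..1} t * (t powr (b - 1) * (1 - t) powr (c - 1)))" for t
      by (auto simp: f_def pos_powr_def indicator_def)
    then show "(\<integral>\<^sup>+ t. ennreal (f t) \<partial>lborel) = ennreal (Beta b c)"
      using nn_integral_has_integral_lebesgue[OF _ has_integral_Beta_real[OF assms(1,2)]] by simp
  qed fact
  then have "has_bochner_integral lborel (\<lambda>t. f (0 + (1 / q) * t)) (Beta b c /\<^sub>R \<bar>1 / q\<bar>)"
    using assms by (subst lborel_has_bochner_integral_real_affine_iff[symmetric]) auto
  then have "has_bochner_integral lborel (\<lambda>t. q powr (b + c - 2) * f (0 + (1 / q) * t)) (q powr (b + c - 2) * (Beta b c /\<^sub>R \<bar>1 / q\<bar>))"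
    by (rule has_bochner_integral_mult_right)
  moreover have "q powr (b + c - 2) * f (0 + (1 / q) * t) = pos_powr b t * pos_powr c (q - t)" for t
  proof -
    have "f (0 + (1 / q) * t) = pos_powr b ((1 / q) * t) * pos_powr c ((1 / q) * (q - t))"
      using assms by (simp add: f_def field_simps)
    also have "\<dots> = (1 / q) powr (b - 1) * (1 / q) powr (c - 1) * (pos_powr b t * pos_powr c (q - t))"
      using assms by (simp only: pos_powr_scale[of "1 / q"] zero_less_divide_1_iff) (simp add: ac_simps)
    also have "(1 / q) powr (b - 1) * (1 / q) powr (c - 1) = 1 / q powr (b + c - 2)"
      using assms by (simp add: powr_divide powr_add[symmetric])
    finally show ?thesis using assms by simp
  qed
  moreover have "q powr (b + c - 2) * (Beta b c /\<^sub>R \<bar>1 / q\<bar>) = Beta b c * q powr (b + c - 1)"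
  proof -
    have "q powr (b + c - 1) = q powr (b + c - 2) * q powr 1" by (subst powr_add[symmetric]) simp
    then show ?thesis using assms by simp
  qed
  ultimately show ?thesis by (simp only:)
qed

text \<open>Fubini on the region \<open>0 < s < q\<close>, in the variables \<open>(s, q) = (s, s + r)\<close>.\<close>

lemma iterated_power_integral:
  fixes h :: "real \<Rightarrow> real"
  assumes b: "0 < b" and c: "0 < c" and d: "0 < d"
    and h: "continuous_on {0<..} h" and hd: "\<And>q. 0 < q \<Longrightarrow> \<bar>h q\<bar> \<le> C * exp (- d * q)"
  shows "integral {0<..} (\<lambda>s. s powr (b - 1) * integral {0<..} (\<lambda>r. r powr (c - 1) * h (s + r)))
       = Beta b c * integral {0<..} (\<lambda>q. q powr (b + c - 1) * h q)"
proof -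
  define k where "k q = (if 0 < q then h q else 0)" for q
  have "k = (\<lambda>x. indicator {0<..} x *\<^sub>R h x)" by (auto simp: k_def)
  then have k[measurable]: "k \<in> borel_measurable borel"
    using borel_measurable_continuous_on_indicator[OF _ h] by simp
  have kb: "\<bar>k q\<bar> \<le> C * exp (- d * q)" if "0 < q" for q using hd that by (simp add: k_def)
  \<comment> \<open>As a function on the plane \<open>G\<close> vanishes unless 0 < s < q.
    Integrating in \<open>s\<close> gives a Beta integral; integrating in \<open>q\<close> and
    translating by \<open>s\<close> gives the iterated integral.\<close>
  define G where "G q s = pos_powr b s * pos_powr c (q - s) * k q" for q s
  have [measurable]: "(\<lambda>(q, s). G q s) \<in> borel_measurable (lborel \<Otimes>\<^sub>M lborel)"
    unfolding G_def by measurable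
  have Gs: "has_bochner_integral lborel (G q) (Beta b c * (pos_powr (b + c) q * k q))"
    and Gsn: "has_bochner_integral lborel (\<lambda>s. norm (G q s)) (Beta b c * (pos_powr (b + c) q * \<bar>k q\<bar>))" for q
  proof -
    have "has_bochner_integral lborel (\<lambda>s. pos_powr b s * pos_powr c (q - s)) (Beta b c * pos_powr (b + c) q)"
    proof (cases "0 < q")
      case True
      then show ?thesis using bochner_Beta[OF b c True] by (simp add: pos_powr_def)
    next
      case False
      then have "(\<lambda>s. pos_powr b s * pos_powr c (q - s)) = (\<lambda>s. 0)"
        by (auto simp: pos_powr_def)
      moreover have "pos_powr (b + c) q = 0" using False by (simp add: pos_powr_def)
      ultimately show ?thesis by (simp add: has_bochner_integral_zero)
    qed
    then have *: "has_bochner_integral lborel (\<lambda>s. pos_powr b s * pos_powr c (q - s) * x) (Beta b c * pos_powr (b + c) q * x)" for x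
      by (rule has_bochner_integral_mult_left)
    show "has_bochner_integral lborel (G q) (Beta b c * (pos_powr (b + c) q * k q))"
      using *[of "k q"] by (simp add: G_def[abs_def] mult.assoc)
    show "has_bochner_integral lborel (\<lambda>s. norm (G q s)) (Beta b c * (pos_powr (b + c) q * \<bar>k q\<bar>))"
      using *[of "\<bar>k q\<bar>"] by (simp add: G_def[abs_def] mult.assoc abs_mult)
  qed
  have dom: "integrable lborel (\<lambda>q. pos_powr a q * k (s + q))" if "0 < a" "0 \<le> s" for a s
  proof (rule Bochner_Integration.integrable_bound)
    show "integrable lborel (\<lambda>q. C * (pos_powr a q * exp (- d * q)))"
      using bochner_Gamma[OF that(1) d] by (auto simp: has_bochner_integral_iff)
    show "(\<lambda>q. pos_powr a q * k (s + q)) \<in> borel_measurable lborel" by measurable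
    have kq: "\<bar>k (s + q)\<bar> \<le> C * exp (- d * q)" if "0 < q" for q
    proof -
      have "0 \<le> C * exp (- d * q)" using kb[OF that] by linarith
      then have "0 \<le> C" by (simp add: zero_le_mult_iff not_le) 
      have "\<bar>k (s + q)\<bar> \<le> C * exp (- d * (s + q))" using kb[of "s + q"] that \<open>0 \<le> s\<close> by simp
      also have "\<dots> \<le> C * exp (- d * q)" using \<open>0 \<le> C\<close> d \<open>0 \<le> s\<close> by (intro mult_left_mono) auto
      finally show ?thesis .
    qed
    have "norm (pos_powr a q * k (s + q)) \<le> norm (C * (pos_powr a q * exp (- d * q)))" for q
    proof (cases "0 < q")
      case True
      have "pos_powr a q * \<bar>k (s + q)\<bar> \<le> pos_powr a q * (C * exp (- d * q))"
        by (rule mult_left_mono[OF kq[OF True]]) simp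
      also have "\<dots> \<le> \<bar>C * (pos_powr a q * exp (- d * q))\<bar>" by (simp add: ac_simps)
      finally show ?thesis by (simp add: abs_mult)
    qed (simp add: pos_powr_def)
    then show "AE q in lborel. norm (pos_powr a q * k (s + q)) \<le> norm (C * (pos_powr a q * exp (- d * q)))"
      by simp
  qed
  \<comment> \<open>Tonelli's criterion: the inner integral of the norm is again a Beta multiple,
    hence dominated by a Gamma density.\<close>
  have intG: "integrable (lborel \<Otimes>\<^sub>M lborel) (\<lambda>(q, s). G q s)"
  proof (rule lborel_pair.Fubini_integrable)
    have "(\<lambda>q. LINT s|lborel. norm (G q s)) = (\<lambda>q. Beta b c * \<bar>pos_powr (b + c) q * k (0 + q)\<bar>)"
      using Gsn by (auto simp: has_bochner_integral_iff abs_mult)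
    then show "integrable lborel (\<lambda>x. LINT y|lborel. norm (case (x, y) of (q, s) \<Rightarrow> G q s))"
      using dom[of "b + c" 0] b c by (auto intro!: integrable_mult_right)
    show "AE x in lborel. integrable lborel (\<lambda>y. case (x, y) of (q, s) \<Rightarrow> G q s)"
      using Gs by (auto simp: has_bochner_integral_iff)
  qed measurable
  have Gq: "(LINT q|lborel. G q s) = (if 0 < s then s powr (b - 1) * integral {0<..} (\<lambda>r. r powr (c - 1) * h (s + r)) else 0)" for s
  proof (cases "0 < s")
    case True
    have "(LINT q|lborel. G q s) = (LINT r|lborel. G (s + 1 * r) s)"
      by (subst lborel_integral_real_affine[where c=1 and t=s]) auto
    also have "\<dots> = pos_powr b s * (LINT r|lborel. pos_powr c r * k (s + r))"
      by (simp add: G_def mult.assoc)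
    also have "(LINT r|lborel. pos_powr c r * k (s + r)) = integral {0<..} (\<lambda>r. r powr (c - 1) * h (s + r))"
    proof (rule integral_unique[symmetric], rule has_bochner_integral_Ioi)
      have "(\<lambda>r. pos_powr c r * k (s + r)) = (\<lambda>t. if 0 < t then t powr (c - 1) * h (s + t) else 0)"
        using True by (auto simp: pos_powr_def k_def)
      then show "has_bochner_integral lborel (\<lambda>t. if 0 < t then t powr (c - 1) * h (s + t) else 0)
          (LINT r|lborel. pos_powr c r * k (s + r))"
        using dom[OF c, of s] True by (simp add: has_bochner_integral_iff)
    qed
    finally show ?thesis using True by (simp add: pos_powr_def)
  qed (simp add: G_def pos_powr_def)
  have "integral {0<..} (\<lambda>s. s powr (b - 1) * integral {0<..} (\<lambda>r. r powr (c - 1) * h (s + r)))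
      = (LINT s|lborel. (LINT q|lborel. G q s))"
    using lborel_pair.integrable_snd[OF intG]
    by (intro integral_unique has_bochner_integral_Ioi) (simp add: has_bochner_integral_iff Gq)
  also have "\<dots> = (LINT q|lborel. (LINT s|lborel. G q s))"
    by (rule lborel_pair.Fubini_integral[OF intG])
  also have "\<dots> = (LINT q|lborel. Beta b c * (pos_powr (b + c) q * k q))"
    using Gs by (simp add: has_bochner_integral_iff)
  also have "\<dots> = Beta b c * (LINT q|lborel. pos_powr (b + c) q * k q)" by simp
  also have "(LINT q|lborel. pos_powr (b + c) q * k q) = integral {0<..} (\<lambda>q. q powr (b + c - 1) * h q)"
  proof (rule integral_unique[symmetric], rule has_bochner_integral_Ioi)
    have "(\<lambda>q. pos_powr (b + c) q * k q) = (\<lambda>t. if 0 < t then t powr (b + c - 1) * h t else 0)"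
      by (auto simp: pos_powr_def k_def)
    then show "has_bochner_integral lborel (\<lambda>t. if 0 < t then t powr (b + c - 1) * h t else 0)
        (LINT q|lborel. pos_powr (b + c) q * k q)"
      using dom[of "b + c" 0] b c by (simp add: has_bochner_integral_iff)
  qed
  finally show ?thesis .
qed

section \<open>Decaying semigroups and their fractional powers\<close>

text \<open>The constants are kept explicit because the same facts are applied to the given
  semigroup, to its exponential rescalings and, with a negative rate, to decaying
  semigroups.\<close>

locale growth_semigroup =
  fixes T :: "real \<Rightarrow> 'a::banach \<Rightarrow>\<^sub>L 'a" and M \<omega> :: real
  assumes C0: "C0_semigroup T"
    and bound: "\<And>t. 0 \<le> t \<Longrightarrow> norm (T t) \<le> M * exp (\<omega> * t)"
begin

lemma at_0 [simp]: "T 0 x = x"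
  using C0 by (simp add: C0_semigroup_def)

lemma semigroup: "0 \<le> s \<Longrightarrow> 0 \<le> t \<Longrightarrow> T (s + t) x = T s (T t x)"
  using C0 by (simp add: C0_semigroup_def)

lemma commute: "0 \<le> s \<Longrightarrow> 0 \<le> t \<Longrightarrow> T s (T t x) = T t (T s x)"
  using semigroup[of s t x] semigroup[of t s x] by (simp add: add.commute)

lemma M_nonneg: "0 \<le> M"
  using bound[of 0] norm_ge_zero[of "T 0"] by (simp del: norm_ge_zero)

lemma norm_apply_le: "0 \<le> t \<Longrightarrow> norm (T t x) \<le> M * exp (\<omega> * t) * norm x"
  by (meson bound norm_blinfun mult_right_mono norm_ge_zero order_trans)

text \<open>Passing to the absolute value of the rate gives a bound uniform on [0, b] whatever the
  sign of \<open>\<omega>\<close>.\<close>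

lemma local_bound: "0 \<le> t \<Longrightarrow> t \<le> b \<Longrightarrow> norm (T t x) \<le> M * exp (\<bar>\<omega>\<bar> * b) * norm x"
proof -
  assume t: "0 \<le> t" "t \<le> b"
  have "\<omega> * t \<le> \<bar>\<omega>\<bar> * b"
    using t by (intro mult_mono) auto
  then show ?thesis
    using norm_apply_le[OF t(1), of x] M_nonneg
    by (meson exp_le_cancel_iff mult_left_mono mult_right_mono norm_ge_zero order_trans)
qed

text \<open>Right continuity at 0 suffices for both one-sided limits: for s \<le> r the increment is
  T s applied to T (r - s) x - x, with the earlier time outside, and T s is locally bounded.\<close>

lemma continuous: "continuous_on {0..} (\<lambda>t. T t x)"
  unfolding continuous_on_iff
proof (intro ballI allI impI)
  fix t e :: real assume t: "t \<in> {0..}" and e: "0 < e"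
  define K where "K = M * exp (\<bar>\<omega>\<bar> * (t + 1))"
  have K: "0 \<le> K" using M_nonneg by (simp add: K_def)
  have "((\<lambda>t. T t x) \<longlongrightarrow> x) (at_right 0)"
    using C0 by (simp add: C0_semigroup_def)
  then have "\<forall>\<^sub>F h in at_right 0. dist (T h x) x < e / (K + 1)"
    using K e by (intro tendstoD) auto
  then obtain d where d: "0 < d" "\<And>h. 0 < h \<Longrightarrow> h < d \<Longrightarrow> dist (T h x) x < e / (K + 1)"
    by (auto simp: eventually_at_right_field)
  have step: "dist (T r x) (T s x) < e" if "0 \<le> s" "s \<le> r" "r \<le> t + 1" "r - s < d" for r s
  proof (cases "r = s")
    case False
    have "T r x - T s x = T s (T (r - s) x - x)"
      using semigroup[of s "r - s" x] that by (simp add: blinfun.diff_right)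
    then have "dist (T r x) (T s x) \<le> K * norm (T (r - s) x - x)"
      using local_bound[of s "t + 1"] that by (simp add: dist_norm K_def)
    also have "\<dots> \<le> K * (e / (K + 1))"
      using d(2)[of "r - s"] that False K by (intro mult_left_mono) (auto simp: dist_norm)
    also have "\<dots> < e" using K e by (simp add: field_simps)
    finally show ?thesis .
  qed (use e in simp)
  show "\<exists>d>0. \<forall>s\<in>{0..}. dist s t < d \<longrightarrow> dist (T s x) (T t x) < e"
  proof (intro exI conjI ballI impI)
    show "0 < min d 1" using d by simp
    fix s assume "s \<in> {0..}" "dist s t < min d 1"
    then show "dist (T s x) (T t x) < e"
      using step[of s t] step[of t s] t by (cases "s \<le> t") (auto simp: dist_real_def dist_commute)
  qed
qed

text \<open>Joint continuity follows from strong continuity together with local boundedness;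
  operator-norm continuity of \<open>T\<close> is not assumed.\<close>

lemma continuous_compose:
  fixes r :: "'b::topological_space \<Rightarrow> real"
  assumes r: "continuous_on I r" and f: "continuous_on I f" and r0: "\<And>i. i \<in> I \<Longrightarrow> 0 \<le> r i"
  shows "continuous_on I (\<lambda>i. T (r i) (f i))"
  unfolding continuous_on_def
proof
  fix i assume i: "i \<in> I"
  define K where "K = M * exp (\<bar>\<omega>\<bar> * (r i + 1))"
  have "continuous_on I (\<lambda>j. T (r j) (f i))"
    by (rule continuous_on_compose2[OF continuous r]) (use r0 in auto)
  then have 1: "((\<lambda>j. T (r j) (f i)) \<longlongrightarrow> T (r i) (f i)) (at i within I)"
    using i by (auto simp: continuous_on_def)
  have rt: "(r \<longlongrightarrow> r i) (at i within I)" and ft: "(f \<longlongrightarrow> f i) (at i within I)"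
    using r f i by (auto simp: continuous_on_def)
  have "\<forall>\<^sub>F j in at i within I. r j < r i + 1"
    by (rule order_tendstoD(2)[OF rt]) simp
  moreover have "\<forall>\<^sub>F j in at i within I. j \<in> I"
    by (simp add: eventually_at_filter)
  ultimately have "\<forall>\<^sub>F j in at i within I. norm (T (r j) (f j) - T (r j) (f i)) \<le> K * norm (f j - f i)"
  proof eventually_elim
    case (elim j)
    then show ?case
      using local_bound[of "r j" "r i + 1" "f j - f i"] r0[of j] by (simp add: K_def blinfun.diff_right)
  qed
  moreover have "((\<lambda>j. K * norm (f j - f i)) \<longlongrightarrow> 0) (at i within I)"
    using tendsto_mult_right_zero[OF tendsto_norm_zero[OF LIM_zero[OF ft]]] .
  ultimately have "((\<lambda>j. T (r j) (f j) - T (r j) (f i)) \<longlongrightarrow> 0) (at i within I)"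
    by (rule Lim_null_comparison)
  from tendsto_add[OF this 1] show "((\<lambda>j. T (r j) (f j)) \<longlongrightarrow> T (r i) (f i)) (at i within I)"
    by simp
qed

lemma exp_shift: "growth_semigroup (\<lambda>t. exp (- k * t) *\<^sub>R T t) M (\<omega> - k)"
proof
  have "((\<lambda>t. exp (- k * t) *\<^sub>R T t x) \<longlongrightarrow> exp (- k * 0) *\<^sub>R x) (at_right 0)" for x
    using C0 by (intro tendsto_intros) (auto simp: C0_semigroup_def)
  then show "C0_semigroup (\<lambda>t. exp (- k * t) *\<^sub>R T t)"
    using C0 unfolding C0_semigroup_def
    by (auto intro!: blinfun_eqI simp: blinfun.scaleR_left blinfun.scaleR_right exp_add[symmetric] algebra_simps)
  show "norm (exp (- k * t) *\<^sub>R T t) \<le> M * exp ((\<omega> - k) * t)" if "0 \<le> t" for t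
    using bound[OF that] by (simp add: algebra_simps exp_add exp_minus divide_simps exp_diff)
qed

end

section \<open>Fractional powers of the generator of a decaying semigroup\<close>

text \<open>The operator of exponent \<open>- \<gamma>\<close> built from the negative of the
  generator of \<open>S\<close>; the exponential factor of \<open>neg_frac_power\<close> is absorbed
  into the semigroup.\<close>

definition fpow :: "(real \<Rightarrow> 'a::banach \<Rightarrow>\<^sub>L 'a) \<Rightarrow> real \<Rightarrow> 'a \<Rightarrow> 'a" where
  "fpow S \<gamma> x = (1 / Gamma \<gamma>) *\<^sub>R integral {0<..} (\<lambda>t. t powr (\<gamma> - 1) *\<^sub>R S t x)"

lemma neg_frac_power_eq_fpow:
  "\<gamma> \<noteq> 0 \<Longrightarrow> neg_frac_power T a \<gamma> = fpow (\<lambda>t. exp (- a * t) *\<^sub>R T t) \<gamma>"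
  by (auto simp: neg_frac_power_def fpow_def blinfun.scaleR_left)

locale decaying_semigroup = growth_semigroup S M "- \<delta>"
  for S :: "real \<Rightarrow> 'a::banach \<Rightarrow>\<^sub>L 'a" and M \<delta> +
  assumes delta_pos: "0 < \<delta>"
begin

lemma integrable_powr_orbit:
  assumes "0 < \<gamma>"
  shows "(\<lambda>t. t powr (\<gamma> - 1) *\<^sub>R S t x) integrable_on {0<..}"
    and "norm (integral {0<..} (\<lambda>t. t powr (\<gamma> - 1) *\<^sub>R S t x)) \<le> M * norm x * (Gamma \<gamma> / \<delta> powr \<gamma>)"
proof -
  define h where "h = (\<lambda>t. M * norm x * (t powr (\<gamma> - 1) * exp (- \<delta> * t)))"
  have h: "(h has_integral (M * norm x * (Gamma \<gamma> / \<delta> powr \<gamma>))) {0<..}"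
    unfolding h_def by (intro has_integral_mult_right has_integral_Gamma_scaled assms delta_pos)
  have b: "norm (t powr (\<gamma> - 1) *\<^sub>R S t x) \<le> h t" if "t \<in> {0<..}" for t
  proof -
    have "t powr (\<gamma> - 1) * norm (S t x) \<le> t powr (\<gamma> - 1) * (M * exp (- \<delta> * t) * norm x)"
      using norm_apply_le[of t x] that by (intro mult_left_mono) auto
    then show ?thesis by (simp add: h_def ac_simps)
  qed
  show i: "(\<lambda>t. t powr (\<gamma> - 1) *\<^sub>R S t x) integrable_on {0<..}"
  proof (rule dominated_integrable_Ioi[OF _ _ b])
    show "continuous_on {0<..} (\<lambda>t. t powr (\<gamma> - 1) *\<^sub>R S t x)"
      by (intro continuous_intros continuous_on_subset[OF continuous]) auto
  qed (use h in \<open>auto simp: integrable_on_def\<close>)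
  show "norm (integral {0<..} (\<lambda>t. t powr (\<gamma> - 1) *\<^sub>R S t x)) \<le> M * norm x * (Gamma \<gamma> / \<delta> powr \<gamma>)"
    unfolding integral_unique[OF h, symmetric]
    by (rule integral_norm_bound_integral[OF i _ b]) (use h in \<open>auto simp: integrable_on_def\<close>)
qed

lemma bounded_linear_fpow:
  assumes "0 < \<gamma>"
  shows "bounded_linear (fpow S \<gamma>)"
proof (rule bounded_linear_intro)
  have G: "0 < Gamma \<gamma>" using assms by (rule Gamma_real_pos)
  show "fpow S \<gamma> (x + y) = fpow S \<gamma> x + fpow S \<gamma> y" for x y
    using integrable_powr_orbit(1)[OF assms]
    by (simp add: fpow_def blinfun.add_right scaleR_add_right integral_add)
  show "fpow S \<gamma> (c *\<^sub>R x) = c *\<^sub>R fpow S \<gamma> x" for c x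
  proof -
    have "(\<lambda>t. t powr (\<gamma> - 1) *\<^sub>R S t (c *\<^sub>R x)) = (\<lambda>t. c *\<^sub>R (t powr (\<gamma> - 1) *\<^sub>R S t x))"
      by (simp add: blinfun.scaleR_right mult.commute)
    then show ?thesis by (simp only: fpow_def integral_cmul scaleR_left_commute)
  qed
  show "norm (fpow S \<gamma> x) \<le> norm x * (M / \<delta> powr \<gamma>)" for x
    using integrable_powr_orbit(2)[OF assms, of x] G by (simp add: fpow_def field_simps)
qed

text \<open>A bounded operator passes through the integral. The intertwining relation is stated for
  one pair \<open>x\<close>, \<open>y\<close>, which covers commutation with \<open>S s\<close> as
  well as with the derivative of the semigroup.\<close>

lemma bounded_linear_fpow_commute:
  assumes "0 < \<gamma>" and B: "bounded_linear B" and "\<And>t. 0 < t \<Longrightarrow> B (S t x) = S t y"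
  shows "B (fpow S \<gamma> x) = fpow S \<gamma> y"
proof -
  have "B (integral {0<..} (\<lambda>t. t powr (\<gamma> - 1) *\<^sub>R S t x))
      = integral {0<..} (B \<circ> (\<lambda>t. t powr (\<gamma> - 1) *\<^sub>R S t x))"
    using integral_linear[OF integrable_powr_orbit(1)[OF assms(1)] B] by simp
  also have "\<dots> = integral {0<..} (\<lambda>t. t powr (\<gamma> - 1) *\<^sub>R S t y)"
    by (rule integral_cong) (use assms(3) B in \<open>auto simp: linear_scale bounded_linear.linear\<close>)
  finally show ?thesis
    using B by (simp add: fpow_def linear_scale bounded_linear.linear)
qed

lemma fpow_apply: "0 < \<gamma> \<Longrightarrow> 0 \<le> s \<Longrightarrow> fpow S \<gamma> (S s x) = S s (fpow S \<gamma> x)"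
  by (rule bounded_linear_fpow_commute[symmetric]) (auto simp: blinfun.bounded_linear_right commute)

text \<open>After testing with a functional both sides are scalar integrals of h q = \<phi> (S q x).
  The double integral produces Beta \<beta> \<gamma>, which is exactly the quotient of the Gamma
  normalisations.\<close>

lemma fpow_fpow:
  assumes b: "0 < \<beta>" and c: "0 < \<gamma>"
  shows "fpow S \<beta> (fpow S \<gamma> x) = fpow S (\<beta> + \<gamma>) x"
proof (rule eq_if_functionals_eq)
  fix \<phi> :: "'a \<Rightarrow> real" assume \<phi>: "bounded_linear \<phi>"
  note lin = linear_scale[OF bounded_linear.linear[OF \<phi>]]
  define h where "h q = \<phi> (S q x)" for q
  obtain K where K: "\<And>y. norm (\<phi> y) \<le> norm y * K" "0 < K"
    using bounded_linear.pos_bounded[OF \<phi>] by blast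
  have hb: "\<bar>h q\<bar> \<le> (M * norm x * K) * exp (- \<delta> * q)" if "0 < q" for q
  proof -
    have "\<bar>h q\<bar> \<le> norm (S q x) * K" using K(1)[of "S q x"] by (simp add: h_def)
    also have "\<dots> \<le> (M * exp (- \<delta> * q) * norm x) * K"
      using norm_apply_le[of q x] that K(2) by (intro mult_right_mono) auto
    finally show ?thesis by (simp add: ac_simps)
  qed
  have hc: "continuous_on {0<..} h"
    unfolding h_def
    by (intro bounded_linear.continuous_on[OF \<phi>] continuous_on_subset[OF continuous]) auto
  have int: "\<phi> (integral {0<..} (\<lambda>t. t powr (g - 1) *\<^sub>R S t y)) = integral {0<..} (\<lambda>t. t powr (g - 1) * \<phi> (S t y))"
    if "0 < g" for g y
    using integral_linear[OF integrable_powr_orbit(1)[OF that] \<phi>, of y] by (simp add: o_def lin)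
  have inner: "\<phi> (S s (fpow S \<gamma> x)) = 1 / Gamma \<gamma> * integral {0<..} (\<lambda>r. r powr (\<gamma> - 1) * h (s + r))"
    if "0 < s" for s
  proof -
    have "\<phi> (S s (fpow S \<gamma> x)) = \<phi> (fpow S \<gamma> (S s x))"
      using that c by (simp add: fpow_apply)
    also have "\<dots> = 1 / Gamma \<gamma> * integral {0<..} (\<lambda>r. r powr (\<gamma> - 1) * \<phi> (S r (S s x)))"
      by (simp add: fpow_def lin int[OF c])
    also have "integral {0<..} (\<lambda>r. r powr (\<gamma> - 1) * \<phi> (S r (S s x)))
        = integral {0<..} (\<lambda>r. r powr (\<gamma> - 1) * h (s + r))"
      by (rule integral_cong) (use that in \<open>simp add: h_def semigroup commute[of s]\<close>)
    finally show ?thesis .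
  qed
  have "\<phi> (fpow S \<beta> (fpow S \<gamma> x))
      = 1 / Gamma \<beta> * integral {0<..} (\<lambda>s. s powr (\<beta> - 1) * \<phi> (S s (fpow S \<gamma> x)))"
    by (subst fpow_def) (simp add: lin int[OF b])
  also have "integral {0<..} (\<lambda>s. s powr (\<beta> - 1) * \<phi> (S s (fpow S \<gamma> x)))
      = integral {0<..} (\<lambda>s. (1 / Gamma \<gamma>) * (s powr (\<beta> - 1) * integral {0<..} (\<lambda>r. r powr (\<gamma> - 1) * h (s + r))))"
    by (rule integral_cong) (simp add: inner)
  also have "\<dots> = (1 / Gamma \<gamma>) * (Beta \<beta> \<gamma> * integral {0<..} (\<lambda>q. q powr (\<beta> + \<gamma> - 1) * h q))"
    by (subst integral_mult_right) (simp add: iterated_power_integral[OF b c delta_pos hc hb])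
  also have "1 / Gamma \<beta> * \<dots> = 1 / Gamma (\<beta> + \<gamma>) * integral {0<..} (\<lambda>q. q powr (\<beta> + \<gamma> - 1) * h q)"
    using Gamma_real_pos[OF b] Gamma_real_pos[OF c] by (simp add: Beta_def)
  also have "\<dots> = \<phi> (fpow S (\<beta> + \<gamma>) x)"
    using b c by (simp add: fpow_def lin int h_def)
  finally show "\<phi> (fpow S \<beta> (fpow S \<gamma> x)) = \<phi> (fpow S (\<beta> + \<gamma>) x)" .
qed

lemma fpow_1: "fpow S 1 x = integral {0<..} (\<lambda>t. S t x)"
  by (auto simp: fpow_def intro!: integral_cong)

text \<open>The hypothesis expresses through orbits that the generator maps \<open>y\<close> to
  \<open>x\<close>. Integrating the derivative of the orbit of \<open>y\<close> from 0 to infinity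
  leaves 0 - y, so the exponent -1 inverts the negative of the generator.\<close>

lemma fpow_1_derivative:
  assumes d: "\<And>t. 0 < t \<Longrightarrow> ((\<lambda>t. S t y) has_vector_derivative S t x) (at t)"
  shows "fpow S 1 x = - y"
proof -
  have i: "((\<lambda>t. M * norm x * (t powr (1 - 1) * exp (- \<delta> * t))) has_integral
      (M * norm x * (Gamma 1 / \<delta> powr 1))) {0<..}"
    by (intro has_integral_mult_right has_integral_Gamma_scaled) (auto simp: delta_pos)
  have "integral {0<..} (\<lambda>t. S t x) = 0 - y"
  proof (rule integral_Ioi_derivative[OF d])
    show "continuous_on {0<..} (\<lambda>t. S t x)" by (intro continuous_on_subset[OF continuous]) auto
    show "(\<lambda>t. M * norm x * (t powr (1 - 1) * exp (- \<delta> * t))) integrable_on {0<..}"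
      using i by (auto simp: integrable_on_def)
    show "norm (S t x) \<le> M * norm x * (t powr (1 - 1) * exp (- \<delta> * t))" if "0 < t" for t
      using norm_apply_le[of t x] that by (simp add: ac_simps)
    show "((\<lambda>t. S t y) \<longlongrightarrow> y) (at_right 0)"
      using C0 by (simp add: C0_semigroup_def)
    have "((\<lambda>t. M * exp (- \<delta> * t) * norm y) \<longlongrightarrow> M * 0 * norm y) at_top"
    proof (intro tendsto_intros filterlim_compose[OF exp_at_bot])
      show "filterlim (\<lambda>t. - \<delta> * t) at_bot at_top"
        using delta_pos by (intro filterlim_tendsto_neg_mult_at_bot[OF tendsto_const] filterlim_ident) auto
    qed
    then have lim: "((\<lambda>t. M * exp (- \<delta> * t) * norm y) \<longlongrightarrow> 0) at_top" by simp
    show "((\<lambda>t. S t y) \<longlongrightarrow> 0) at_top"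
      by (rule Lim_null_comparison[OF _ lim])
        (use norm_apply_le in \<open>auto simp: eventually_at_top_linorder intro!: exI[of _ 0]\<close>)
  qed
  then show ?thesis by (simp add: fpow_1)
qed

lemma decaying_exp_shift: "0 \<le> k \<Longrightarrow> decaying_semigroup (\<lambda>t. exp (- k * t) *\<^sub>R S t) M (\<delta> + k)"
  using exp_shift[of k] delta_pos by (simp add: decaying_semigroup_def decaying_semigroup_axioms_def)

text \<open>The weight \<open>l\<^sup>n s\<^bsup>n-1\<^esup> e\<^bsup>-ls\<^esup> / \<Gamma>(n)\<close>, \<open>l = n/t\<close>, is a probability density with mean \<open>t\<close> and
  variance \<open>t\<^sup>2/n\<close>, so Chebyshev's inequality gives the exponential formula.\<close>

lemma exponential_formula:
  assumes t: "0 < t"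
  shows "(\<lambda>n. (real n / t) ^ n *\<^sub>R fpow (\<lambda>s. exp (- (real n / t) * s) *\<^sub>R S s) (real n) x) \<longlonglongrightarrow> S t x"
proof -
  define A where "A n = (real n / t) ^ n *\<^sub>R fpow (\<lambda>s. exp (- (real n / t) * s) *\<^sub>R S s) (real n) x" for n
  have bd: "norm (S s x) \<le> M * norm x" if "0 \<le> s" for s
  proof -
    have "exp (- \<delta> * s) \<le> 1" using delta_pos that by simp
    then have "M * exp (- \<delta> * s) * norm x \<le> M * 1 * norm x"
      using M_nonneg by (intro mult_right_mono mult_left_mono) auto
    then show ?thesis using norm_apply_le[OF that, of x] by simp
  qed
  have "\<forall>\<^sub>F n in sequentially. dist (A n) (S t x) < e" if e: "0 < e" for e
  proof -
    obtain d where d: "0 < d" "\<And>s. 0 \<le> s \<Longrightarrow> \<bar>s - t\<bar> < d \<Longrightarrow> norm (S s x - S t x) < e / 2"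
      using continuous[of x, unfolded continuous_on_iff, rule_format, of t "e / 2"] t e
      unfolding dist_real_def dist_norm by auto
    \<comment> \<open>Chebyshev's constant: at distance at least \<open>d\<close> from
      \<open>t\<close> the trivial bound 2 M norm x is at most C (s - t)^2.\<close>
    define C where "C = 2 * M * norm x / d\<^sup>2"
    have C: "0 \<le> C" using M_nonneg by (simp add: C_def)
    have est: "norm (S s x - S t x) \<le> e / 2 + C * (s - t)\<^sup>2" if "0 \<le> s" for s
    proof (cases "\<bar>s - t\<bar> < d")
      case True
      then show ?thesis using d(2)[OF that] C by (smt (verit) mult_nonneg_nonneg zero_le_power2)
    next
      case False
      then have "d\<^sup>2 \<le> (s - t)\<^sup>2" using d(1) by (intro abs_le_square_iff[THEN iffD1]) auto
      then have "C * d\<^sup>2 \<le> C * (s - t)\<^sup>2" using C by (rule mult_left_mono)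
      moreover have "C * d\<^sup>2 = 2 * M * norm x" using d(1) by (simp add: C_def)
      moreover have "norm (S s x - S t x) \<le> 2 * M * norm x"
        using norm_triangle_ineq4[of "S s x" "S t x"] bd[OF that] bd[of t] t by linarith
      ultimately show ?thesis using e by linarith
    qed
    have main: "dist (A n) (S t x) \<le> e / 2 + C * t\<^sup>2 / real n" if n: "0 < n" for n
    proof -
      define l where "l = real n / t"
      have l: "0 < l" using n t by (simp add: l_def)
      define p where "p s = s powr (real n - 1) * exp (- l * s)" for s
      have G: "0 < Gamma (real n)" using n by (intro Gamma_real_pos) simp
      have np: "real n \<notin> \<int>\<^sub>\<le>\<^sub>0" "real n + 1 \<notin> \<int>\<^sub>\<le>\<^sub>0"
        using nonpos_Ints_nonpos[of "real n"] nonpos_Ints_nonpos[of "real n + 1"] n by auto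
      have ln: "l ^ n = l powr real n" using l by (simp add: powr_realpow)
      \<comment> \<open>\<open>c\<close> normalises \<open>p\<close> to a probability density; the
        integrals \<open>p0\<close>, \<open>p1\<close>, \<open>p2\<close> are its moments up to that
        factor.\<close>
      define c where "c = l ^ n / Gamma (real n)"
      have c: "0 < c" using l G by (simp add: c_def)
      have p0: "(p has_integral (1 / c)) {0<..}"
        unfolding p_def c_def ln using has_integral_Gamma_scaled[of "real n" l] n l by simp
      have p1: "((\<lambda>s. s * p s) has_integral (t / c)) {0<..}"
      proof -
        have "((\<lambda>s. s powr (real n + 1 - 1) * exp (- l * s)) has_integral (Gamma (real n + 1) / l powr (real n + 1))) {0<..}"
          using n l by (intro has_integral_Gamma_scaled) auto
        moreover have "Gamma (real n + 1) / l powr (real n + 1) = t / c"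
        proof -
          have "Gamma (real n + 1) = real n * Gamma (real n)" using Gamma_plus1[OF np(1)] .
          moreover have "l powr (real n + 1) = l ^ n * l" using l by (simp add: powr_add ln)
          ultimately have "Gamma (real n + 1) / l powr (real n + 1) = (real n / l) / c" by (simp add: c_def)
          also have "real n / l = t" using n t by (simp add: l_def)
          finally show ?thesis .
        qed
        moreover have "s * p s = s powr (real n + 1 - 1) * exp (- l * s)" if "s \<in> {0<..}" for s
          using that by (simp add: p_def powr_mult_base[symmetric] mult.assoc[symmetric])
             (simp add: powr_diff)
        ultimately show ?thesis by (metis (mono_tags, lifting) has_integral_cong)
      qed
      have p2: "((\<lambda>s. s\<^sup>2 * p s) has_integral ((t\<^sup>2 + t\<^sup>2 / real n) / c)) {0<..}"
      proof -
        have "((\<lambda>s. s powr (real n + 2 - 1) * exp (- l * s)) has_integral (Gamma (real n + 2) / l powr (real n + 2))) {0<..}"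
          using n l by (intro has_integral_Gamma_scaled) auto
        moreover have "Gamma (real n + 2) / l powr (real n + 2) = (t\<^sup>2 + t\<^sup>2 / real n) / c"
        proof -
          have "Gamma (real n + 2) = (real n + 1) * (real n * Gamma (real n))"
            using Gamma_plus1[OF np(1)] Gamma_plus1[OF np(2)] by (simp add: add.assoc)
          moreover have "l powr (real n + 2) = l ^ n * l\<^sup>2"
            using l by (simp add: powr_add ln)
          ultimately have "Gamma (real n + 2) / l powr (real n + 2) = ((real n + 1) * real n / l\<^sup>2) / c"
            by (simp add: c_def ac_simps)
          also have "(real n + 1) * real n / l\<^sup>2 = t\<^sup>2 + t\<^sup>2 / real n"
            using n t by (simp add: l_def power2_eq_square field_simps)
          finally show ?thesis .
        qed
        moreover have "s\<^sup>2 * p s = s powr (real n + 2 - 1) * exp (- l * s)" if "s \<in> {0<..}" for s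
        proof -
          have "s powr (real n + 2 - 1) = s powr (real n - 1) * s powr 2"
            by (subst powr_add[symmetric]) simp
          then show ?thesis using that by (simp add: p_def)
        qed
        ultimately show ?thesis by (metis (mono_tags, lifting) has_integral_cong)
      qed
      \<comment> \<open>Expectation of the pointwise estimate \<open>est\<close>: the quadratic term
        contributes the variance, because the mean is exactly \<open>t\<close>.\<close>
      have q: "((\<lambda>s. p s * (e / 2 + C * (s - t)\<^sup>2)) has_integral ((e / 2 + C * t\<^sup>2 / real n) / c)) {0<..}"
      proof -
        have "((\<lambda>s. (e / 2) * p s + C * (s\<^sup>2 * p s - 2 * t * (s * p s) + t\<^sup>2 * p s)) has_integral
            ((e / 2) * (1 / c) + C * ((t\<^sup>2 + t\<^sup>2 / real n) / c - 2 * t * (t / c) + t\<^sup>2 * (1 / c)))) {0<..}"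
          by (intro has_integral_add has_integral_mult_right has_integral_diff p0 p1 p2)
        moreover have "(e / 2) * (1 / c) + C * ((t\<^sup>2 + t\<^sup>2 / real n) / c - 2 * t * (t / c) + t\<^sup>2 * (1 / c))
            = (e / 2 + C * t\<^sup>2 / real n) / c"
          using c n by (simp add: field_simps power2_eq_square)
        moreover have "(e / 2) * p s + C * (s\<^sup>2 * p s - 2 * t * (s * p s) + t\<^sup>2 * p s) = p s * (e / 2 + C * (s - t)\<^sup>2)" for s
          by (simp add: power2_eq_square algebra_simps)
        ultimately show ?thesis by simp
      qed
      interpret L: decaying_semigroup "\<lambda>s. exp (- l * s) *\<^sub>R S s" M "\<delta> + l"
        by (rule decaying_exp_shift) (use l in simp)
      have eqp: "s powr (real n - 1) *\<^sub>R ((exp (- l * s) *\<^sub>R S s) x) = p s *\<^sub>R S s x" for s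
        by (simp add: p_def blinfun.scaleR_left)
      have Li: "(\<lambda>s. p s *\<^sub>R S s x) integrable_on {0<..}"
        using L.integrable_powr_orbit(1)[of "real n" x] n unfolding eqp by simp
      have A: "A n = c *\<^sub>R integral {0<..} (\<lambda>s. p s *\<^sub>R S s x)"
        unfolding A_def fpow_def l_def[symmetric] eqp by (simp add: c_def)
      have P: "((\<lambda>s. p s *\<^sub>R S t x) has_integral (1 / c) *\<^sub>R S t x) {0<..}"
        using has_integral_linear[OF p0 bounded_linear_scaleR_left, of "S t x"] by (simp add: o_def)
      have "A n - S t x = c *\<^sub>R (integral {0<..} (\<lambda>s. p s *\<^sub>R S s x) - integral {0<..} (\<lambda>s. p s *\<^sub>R S t x))"
        using c by (simp add: A integral_unique[OF P] scaleR_diff_right)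
      also have "\<dots> = c *\<^sub>R integral {0<..} (\<lambda>s. p s *\<^sub>R S s x - p s *\<^sub>R S t x)"
        using P by (subst integral_diff[OF Li]) (auto simp: integrable_on_def)
      finally have "norm (A n - S t x) = c * norm (integral {0<..} (\<lambda>s. p s *\<^sub>R S s x - p s *\<^sub>R S t x))"
        using c by simp
      also have "\<dots> \<le> c * integral {0<..} (\<lambda>s. p s * (e / 2 + C * (s - t)\<^sup>2))"
      proof (rule mult_left_mono, rule integral_norm_bound_integral)
        show "(\<lambda>s. p s *\<^sub>R S s x - p s *\<^sub>R S t x) integrable_on {0<..}"
          by (rule integrable_diff[OF Li]) (use P in \<open>auto simp: integrable_on_def\<close>)
        show "(\<lambda>s. p s * (e / 2 + C * (s - t)\<^sup>2)) integrable_on {0<..}"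
          using q by (auto simp: integrable_on_def)
        show "norm (p s *\<^sub>R S s x - p s *\<^sub>R S t x) \<le> p s * (e / 2 + C * (s - t)\<^sup>2)" if "s \<in> {0<..}" for s
        proof -
          have "0 \<le> p s" by (simp add: p_def)
          then show ?thesis using est[of s] that
            by (simp add: scaleR_diff_right[symmetric] mult_left_mono)
        qed
      qed (use c in simp)
      also have "\<dots> = e / 2 + C * t\<^sup>2 / real n"
        using c by (simp add: integral_unique[OF q])
      finally show ?thesis by (simp add: dist_norm)
    qed
    have "(\<lambda>n. C * t\<^sup>2 / real n) \<longlonglongrightarrow> 0"
      by (rule lim_const_over_n)
    then have "\<forall>\<^sub>F n in sequentially. C * t\<^sup>2 / real n < e / 2"
      by (rule order_tendstoD(2)) (use e in simp)
    with eventually_gt_at_top[of 0] show ?thesis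
    proof eventually_elim
      case (elim n)
      then show ?case using main[of n] by linarith
    qed
  qed
  then have "A \<longlonglongrightarrow> S t x" by (rule tendstoI)
  then show ?thesis unfolding A_def .
qed

end

section \<open>Analytic semigroups\<close>

lemma has_vector_derivative_translate:
  fixes s t :: real
  assumes "(f has_vector_derivative f') (at (t + s))"
  shows "((\<lambda>r. f (r + s)) has_vector_derivative f') (at t)"
proof -
  have "((\<lambda>r. r + s) has_vector_derivative 1) (at t)"
    by (auto intro!: derivative_eq_intros simp flip: has_real_derivative_iff_has_vector_derivative)
  from vector_diff_chain_at[OF this, of f f'] assms show ?thesis by (simp add: o_def)
qed

text \<open>T t = T (t - r) T r near \<open>t\<close>, so differentiability of an orbit at one time
  propagates to all later times.\<close>

lemma C0_semigroup_derivative: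
  assumes T: "C0_semigroup T" and d: "((\<lambda>t. T t x) has_vector_derivative v) (at r)"
    and r: "0 < r" "r \<le> t"
  shows "((\<lambda>t. T t x) has_vector_derivative T (t - r) v) (at t)"
proof -
  have "((\<lambda>s. T (s + (r - t)) x) has_vector_derivative v) (at t)"
    by (rule has_vector_derivative_translate) (use d in simp)
  then have "((\<lambda>s. T (t - r) (T (s + (r - t)) x)) has_vector_derivative T (t - r) v) (at t)"
    by (rule bounded_linear.has_vector_derivative[OF blinfun.bounded_linear_right])
  then show ?thesis
  proof (rule has_vector_derivative_transform_within_open[of _ _ _ "{t - r<..}"])
    fix s assume "s \<in> {t - r<..}"
    moreover have "T (p + q) = T p o\<^sub>L T q" if "0 \<le> p" "0 \<le> q" for p q
      using T that by (simp add: C0_semigroup_def)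
    from this[of "t - r" "s + (r - t)"] have "T ((t - r) + (s + (r - t))) x = T (t - r) (T (s + (r - t)) x)"
      if "t - r < s" using r that by simp
    ultimately show "T (t - r) (T (s + (r - t)) x) = T s x" by simp
  qed (use r in auto)
qed

lemma cscale_of_real: "cscale (of_real h) q = h *\<^sub>R q"
  by (simp add: cscale_def scaleR_prod_def)

text \<open>Continuity of Arg at 1 gives one ball; sectors are invariant under positive scaling,
  which turns it into balls of radius proportional to \<open>t\<close>.\<close>

lemma sector_ball:
  assumes "0 < \<theta>"
  obtains \<kappa> where "0 < \<kappa>" "\<kappa> \<le> 1" "\<And>t. 0 < t \<Longrightarrow> ball (complex_of_real t) (\<kappa> * t) \<subseteq> sector \<theta>"
proof -
  have "isCont Arg 1" by (rule continuous_at_Arg) simp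
  then have "(Arg \<longlongrightarrow> Arg 1) (at 1)" by (simp add: isCont_def)
  from tendstoD[OF this assms] obtain k where k: "0 < k" "\<And>z. z \<noteq> 1 \<Longrightarrow> dist z 1 < k \<Longrightarrow> dist (Arg z) (Arg 1) < \<theta>"
    by (auto simp: eventually_at)
  have Arg1: "Arg 1 = 0" using Arg_of_real[of 1] by simp
  have A: "\<bar>Arg z\<bar> < \<theta>" if "dist z 1 < k" for z
    using k(2)[of z] that Arg1 assms by (cases "z = 1") (auto simp: dist_real_def)
  show thesis
  proof (rule that[of "min k 1"])
    fix t :: real assume t: "0 < t"
    show "ball (complex_of_real t) (min k 1 * t) \<subseteq> sector \<theta>"
    proof
      fix z assume z: "z \<in> ball (complex_of_real t) (min k 1 * t)"
      define w where "w = z / of_real t"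
      have zw: "z = of_real t * w" using t by (simp add: w_def)
      have "dist z (of_real t) = t * dist w 1"
      proof -
        have "z - of_real t = of_real t * (w - 1)" by (simp add: zw algebra_simps)
        then show ?thesis using t by (simp add: dist_norm norm_mult)
      qed
      then have d: "dist w 1 < min k 1" using z t by (simp add: dist_commute)
      then have "w \<noteq> 0" by auto
      moreover have "Arg z = Arg w" using t by (simp add: zw)
      ultimately show "z \<in> sector \<theta>" using A[of w] d t by (simp add: sector_def zw)
    qed
  qed (use k in auto)
qed

text \<open>Were there no bound, points tending to 0 in the sector would carry operators of
  unbounded norm, although strong continuity makes these pointwise convergent; uniform boundedness
  excludes this.\<close>

lemma holomorphic_semigroup_bounded_near_0:
  assumes S: "holomorphic_semigroup \<theta> S"
  obtains M r where "0 < r" "\<And>z. z \<in> sector \<theta> \<Longrightarrow> norm z < r \<Longrightarrow> norm (S z) \<le> M"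
proof -
  have lim: "((\<lambda>z. S z p) \<longlongrightarrow> p) (at 0 within sector \<theta>)" for p
    using S unfolding holomorphic_semigroup_def by blast
  have "\<exists>n::nat. \<forall>z\<in>sector \<theta>. norm z < 1 / real (Suc n) \<longrightarrow> norm (S z) \<le> real n"
  proof (rule ccontr)
    assume "\<not> ?thesis"
    then obtain z where z: "\<And>n. z n \<in> sector \<theta>" "\<And>n. norm (z n) < 1 / real (Suc n)" "\<And>n. real n < norm (S (z n))"
      by (auto simp: not_le) metis
    have "(\<lambda>n. norm (z n)) \<longlonglongrightarrow> 0"
    proof (rule tendsto_sandwich[of "\<lambda>_. 0"])
      show "(\<lambda>n. 1 / real (Suc n)) \<longlonglongrightarrow> 0"
        using LIMSEQ_inverse_real_of_nat by (simp add: inverse_eq_divide)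
      show "\<forall>\<^sub>F n in sequentially. norm (z n) \<le> 1 / real (Suc n)"
        using z(2) less_imp_le by (intro always_eventually) blast
    qed auto
    then have "z \<longlonglongrightarrow> 0" by (rule tendsto_norm_zero_cancel)
    moreover have "z n \<noteq> 0" for n using z(1)[of n] by (auto simp: sector_def)
    ultimately have "filterlim z (at 0 within sector \<theta>) sequentially"
      using z(1) by (auto simp: filterlim_at)
    then have "(\<lambda>n. S (z n) p) \<longlonglongrightarrow> p" for p
      by (rule filterlim_compose[OF lim])
    then have "bounded (range (\<lambda>n. S (z n) p))" for p
      by (rule convergent_imp_bounded)
    then obtain M where M: "\<And>n. norm (S (z n)) \<le> M"
      using uniform_boundedness[of "\<lambda>n. S (z n)"] by blast
    obtain n where "M \<le> real n" using real_arch_simple by blast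
    then show False using M[of n] z(3)[of n] by linarith
  qed
  then obtain n :: nat where "\<And>z. z \<in> sector \<theta> \<Longrightarrow> norm z < 1 / real (Suc n) \<Longrightarrow> norm (S z) \<le> real n"
    by blast
  then show thesis by (intro that[of "1 / real (Suc n)"]) auto
qed

text \<open>Cauchy's inequality, applied after composing with the complexification of a norming
  functional.\<close>

lemma Cauchy_estimate_cscale:
  fixes f :: "complex \<Rightarrow> 'a::real_normed_vector \<times> 'a"
  assumes d: "\<And>z. z \<in> ball c R \<Longrightarrow> \<exists>q. (f has_derivative (\<lambda>h. cscale h q)) (at z)"
    and r: "0 < r" "r < R" and B: "\<And>z. z \<in> ball c R \<Longrightarrow> norm (f z) \<le> B"
    and q: "(f has_derivative (\<lambda>h. cscale h q)) (at c)"
  shows "norm (fst q) \<le> 2 * B / r"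
proof -
  obtain \<phi> :: "'a \<Rightarrow> real" where \<phi>: "bounded_linear \<phi>" "\<And>y. \<bar>\<phi> y\<bar> \<le> norm y" "\<phi> (fst q) = norm (fst q)"
    using norming_functional[of "fst q"] by metis
  have lin: "linear \<phi>" using \<phi>(1) by (rule bounded_linear.linear)
  \<comment> \<open>Complexification of the real functional. The constant 2 in the conclusion comes
    from estimating the modulus by the sum of real and imaginary part.\<close>
  define \<Phi> where "\<Phi> p = Complex (\<phi> (fst p)) (\<phi> (snd p))" for p
  have \<Phi>n: "norm (\<Phi> p) \<le> 2 * norm p" for p
  proof -
    have "norm (\<Phi> p) \<le> \<bar>\<phi> (fst p)\<bar> + \<bar>\<phi> (snd p)\<bar>"
      using cmod_le[of "\<Phi> p"] by (simp add: \<Phi>_def)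
    also have "\<dots> \<le> norm (fst p) + norm (snd p)" by (intro add_mono \<phi>)
    also have "\<dots> \<le> 2 * norm p" using norm_fst_le[of "fst p" "snd p"] norm_snd_le[of "snd p" "fst p"] by simp
    finally show ?thesis .
  qed
  have \<Phi>: "bounded_linear \<Phi>"
    by (rule bounded_linear_intro[of _ 2])
      (use \<Phi>n lin in \<open>auto simp: \<Phi>_def linear_add linear_scale complex_eq_iff mult.commute\<close>)
  have cs: "\<Phi> (cscale h p) = \<Phi> p * h" for h p
    using lin by (simp add: \<Phi>_def cscale_def linear_add linear_diff linear_scale complex_eq_iff)
  have D: "((\<lambda>z. \<Phi> (f z)) has_field_derivative \<Phi> p) (at z)"
    if "(f has_derivative (\<lambda>h. cscale h p)) (at z)" for z p
    using bounded_linear.has_derivative[OF \<Phi> that] by (simp add: has_field_derivative_def cs)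
  have hol: "(\<lambda>z. \<Phi> (f z)) holomorphic_on ball c R"
    unfolding holomorphic_on_def field_differentiable_def
    using d D has_field_derivative_at_within by blast
  have "norm ((deriv ^^ 1) (\<lambda>z. \<Phi> (f z)) c) \<le> fact 1 * (2 * B) / r ^ 1"
  proof (rule Cauchy_inequality)
    show "(\<lambda>z. \<Phi> (f z)) holomorphic_on ball c r"
      by (rule holomorphic_on_subset[OF hol]) (use r in auto)
    show "continuous_on (cball c r) (\<lambda>z. \<Phi> (f z))"
      by (rule holomorphic_on_imp_continuous_on[OF holomorphic_on_subset[OF hol]]) (use r in auto)
    show "norm (\<Phi> (f x)) \<le> 2 * B" if "norm (c - x) = r" for x
    proof -
      have "x \<in> ball c R" using that r by (simp add: dist_norm)
      then show ?thesis using \<Phi>n[of "f x"] B[of x] by linarith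
    qed
  qed (use r in simp)
  moreover have "deriv (\<lambda>z. \<Phi> (f z)) c = \<Phi> q" using D[OF q] by (rule DERIV_imp_deriv)
  moreover have "norm (fst q) \<le> norm (\<Phi> q)"
    using abs_Re_le_cmod[of "\<Phi> q"] \<phi>(3) by (simp add: \<Phi>_def)
  ultimately show ?thesis by simp
qed

text \<open>Cauchy's inequality on a disc of radius proportional to \<open>t\<close> gives a
  derivative of size 1/t, as long as the disc stays in the region near 0 where the holomorphic
  extension is bounded.\<close>

lemma analytic_semigroup_derivative:
  fixes T :: "real \<Rightarrow> 'a::banach \<Rightarrow>\<^sub>L 'a"
  assumes T: "analytic_semigroup T"
  obtains V :: "real \<Rightarrow> 'a \<Rightarrow>\<^sub>L 'a" and C \<rho> where "0 < \<rho>"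
    "\<And>t x. 0 < t \<Longrightarrow> ((\<lambda>t. T t x) has_vector_derivative V t x) (at t)"
    "\<And>t. 0 < t \<Longrightarrow> t \<le> \<rho> \<Longrightarrow> norm (V t) \<le> C / t"
proof -
  obtain \<theta> S where \<theta>: "0 < \<theta>" and S: "holomorphic_semigroup \<theta> S"
    and ST: "\<And>t x y. 0 < t \<Longrightarrow> S (complex_of_real t) (x, y) = (T t x, T t y)"
    using T by (auto simp: analytic_semigroup_def)
  have C0: "C0_semigroup T" using T by (simp add: analytic_semigroup_def)
  have hol: "\<exists>q. ((\<lambda>w. S w p) has_derivative (\<lambda>h. cscale h q)) (at z)" if "z \<in> sector \<theta>" for z p
    using S that unfolding holomorphic_semigroup_def by blast
  obtain \<kappa> where \<kappa>: "0 < \<kappa>" "\<kappa> \<le> 1" and ball: "\<And>t. 0 < t \<Longrightarrow> ball (complex_of_real t) (\<kappa> * t) \<subseteq> sector \<theta>"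
    using sector_ball[OF \<theta>] by metis
  obtain M r where r: "0 < r" and M: "\<And>z. z \<in> sector \<theta> \<Longrightarrow> norm z < r \<Longrightarrow> norm (S z) \<le> M"
    using holomorphic_semigroup_bounded_near_0[OF S] by metis
  define D where "D t x = vector_derivative (\<lambda>t. T t x) (at t)" for t x
  have real_der: "((\<lambda>t. T t x) has_vector_derivative fst q) (at t)"
    if t: "0 < t" and q: "((\<lambda>w. S w (x, 0)) has_derivative (\<lambda>h. cscale h q)) (at (complex_of_real t))" for t x q
  proof -
    have "((\<lambda>s. S (complex_of_real s) (x, 0)) has_derivative (\<lambda>h. cscale (complex_of_real h) q)) (at t)"
      by (rule has_derivative_compose[of complex_of_real complex_of_real, OF _ q])
        (auto intro!: derivative_eq_intros bounded_linear_imp_has_derivative bounded_linear_of_real)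
    then have "((\<lambda>s. fst (S (complex_of_real s) (x, 0))) has_derivative (\<lambda>h. fst (h *\<^sub>R q))) (at t)"
      unfolding cscale_of_real by (rule has_derivative_fst)
    then have "((\<lambda>s. fst (S (complex_of_real s) (x, 0))) has_vector_derivative fst q) (at t)"
      by (simp add: has_vector_derivative_def)
    then show ?thesis
      by (rule has_vector_derivative_transform_within_open[of _ _ _ "{0<..}"]) (use t ST in auto)
  qed
  have der: "((\<lambda>t. T t x) has_vector_derivative D t x) (at t)" if "0 < t" for t x
  proof -
    have "complex_of_real t \<in> sector \<theta>" using that \<theta> by (simp add: sector_def)
    then obtain q where "((\<lambda>w. S w (x, 0)) has_derivative (\<lambda>h. cscale h q)) (at (complex_of_real t))"
      using hol by blast
    from real_der[OF that this] show ?thesis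
      unfolding D_def using vector_derivative_at by metis
  qed
  \<comment> \<open>t \<le> r/4 keeps the ball of radius \<kappa> t around \<open>t\<close> inside
    norm less than \<open>r\<close>; the estimate is taken on the half radius \<kappa> t / 2, hence
    the 4.\<close>
  have bd: "norm (D t x) \<le> (4 * M / \<kappa>) / t * norm x" if t: "0 < t" "t \<le> r / 4" for t x
  proof -
    have "complex_of_real t \<in> sector \<theta>" using t \<theta> by (simp add: sector_def)
    then obtain q where q: "((\<lambda>w. S w (x, 0)) has_derivative (\<lambda>h. cscale h q)) (at (complex_of_real t))"
      using hol by blast
    have Dq: "D t x = fst q"
      unfolding D_def by (rule vector_derivative_at[OF real_der[OF t(1) q]])
    have "norm (fst q) \<le> 2 * (M * norm x) / (\<kappa> * t / 2)"
    proof (rule Cauchy_estimate_cscale[OF _ _ _ _ q])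
      show "\<exists>q. ((\<lambda>w. S w (x, 0)) has_derivative (\<lambda>h. cscale h q)) (at z)"
        if "z \<in> ball (complex_of_real t) (\<kappa> * t)" for z
        using hol ball[OF t(1)] that by blast
      show "norm (S z (x, 0)) \<le> M * norm x" if z: "z \<in> ball (complex_of_real t) (\<kappa> * t)" for z
      proof -
        have "norm z \<le> norm (z - complex_of_real t) + norm (complex_of_real t)"
          using norm_triangle_ineq[of "z - complex_of_real t" "complex_of_real t"] by simp
        also have "\<dots> < \<kappa> * t + t" using z t by (simp add: dist_norm norm_minus_commute)
        also have "\<dots> \<le> 2 * t" using \<kappa> t by simp
        also have "\<dots> < r" using t by simp
        finally have "norm (S z) \<le> M" using M ball[OF t(1)] z by blast
        then have "norm (S z (x, 0)) \<le> M * norm (x, 0::'a)"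
          by (meson norm_blinfun mult_right_mono norm_ge_zero order_trans)
        then show ?thesis by (simp add: norm_Pair)
      qed
    qed (use \<kappa> t in auto)
    also have "\<dots> = (4 * M / \<kappa>) / t * norm x" using \<kappa> t by (simp add: field_simps)
    finally show ?thesis by (simp add: Dq)
  qed
  define \<rho> where "\<rho> = r / 4"
  have \<rho>: "0 < \<rho>" using r by (simp add: \<rho>_def)
  have Dsemi: "D t x = T (t - \<rho>) (D \<rho> x)" if "\<rho> \<le> t" for t x
    unfolding D_def[of t]
    by (rule vector_derivative_at[OF C0_semigroup_derivative[OF C0 der[OF \<rho>] \<rho> that]])
  have bl: "bounded_linear (D t)" if t: "0 < t" for t
  proof -
    have "\<exists>K. \<forall>x. norm (D t x) \<le> norm x * K"
    proof (cases "t \<le> \<rho>")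
      case True
      then show ?thesis
        using bd[OF t] by (intro exI[of _ "(4 * M / \<kappa>) / t"]) (simp add: \<rho>_def mult.commute)
    next
      case False
      have "norm (D t x) \<le> norm x * (norm (T (t - \<rho>)) * ((4 * M / \<kappa>) / \<rho>))" for x
      proof -
        have "norm (D t x) \<le> norm (T (t - \<rho>)) * norm (D \<rho> x)"
          using Dsemi[of t x] False norm_blinfun by simp
        also have "\<dots> \<le> norm (T (t - \<rho>)) * ((4 * M / \<kappa>) / \<rho> * norm x)"
          using bd[OF \<rho>, of x] by (intro mult_left_mono) (auto simp: \<rho>_def)
        finally show ?thesis by (simp add: ac_simps)
      qed
      then show ?thesis by blast
    qed
    then obtain K where K: "\<And>x. norm (D t x) \<le> norm x * K" by blast
    show ?thesis
    proof (rule bounded_linear_intro[OF _ _ K])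
      show "D t (x + y) = D t x + D t y" for x y
        unfolding D_def[of t "x + y"] blinfun.add_right
        by (rule vector_derivative_at) (intro has_vector_derivative_add der t)
      show "D t (c *\<^sub>R x) = c *\<^sub>R D t x" for c x
        unfolding D_def[of t "c *\<^sub>R x"] blinfun.scaleR_right
        by (rule vector_derivative_at)
          (intro bounded_linear.has_vector_derivative[OF bounded_linear_scaleR_right] der t)
    qed
  qed
  define V where "V t = Blinfun (D t)" for t
  have V: "V t x = D t x" if "0 < t" for t x
    unfolding V_def by (simp add: bounded_linear_Blinfun_apply bl that)
  show thesis
  proof (rule that[of \<rho> V "max 0 (4 * M / \<kappa>)"])
    show "0 < \<rho>" by fact
    show "((\<lambda>t. T t x) has_vector_derivative V t x) (at t)" if "0 < t" for t x
      using der[OF that] V[OF that] by simp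
    show "norm (V t) \<le> max 0 (4 * M / \<kappa>) / t" if t: "0 < t" "t \<le> \<rho>" for t
    proof (rule norm_blinfun_bound)
      show "0 \<le> max 0 (4 * M / \<kappa>) / t" using t by simp
      fix x :: 'a
      have "(4 * M / \<kappa>) / t * norm x \<le> max 0 (4 * M / \<kappa>) / t * norm x"
        using t by (intro mult_right_mono divide_right_mono) auto
      then show "norm (V t x) \<le> max 0 (4 * M / \<kappa>) / t * norm x"
        using bd[of t x] t V[of t x] by (simp add: \<rho>_def)
    qed
  qed
qed

section \<open>The smoothing kernel and its singularity\<close>

text \<open>The bound C/t holds on the whole half-line: near 0 it expresses analyticity, at infinity
  it follows from decay. Both ends are used when \<open>W t\<close> is integrated against a power
  weight.\<close>

locale analytic_decay = decaying_semigroup S M \<delta>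
  for S :: "real \<Rightarrow> 'a::banach \<Rightarrow>\<^sub>L 'a" and M \<delta> +
  fixes W :: "real \<Rightarrow> 'a \<Rightarrow>\<^sub>L 'a" and C :: real
  assumes derivative: "\<And>t x. 0 < t \<Longrightarrow> ((\<lambda>t. S t x) has_vector_derivative W t x) (at t)"
    and derivative_bound: "\<And>t. 0 < t \<Longrightarrow> norm (W t) \<le> C / t"
begin

lemma derivative_shift: "0 < t \<Longrightarrow> 0 \<le> s \<Longrightarrow> ((\<lambda>r. S (r + s) x) has_vector_derivative W (t + s) x) (at t)"
  by (intro has_vector_derivative_translate derivative) simp

text \<open>Uniqueness of derivatives: the orbit at time r + s can be written with
  \<open>S s\<close> outside or inside, and both forms are differentiated in
  \<open>r\<close>.\<close>

lemma W_semigroup: "0 < t \<Longrightarrow> 0 \<le> s \<Longrightarrow> W (t + s) x = S s (W t x)"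
  and W_apply: "0 < t \<Longrightarrow> 0 \<le> s \<Longrightarrow> W (t + s) x = W t (S s x)"
proof -
  assume ts: "0 < t" "0 \<le> s"
  have eq: "S (r + s) x = S s (S r x)" "S (r + s) x = S r (S s x)" if "r \<in> {0<..}" for r
    using semigroup[of r s x] commute[of r s x] that ts by auto
  have "((\<lambda>r. S s (S r x)) has_vector_derivative S s (W t x)) (at t)"
    by (rule bounded_linear.has_vector_derivative[OF blinfun.bounded_linear_right derivative[OF ts(1)]])
  moreover have "((\<lambda>r. S s (S r x)) has_vector_derivative W (t + s) x) (at t)"
    by (rule has_vector_derivative_transform_within_open[OF derivative_shift[OF ts], of "{0<..}"])
      (use ts eq in auto)
  ultimately show "W (t + s) x = S s (W t x)" by (rule vector_derivative_unique_at[symmetric])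
  have "((\<lambda>r. S r (S s x)) has_vector_derivative W (t + s) x) (at t)"
    by (rule has_vector_derivative_transform_within_open[OF derivative_shift[OF ts], of "{0<..}"])
      (use ts eq in auto)
  with derivative[OF ts(1)] show "W (t + s) x = W t (S s x)" by (rule vector_derivative_unique_at[symmetric])
qed

lemma fpow_1_W: "0 < t \<Longrightarrow> fpow S 1 (W t x) = - S t x"
proof (rule fpow_1_derivative)
  fix s :: real assume t: "0 < t" and s: "0 < s"
  have "((\<lambda>s. S s (S t x)) has_vector_derivative W (s + t) x) (at s)"
    using derivative[OF s, of "S t x"] W_apply[of s t x] s t by simp
  then show "((\<lambda>s. S s (S t x)) has_vector_derivative S s (W t x)) (at s)"
    using W_semigroup[of t s x] s t by (simp add: add.commute)
qed

text \<open>\<open>W t\<close> commutes with the inverse and composed with it gives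
  \<open>- S t\<close>. So a vector killed by the inverse is killed by every \<open>S t\<close>, and
  t tends to 0.\<close>

lemma fpow_1_eq_0: "fpow S 1 x = 0 \<Longrightarrow> x = 0"
proof -
  assume x: "fpow S 1 x = 0"
  have "S t x = 0" if t: "0 < t" for t
  proof -
    have "W t (fpow S 1 x) = fpow S 1 (W t x)"
    proof (rule bounded_linear_fpow_commute)
      show "W t (S s x) = S s (W t x)" if "0 < s" for s
        using W_semigroup[of t s x] W_apply[of t s x] t that by simp
    qed (auto simp: blinfun.bounded_linear_right)
    then show ?thesis using fpow_1_W[OF t, of x] x by (simp add: blinfun.zero_right)
  qed
  then have "\<forall>\<^sub>F t in at_right 0. S t x = 0"
    by (auto simp: eventually_at_filter)
  then have "((\<lambda>t. S t x) \<longlongrightarrow> 0) (at_right 0)" by (rule tendsto_eventually)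
  moreover have "((\<lambda>t. S t x) \<longlongrightarrow> x) (at_right 0)" using C0 by (simp add: C0_semigroup_def)
  ultimately show "x = 0" by (rule tendsto_unique[OF trivial_limit_at_right_real, symmetric])
qed

text \<open>Composition with the power of exponent -(1 - \<alpha>) gives the inverse itself, which
  is injective.\<close>

lemma fpow_inj:
  assumes "0 < \<alpha>" "\<alpha> < 1"
  shows "inj (fpow S \<alpha>)"
proof (rule linear_injective_0[THEN iffD2, rule_format])
  show "linear (fpow S \<alpha>)" using bounded_linear_fpow[OF assms(1)] bounded_linear.linear by blast
  fix x assume "fpow S \<alpha> x = 0"
  then have "fpow S (1 - \<alpha>) (fpow S \<alpha> x) = 0"
    using bounded_linear_fpow[of "1 - \<alpha>"] assms by (simp add: linear_0 bounded_linear.linear)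
  then show "x = 0" using fpow_fpow[of "1 - \<alpha>" \<alpha> x] assms fpow_1_eq_0 by simp
qed

text \<open>\<open>frac_kernel \<alpha> t = A\<^sub>1\<^sup>\<alpha> S(t)\<close>, factored as \<open>A\<^sub>1\<^bsup>-(1-\<alpha>)\<^esup> A\<^sub>1 S(t)\<close>, where \<open>W t = - A\<^sub>1 S(t)\<close>.\<close>

definition frac_kernel :: "real \<Rightarrow> real \<Rightarrow> 'a \<Rightarrow>\<^sub>L 'a" where
  "frac_kernel \<alpha> t = (if 0 < t then Blinfun (\<lambda>x. - fpow S (1 - \<alpha>) (W t x)) else 0)"

context
  fixes \<alpha> :: real
  assumes \<alpha>: "0 < \<alpha>" "\<alpha> < 1"
begin

lemma frac_kernel_apply: "0 < t \<Longrightarrow> frac_kernel \<alpha> t x = - fpow S (1 - \<alpha>) (W t x)"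
proof -
  assume "0 < t"
  have "bounded_linear (\<lambda>x. - fpow S (1 - \<alpha>) (W t x))"
    by (intro bounded_linear_minus bounded_linear_compose[OF bounded_linear_fpow])
      (use \<alpha> in \<open>auto simp: blinfun.bounded_linear_right\<close>)
  then show ?thesis using \<open>0 < t\<close> by (simp add: frac_kernel_def bounded_linear_Blinfun_apply)
qed

lemma frac_kernel_0: "t \<le> 0 \<Longrightarrow> frac_kernel \<alpha> t = 0"
  by (simp add: frac_kernel_def)

lemma fpow_frac_kernel: "0 < t \<Longrightarrow> fpow S \<alpha> (frac_kernel \<alpha> t x) = S t x"
proof -
  assume t: "0 < t"
  have "fpow S \<alpha> (frac_kernel \<alpha> t x) = - fpow S \<alpha> (fpow S (1 - \<alpha>) (W t x))"
    using t bounded_linear_fpow[of \<alpha>] \<alpha> by (simp add: frac_kernel_apply linear_neg bounded_linear.linear)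
  also have "\<dots> = - fpow S 1 (W t x)" using \<alpha> by (simp add: fpow_fpow)
  finally show ?thesis using t by (simp add: fpow_1_W)
qed

lemma frac_kernel_semigroup: "0 < t \<Longrightarrow> 0 \<le> s \<Longrightarrow> frac_kernel \<alpha> (t + s) x = S s (frac_kernel \<alpha> t x)"
  using \<alpha> by (simp add: frac_kernel_apply W_semigroup fpow_apply blinfun.minus_right)

text \<open>The weight s powr (-\<alpha>) / (t + s) is split at s = t, with t + s replaced by
  \<open>t\<close> below and by \<open>s\<close> above. The two elementary integrals are t powr
  (-\<alpha>) divided by 1 - \<alpha> and by \<alpha>.\<close>

lemma frac_kernel_bound:
  assumes t: "0 < t"
  shows "norm (frac_kernel \<alpha> t) \<le> C / Gamma (1 - \<alpha>) * (1 / (1 - \<alpha>) + 1 / \<alpha>) * t powr (- \<alpha>)"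
proof (rule norm_blinfun_bound)
  have C: "0 \<le> C"
    using derivative_bound[of 1] norm_ge_zero[of "W 1"] by (simp del: norm_ge_zero)
  have G: "0 < Gamma (1 - \<alpha>)" using \<alpha> by (intro Gamma_real_pos) simp
  show "0 \<le> C / Gamma (1 - \<alpha>) * (1 / (1 - \<alpha>) + 1 / \<alpha>) * t powr (- \<alpha>)"
    using C G \<alpha> by simp
  fix x :: 'a
  define h1 h2 where "h1 s = (if s \<in> {0..t} then s powr (- \<alpha>) else 0) / t"
    and "h2 s = (if s \<in> {t..} then s powr (- \<alpha> - 1) else 0)" for s
  have "((\<lambda>s. s powr (- \<alpha>)) has_integral (t powr (- \<alpha> + 1) / (- \<alpha> + 1))) {0..t}"
    using \<alpha> t by (intro has_integral_powr_from_0) auto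
  then have "((\<lambda>s. if s \<in> {0..t} then s powr (- \<alpha>) else 0) has_integral (t powr (- \<alpha> + 1) / (- \<alpha> + 1))) UNIV"
    by (simp only: has_integral_restrict_UNIV)
  then have h1: "(h1 has_integral (t powr (- \<alpha> + 1) / (- \<alpha> + 1)) / t) UNIV"
    unfolding h1_def[abs_def] by (rule has_integral_divide)
  have "((\<lambda>s. s powr (- \<alpha> - 1)) has_integral - (t powr (- \<alpha> - 1 + 1)) / (- \<alpha> - 1 + 1)) {t..}"
    using \<alpha> t by (intro has_integral_powr_to_inf) auto
  then have h2: "(h2 has_integral - (t powr (- \<alpha> - 1 + 1)) / (- \<alpha> - 1 + 1)) UNIV"
    unfolding h2_def[abs_def] by (simp only: has_integral_restrict_UNIV)
  have "(t powr (- \<alpha> + 1) / (- \<alpha> + 1)) / t + - (t powr (- \<alpha> - 1 + 1)) / (- \<alpha> - 1 + 1)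
      = (1 / (1 - \<alpha>) + 1 / \<alpha>) * t powr (- \<alpha>)"
  proof -
    have "t powr (- \<alpha> + 1) = t powr (- \<alpha>) * t" by (subst powr_add) (use t in simp)
    then show ?thesis using t \<alpha> by (simp add: field_simps)
  qed
  with has_integral_add[OF h1 h2] have h: "((\<lambda>s. h1 s + h2 s) has_integral (1 / (1 - \<alpha>) + 1 / \<alpha>) * t powr (- \<alpha>)) UNIV"
    by simp
  have "(\<lambda>s. h1 s + h2 s) = (\<lambda>s. if s \<in> {0<..} then h1 s + h2 s else 0)"
    using t by (auto simp: h1_def h2_def)
  with h have "((\<lambda>s. if s \<in> {0<..} then h1 s + h2 s else 0) has_integral (1 / (1 - \<alpha>) + 1 / \<alpha>) * t powr (- \<alpha>)) UNIV"
    by simp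
  then have "((\<lambda>s. h1 s + h2 s) has_integral (1 / (1 - \<alpha>) + 1 / \<alpha>) * t powr (- \<alpha>)) {0<..}"
    by (simp only: has_integral_restrict_UNIV)
  then have hh: "((\<lambda>s. (C * norm x) * (h1 s + h2 s)) has_integral (C * norm x) * ((1 / (1 - \<alpha>) + 1 / \<alpha>) * t powr (- \<alpha>))) {0<..}"
    by (rule has_integral_mult_right)
  have bd: "norm (s powr (1 - \<alpha> - 1) *\<^sub>R S s (W t x)) \<le> (C * norm x) * (h1 s + h2 s)" if s: "s \<in> {0<..}" for s
  proof -
    have "norm (S s (W t x)) = norm (W (t + s) x)" using W_semigroup[OF t, of s x] s by simp
    also have "\<dots> \<le> norm (W (t + s)) * norm x" by (rule norm_blinfun)
    also have "\<dots> \<le> C / (t + s) * norm x"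
      using derivative_bound[of "t + s"] t s by (intro mult_right_mono) auto
    finally have 1: "norm (S s (W t x)) \<le> (C * norm x) * (1 / (t + s))" by simp
    have "norm (s powr (1 - \<alpha> - 1) *\<^sub>R S s (W t x)) = s powr (- \<alpha>) * norm (S s (W t x))" by simp
    also have "\<dots> \<le> s powr (- \<alpha>) * ((C * norm x) * (1 / (t + s)))"
      by (rule mult_left_mono[OF 1]) simp
    also have "\<dots> = (C * norm x) * (s powr (- \<alpha>) * (1 / (t + s)))" by simp
    also have "\<dots> \<le> (C * norm x) * (h1 s + h2 s)"
    proof (rule mult_left_mono)
      show "s powr (- \<alpha>) * (1 / (t + s)) \<le> h1 s + h2 s"
      proof (cases "s \<le> t")
        case True
        have "s powr (- \<alpha>) * (1 / (t + s)) \<le> s powr (- \<alpha>) * (1 / t)"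
          using s t by (intro mult_left_mono divide_left_mono) auto
        also have "\<dots> = h1 s" using True s by (simp add: h1_def)
        also have "\<dots> \<le> h1 s + h2 s" by (simp add: h2_def)
        finally show ?thesis .
      next
        case False
        have "s powr (- \<alpha>) * (1 / (t + s)) \<le> s powr (- \<alpha>) * (1 / s)"
          using s t by (intro mult_left_mono divide_left_mono) auto
        also have "\<dots> = h2 s" using False s by (simp add: h2_def powr_diff)
        also have "\<dots> \<le> h1 s + h2 s" using t by (simp add: h1_def)
        finally show ?thesis .
      qed
    qed (use C in simp)
    finally show ?thesis .
  qed
  have "norm (integral {0<..} (\<lambda>s. s powr (1 - \<alpha> - 1) *\<^sub>R S s (W t x)))
      \<le> integral {0<..} (\<lambda>s. (C * norm x) * (h1 s + h2 s))"
    by (rule integral_norm_bound_integral[OF integrable_powr_orbit(1) _ bd])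
      (use \<alpha> hh in \<open>auto simp: integrable_on_def\<close>)
  also have "\<dots> = (C * norm x) * ((1 / (1 - \<alpha>) + 1 / \<alpha>) * t powr (- \<alpha>))"
    by (rule integral_unique[OF hh])
  finally have "1 / Gamma (1 - \<alpha>) * norm (integral {0<..} (\<lambda>s. s powr (1 - \<alpha> - 1) *\<^sub>R S s (W t x)))
      \<le> 1 / Gamma (1 - \<alpha>) * ((C * norm x) * ((1 / (1 - \<alpha>) + 1 / \<alpha>) * t powr (- \<alpha>)))"
    using G by (intro mult_left_mono) auto
  then show "norm (frac_kernel \<alpha> t x) \<le> C / Gamma (1 - \<alpha>) * (1 / (1 - \<alpha>) + 1 / \<alpha>) * t powr (- \<alpha>) * norm x"
    using t G by (simp add: frac_kernel_apply fpow_def ac_simps)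
qed

end

end

text \<open>Up to \<open>\<rho>\<close> the bound is the one from holomorphy. Afterwards
  \<open>W t\<close> is the decaying semigroup applied to \<open>W \<rho>\<close>, and exponential
  decay is stronger than 1/t.\<close>

lemma analytic_semigroup_imp_analytic_decay:
  fixes T :: "real \<Rightarrow> 'a::banach \<Rightarrow>\<^sub>L 'a"
  assumes T: "analytic_semigroup T" and a: "admissible_shift T a"
  obtains M \<delta> W C where "analytic_decay (\<lambda>t. exp (- a * t) *\<^sub>R T t) M \<delta> W C"
proof -
  define S where "S t = exp (- a * t) *\<^sub>R T t" for t
  obtain M0 \<delta> where \<delta>: "0 < \<delta>" and M0: "\<And>t. 0 \<le> t \<Longrightarrow> norm (S t) \<le> M0 * exp (- \<delta> * t)"
    using a by (auto simp: admissible_shift_def S_def)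
  have "growth_semigroup T M0 (a - \<delta>)"
  proof
    show "C0_semigroup T" using T by (simp add: analytic_semigroup_def)
    show "norm (T t) \<le> M0 * exp ((a - \<delta>) * t)" if "0 \<le> t" for t
      using M0[OF that] by (simp add: S_def exp_minus exp_diff algebra_simps divide_simps)
  qed
  then interpret T: growth_semigroup T M0 "a - \<delta>" .
  interpret S: decaying_semigroup S M0 \<delta>
    using T.exp_shift[of a] \<delta> by (simp add: decaying_semigroup_def decaying_semigroup_axioms_def S_def[abs_def])
  obtain V :: "real \<Rightarrow> 'a \<Rightarrow>\<^sub>L 'a" and C \<rho> where \<rho>: "0 < \<rho>"
    and V: "\<And>t x. 0 < t \<Longrightarrow> ((\<lambda>t. T t x) has_vector_derivative V t x) (at t)"
    and VC: "\<And>t. 0 < t \<Longrightarrow> t \<le> \<rho> \<Longrightarrow> norm (V t) \<le> C / t"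
    using analytic_semigroup_derivative[OF T] by metis
  define W where "W t = exp (- a * t) *\<^sub>R (V t - a *\<^sub>R T t)" for t
  have W: "((\<lambda>t. S t x) has_vector_derivative W t x) (at t)" if "0 < t" for t x
  proof -
    have "((\<lambda>t. exp (- a * t)) has_real_derivative - a * exp (- a * t)) (at t)"
      by (auto intro!: derivative_eq_intros)
    from has_vector_derivative_scaleR[OF this V[OF that, of x]]
    show ?thesis
      unfolding S_def W_def
      by (simp add: blinfun.scaleR_left blinfun.diff_left algebra_simps)
  qed
  obtain c where c: "0 \<le> c" "\<And>t. 0 < t \<Longrightarrow> t \<le> \<rho> \<Longrightarrow> norm (W t) \<le> c / t"
  proof
    \<comment> \<open>The first summand comes from \<open>V\<close>, the second from the bounded
      term a S(t), which is written as a multiple of 1/t by means of t \<le> \<rho>.\<close>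
    define c where "c = max 0 (exp (\<bar>a\<bar> * \<rho>) * C) + \<bar>a\<bar> * M0 * \<rho>"
    show "0 \<le> c" using \<rho> T.M_nonneg by (simp add: c_def)
    fix t assume t: "0 < t" "t \<le> \<rho>"
    have "norm (W t) \<le> exp (- a * t) * norm (V t) + \<bar>a\<bar> * norm (S t)"
    proof -
      have "W t = exp (- a * t) *\<^sub>R V t - a *\<^sub>R S t"
        by (simp add: W_def S_def scaleR_diff_right)
      then show ?thesis using norm_triangle_ineq4[of "exp (- a * t) *\<^sub>R V t" "a *\<^sub>R S t"] by simp
    qed
    also have "exp (- a * t) * norm (V t) \<le> exp (\<bar>a\<bar> * \<rho>) * (C / t)"
    proof (rule mult_mono)
      have "- a * t \<le> \<bar>a\<bar> * \<rho>" using t by (intro mult_mono) auto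
      then show "exp (- a * t) \<le> exp (\<bar>a\<bar> * \<rho>)" by simp
    qed (use VC[OF t] in auto)
    also have "\<bar>a\<bar> * norm (S t) \<le> \<bar>a\<bar> * M0"
    proof -
      have "M0 * exp (- \<delta> * t) \<le> M0 * 1" using \<delta> t T.M_nonneg by (intro mult_left_mono) auto
      then show ?thesis using M0[of t] t by (intro mult_left_mono) auto
    qed
    also have "\<bar>a\<bar> * M0 \<le> \<bar>a\<bar> * M0 * \<rho> / t"
    proof -
      have "\<bar>a\<bar> * M0 * 1 \<le> \<bar>a\<bar> * M0 * (\<rho> / t)"
        using t T.M_nonneg by (intro mult_left_mono) auto
      then show ?thesis by simp
    qed
    also have "exp (\<bar>a\<bar> * \<rho>) * (C / t) \<le> max 0 (exp (\<bar>a\<bar> * \<rho>) * C) / t"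
      using t by (simp add: divide_right_mono)
    finally show "norm (W t) \<le> c / t" by (simp add: c_def add_divide_distrib)
  qed
  have Wsemi: "W t x = S (t - \<rho>) (W \<rho> x)" if t: "\<rho> \<le> t" for t x
    by (rule vector_derivative_unique_at[OF W C0_semigroup_derivative[OF S.C0 W[OF \<rho>] \<rho> t]])
      (use t \<rho> in simp)
  \<comment> \<open>The summands serve the ranges t \<le> \<rho> and t > \<rho>; in the second one
    exp (- \<delta> t) \<le> 1 / (\<delta> t).\<close>
  define c' where "c' = c + M0 * exp (\<delta> * \<rho>) * norm (W \<rho>) / \<delta>"
  have "norm (W t) \<le> c' / t" if t: "0 < t" for t
  proof (cases "t \<le> \<rho>")
    case True
    have "c / t \<le> c' / t"
      using t \<delta> T.M_nonneg by (intro divide_right_mono) (auto simp: c'_def)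
    then show ?thesis using c(2)[OF t True] by simp
  next
    case False
    show ?thesis
    proof (rule norm_blinfun_bound)
      show "0 \<le> c' / t" using t \<delta> T.M_nonneg c(1) by (simp add: c'_def)
      fix x :: 'a
      have "norm (W t x) \<le> M0 * exp (- \<delta> * (t - \<rho>)) * norm (W \<rho> x)"
        using S.norm_apply_le[of "t - \<rho>" "W \<rho> x"] Wsemi[of t x] False by simp
      also have "\<dots> \<le> M0 * exp (- \<delta> * (t - \<rho>)) * (norm (W \<rho>) * norm x)"
        using T.M_nonneg norm_blinfun by (intro mult_left_mono) auto
      also have "M0 * exp (- \<delta> * (t - \<rho>)) \<le> M0 * exp (\<delta> * \<rho>) / \<delta> / t"
      proof -
        have "\<delta> * t \<le> exp (\<delta> * t)" using exp_ge_add_one_self[of "\<delta> * t"] by linarith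
        then have "exp (- \<delta> * t) \<le> 1 / (\<delta> * t)"
          using \<delta> t by (simp add: exp_minus divide_simps mult.commute)
        then have "exp (\<delta> * \<rho>) * exp (- \<delta> * t) \<le> exp (\<delta> * \<rho>) * (1 / (\<delta> * t))" by (rule mult_left_mono) simp
        moreover have "exp (- \<delta> * (t - \<rho>)) = exp (\<delta> * \<rho>) * exp (- \<delta> * t)"
          by (simp add: exp_add[symmetric] algebra_simps)
        ultimately have "M0 * exp (- \<delta> * (t - \<rho>)) \<le> M0 * (exp (\<delta> * \<rho>) * (1 / (\<delta> * t)))"
          using T.M_nonneg by (intro mult_left_mono) auto
        then show ?thesis by simp
      qed
      then have "M0 * exp (- \<delta> * (t - \<rho>)) * (norm (W \<rho>) * norm x) \<le> M0 * exp (\<delta> * \<rho>) / \<delta> / t * (norm (W \<rho>) * norm x)"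
        by (rule mult_right_mono) simp
      also have "\<dots> = (M0 * exp (\<delta> * \<rho>) * norm (W \<rho>) / \<delta>) / t * norm x" by simp
      also have "\<dots> \<le> c' / t * norm x"
        using t c(1) by (intro mult_right_mono divide_right_mono) (auto simp: c'_def)
      finally show "norm (W t x) \<le> c' / t * norm x" .
    qed
  qed
  then have "analytic_decay S M0 \<delta> W c'"
    by unfold_locales (use W in auto)
  then show thesis using that unfolding S_def[abs_def] by blast
qed

section \<open>Generator, compactness and positivity of the semigroup\<close>

text \<open>The right difference quotient of an orbit at \<open>t\<close> is the generator quotient
  at \<open>T t x\<close>. It is also \<open>T t\<close> applied to the generator quotient at the
  starting point, so for a start in the domain \<open>T t\<close> passes through the limit.\<close>

lemma generator_orbit:
  fixes T :: "real \<Rightarrow> 'a::banach \<Rightarrow>\<^sub>L 'a"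
  assumes "growth_semigroup T M \<omega>" and gen: "infinitesimal_generator T D B"
    and V: "\<And>t x. 0 < t \<Longrightarrow> ((\<lambda>t. T t x) has_vector_derivative V t x) (at t)"
    and t: "0 < t"
  shows "T t x \<in> D" "B (T t x) = V t x" "y \<in> D \<Longrightarrow> V t y = T t (B y)"
proof -
  interpret growth_semigroup T M \<omega> by fact
  have V': "((\<lambda>h. (1 / h) *\<^sub>R (T (t + h) x - T t x)) \<longlongrightarrow> V t x) (at_right 0)" for x
  proof -
    have "((\<lambda>h. (1 / h) *\<^sub>R (T (t + h) x - T t x)) \<longlongrightarrow> V t x) (at 0)"
    proof -
      have "((\<lambda>h. norm (T (t + h) x - T t x - h *\<^sub>R V t x) / norm h) \<longlongrightarrow> 0) (at 0)"
        using V[OF t, of x] by (simp add: has_vector_derivative_def has_derivative_at)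
      moreover have "norm ((1 / h) *\<^sub>R (T (t + h) x - T t x) - V t x) = norm (T (t + h) x - T t x - h *\<^sub>R V t x) / norm h"
        if "h \<noteq> 0" for h
      proof -
        have "(1 / h) *\<^sub>R (T (t + h) x - T t x) - V t x = (1 / h) *\<^sub>R (T (t + h) x - T t x - h *\<^sub>R V t x)"
          using that by (simp add: scaleR_diff_right)
        then show ?thesis by simp
      qed
      ultimately have "((\<lambda>h. norm ((1 / h) *\<^sub>R (T (t + h) x - T t x) - V t x)) \<longlongrightarrow> 0) (at 0)"
        by (subst tendsto_cong[of _ "\<lambda>h. norm (T (t + h) x - T t x - h *\<^sub>R V t x) / norm h"])
          (auto simp: eventually_at_filter)
      then show ?thesis by (rule LIM_zero_cancel[OF tendsto_norm_zero_cancel])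
    qed
    then show ?thesis by (rule filterlim_mono[OF _ order_refl]) (simp add: at_le)
  qed
  have ev: "\<forall>\<^sub>F h in at_right 0. (0::real) < h" by (auto simp: eventually_at_filter)
  have 1: "((\<lambda>h. (1 / h) *\<^sub>R (T h (T t x) - T t x)) \<longlongrightarrow> V t x) (at_right 0)"
  proof (rule Lim_transform_eventually[OF V'])
    show "\<forall>\<^sub>F h in at_right 0. (1 / h) *\<^sub>R (T (t + h) x - T t x) = (1 / h) *\<^sub>R (T h (T t x) - T t x)"
      using ev by eventually_elim (use t in \<open>simp add: add.commute[of t] semigroup\<close>)
  qed
  have "D = {x. \<exists>y. ((\<lambda>h. (1 / h) *\<^sub>R (T h x - x)) \<longlongrightarrow> y) (at_right 0)}"
    and gB: "\<And>x. x \<in> D \<Longrightarrow> ((\<lambda>h. (1 / h) *\<^sub>R (T h x - x)) \<longlongrightarrow> B x) (at_right 0)"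
    using gen by (simp_all add: infinitesimal_generator_def)
  then show D: "T t x \<in> D" using 1 by auto
  then have "((\<lambda>h. (1 / h) *\<^sub>R (T h (T t x) - T t x)) \<longlongrightarrow> B (T t x)) (at_right 0)"
    by (rule gB)
  then show "B (T t x) = V t x" by (rule tendsto_unique[OF trivial_limit_at_right_real _ 1])
  assume "y \<in> D"
  then have "((\<lambda>h. (1 / h) *\<^sub>R (T h y - y)) \<longlongrightarrow> B y) (at_right 0)"
    by (rule gB)
  then have 2: "((\<lambda>h. T t ((1 / h) *\<^sub>R (T h y - y))) \<longlongrightarrow> T t (B y)) (at_right 0)"
    by (rule bounded_linear.tendsto[OF blinfun.bounded_linear_right])
  have "((\<lambda>h. (1 / h) *\<^sub>R (T (t + h) y - T t y)) \<longlongrightarrow> T t (B y)) (at_right 0)"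
  proof (rule Lim_transform_eventually[OF 2])
    show "\<forall>\<^sub>F h in at_right 0. T t ((1 / h) *\<^sub>R (T h y - y)) = (1 / h) *\<^sub>R (T (t + h) y - T t y)"
      using ev by eventually_elim (use t in \<open>simp add: semigroup blinfun.diff_right blinfun.scaleR_right\<close>)
  qed
  then show "V t y = T t (B y)" by (rule tendsto_unique[OF trivial_limit_at_right_real V'])
qed

text \<open>With R the resolvent at \<mu>, T t = R (\<mu> T t - V t) is a compact operator after a
  bounded one; boundedness of \<open>V t\<close> is the smoothing effect of analyticity.\<close>

lemma compact_orbit_operator:
  fixes T :: "real \<Rightarrow> 'a::banach \<Rightarrow>\<^sub>L 'a" and V :: "real \<Rightarrow> 'a \<Rightarrow>\<^sub>L 'a"
  assumes T: "growth_semigroup T M \<omega>" and gen: "infinitesimal_generator T D B"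
    and V: "\<And>t x. 0 < t \<Longrightarrow> ((\<lambda>t. T t x) has_vector_derivative V t x) (at t)"
    and cr: "compact_resolvent D B" and t: "0 < t"
  shows "compact_operator (T t)"
  unfolding compact_operator_def
proof (intro allI impI)
  fix S :: "'a set" assume S: "bounded S"
  obtain \<mu> R where R: "is_resolvent D B \<mu> R" "compact_operator R"
    using cr by (auto simp: compact_resolvent_def)
  define Q where "Q = \<mu> *\<^sub>R T t - V t"
  have "T t x = R (Q x)" for x
  proof -
    have "R (\<mu> *\<^sub>R T t x - B (T t x)) = T t x"
      using R(1) generator_orbit(1)[OF T gen V t, of x] unfolding is_resolvent_def by blast
    then show ?thesis
      using generator_orbit(2)[OF T gen V t, of x] by (simp add: Q_def blinfun.diff_left blinfun.scaleR_left)
  qed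
  then have "T t ` S = R ` (Q ` S)" by (simp add: image_image)
  moreover have "bounded (Q ` S)"
    by (rule bounded_linear_image[OF S]) (rule blinfun.bounded_linear_right)
  ultimately show "compact (closure (T t ` S))"
    using R(2) by (simp add: compact_operator_def)
qed

text \<open>\<open>fpow\<close> of integer order \<open>n\<close> for the semigroup rescaled by
  \<open>k\<close> is the n-th power of the resolvent at a + k, so the exponential formula writes
  S(t) x as a limit of nonnegative multiples of positive operators applied to \<open>x\<close>, and
  the cone is closed.\<close>

lemma semigroup_positive:
  fixes T V :: "real \<Rightarrow> 'a::{banach, ordered_real_vector} \<Rightarrow>\<^sub>L 'a"
  assumes T: "growth_semigroup T M \<omega>" and gen: "infinitesimal_generator T D B"
    and V: "\<And>t x. 0 < t \<Longrightarrow> ((\<lambda>t. T t x) has_vector_derivative V t x) (at t)"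
    and a: "decaying_semigroup (\<lambda>t. exp (- a * t) *\<^sub>R T t) M' \<delta>"
    and pos: "positive_resolvent T a D B"
    and cl: "closed {x::'a. 0 \<le> x}"
    and t: "0 \<le> t" and x: "0 \<le> x"
  shows "0 \<le> T t x"
proof (cases "t = 0")
  case True
  interpret growth_semigroup T M \<omega> by fact
  show ?thesis using True x by simp
next
  case False
  with t have t: "0 < t" by simp
  define S where "S t = exp (- a * t) *\<^sub>R T t" for t
  interpret S: decaying_semigroup S M' \<delta> using a unfolding S_def[abs_def] .
  have cone: "positive_cone T a 0 = {x. 0 \<le> x}"
    by (auto simp: positive_cone_def frac_space_def neg_frac_power_def)
  obtain w where w: "\<And>\<mu>. w < \<mu> \<Longrightarrow> \<exists>R. is_resolvent D B \<mu> R \<and> blinfun_apply R ` {x. 0 \<le> x} \<subseteq> {x. 0 \<le> x}"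
    using pos unfolding positive_resolvent_def cone[symmetric] by (meson order_refl)
  have nn: "0 \<le> fpow (\<lambda>s. exp (- k * s) *\<^sub>R S s) (real (Suc n)) x"
    if k: "0 \<le> k" "w < a + k" for n k
  proof -
    interpret L: decaying_semigroup "\<lambda>s. exp (- k * s) *\<^sub>R S s" M' "\<delta> + k"
      by (rule S.decaying_exp_shift[OF k(1)])
    obtain R where R: "is_resolvent D B (a + k) R" "\<And>x. 0 \<le> x \<Longrightarrow> 0 \<le> R x"
      using w[OF k(2)] by blast
    \<comment> \<open>By the resolvent equation the rescaled orbit of \<open>- R z\<close> has as
      its derivative the orbit of \<open>z\<close>.\<close>
    have f1: "fpow (\<lambda>s. exp (- k * s) *\<^sub>R S s) 1 z = R z" for z
    proof -
      have RD: "R z \<in> D" "(a + k) *\<^sub>R R z - B (R z) = z"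
        using R(1) unfolding is_resolvent_def by blast+
      have "fpow (\<lambda>s. exp (- k * s) *\<^sub>R S s) 1 z = - (- R z)"
      proof (rule L.fpow_1_derivative)
        fix s :: real assume s: "0 < s"
        have "((\<lambda>s. exp (- (a + k) * s)) has_real_derivative - (a + k) * exp (- (a + k) * s)) (at s)"
          by (auto intro!: derivative_eq_intros)
        from has_vector_derivative_scaleR[OF this V[OF s, of "- R z"]]
        have "((\<lambda>s. exp (- (a + k) * s) *\<^sub>R T s (- R z)) has_vector_derivative
            exp (- (a + k) * s) *\<^sub>R V s (- R z) + (- (a + k) * exp (- (a + k) * s)) *\<^sub>R T s (- R z)) (at s)" .
        moreover have "exp (- (a + k) * s) *\<^sub>R V s (- R z) + (- (a + k) * exp (- (a + k) * s)) *\<^sub>R T s (- R z)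
            = exp (- (a + k) * s) *\<^sub>R T s ((a + k) *\<^sub>R R z - B (R z))"
          using generator_orbit(3)[OF T gen V s RD(1)]
          by (simp add: blinfun.minus_right blinfun.diff_right blinfun.add_right blinfun.scaleR_right algebra_simps)
        moreover have "exp (- (a + k) * s) *\<^sub>R T s y = (exp (- k * s) *\<^sub>R S s) y" for s y
          by (simp add: S_def blinfun.scaleR_left exp_add[symmetric] algebra_simps)
        ultimately show "((\<lambda>s. (exp (- k * s) *\<^sub>R S s) (- R z)) has_vector_derivative (exp (- k * s) *\<^sub>R S s) z) (at s)"
          using RD(2) by simp
      qed
      then show ?thesis by simp
    qed
    show ?thesis
    proof (induction n)
      case 0
      then show ?case using f1 R(2) x by simp
    next
      case (Suc n)
      have "fpow (\<lambda>s. exp (- k * s) *\<^sub>R S s) (real (Suc (Suc n))) x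
          = fpow (\<lambda>s. exp (- k * s) *\<^sub>R S s) 1 (fpow (\<lambda>s. exp (- k * s) *\<^sub>R S s) (real (Suc n)) x)"
        by (subst L.fpow_fpow) auto
      then show ?case using f1 R(2) Suc by simp
    qed
  qed
  define A where "A n = (real n / t) ^ n *\<^sub>R fpow (\<lambda>s. exp (- (real n / t) * s) *\<^sub>R S s) (real n) x" for n
  have lim: "A \<longlonglongrightarrow> S t x" unfolding A_def by (rule S.exponential_formula[OF t])
  have "\<forall>\<^sub>F n in sequentially. A n \<in> {x. 0 \<le> x}"
  proof -
    \<comment> \<open>From here on n/t exceeds w - a, so the resolvent at a + n/t exists and is
      positive.\<close>
    obtain N :: nat where N: "(\<bar>w\<bar> + \<bar>a\<bar> + 1) * t < real N" using reals_Archimedean2 by blast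
    have "A n \<in> {x. 0 \<le> x}" if n: "Suc N \<le> n" for n
    proof -
      obtain m where m: "n = Suc m" using n by (cases n) auto
      have "(\<bar>w\<bar> + \<bar>a\<bar> + 1) * t < real n" using N n by linarith
      then have "\<bar>w\<bar> + \<bar>a\<bar> + 1 < real n / t" using t by (simp add: field_simps)
      then have "0 \<le> fpow (\<lambda>s. exp (- (real n / t) * s) *\<^sub>R S s) (real (Suc m)) x"
        by (intro nn) auto
      then show ?thesis using t by (simp add: A_def m scaleR_nonneg_nonneg)
    qed
    then show ?thesis by (auto simp: eventually_sequentially)
  qed
  from Lim_in_closed_set[OF cl this _ lim] have "0 \<le> S t x" by simp
  then have "0 \<le> exp (a * t) *\<^sub>R S t x" by (intro scaleR_nonneg_nonneg) auto
  also have "exp (a * t) *\<^sub>R S t x = T t x"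
    by (simp add: S_def blinfun.scaleR_left exp_add[symmetric])
  finally show ?thesis .
qed

section \<open>Local solutions below a given solution\<close>

text \<open>The weight is singular at s = t, but its antiderivative is continuous up to that point
  because 1 - a > 0.\<close>

lemma has_integral_kernel_weight:
  fixes a r t :: real
  assumes a: "0 < a" "a < 1" and r: "r \<le> t"
  shows "((\<lambda>s. (t - s) powr (- a)) has_integral (t - r) powr (1 - a) / (1 - a)) {r..t}"
proof -
  have "((\<lambda>s. (t - s) powr (- a)) has_integral
      - ((t - t) powr (1 - a) / (1 - a)) - (- ((t - r) powr (1 - a) / (1 - a)))) {r..t}"
  proof (rule fundamental_theorem_of_calculus_interior[OF r])
    show "continuous_on {r..t} (\<lambda>s. - ((t - s) powr (1 - a) / (1 - a)))"
      using a by (intro continuous_intros continuous_on_powr') auto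
    fix s assume s: "s \<in> {r<..<t}"
    have "((\<lambda>s. t - s) has_real_derivative - 1) (at s)"
      by (auto intro!: derivative_eq_intros)
    then have "((\<lambda>s. (t - s) powr (1 - a)) has_real_derivative (1 - a) * (t - s) powr (1 - a - of_nat 1) * - 1) (at s)"
      by (rule DERIV_fun_powr) (use s in simp)
    from DERIV_minus[OF DERIV_cdivide[OF this, of "1 - a"]]
    have "((\<lambda>s. - ((t - s) powr (1 - a) / (1 - a))) has_real_derivative (t - s) powr (- a)) (at s)"
      using a by simp
    then show "((\<lambda>s. - ((t - s) powr (1 - a) / (1 - a))) has_vector_derivative (t - s) powr (- a)) (at s)"
      by (simp add: has_real_derivative_iff_has_vector_derivative)
  qed
  then show ?thesis by simp
qed

section \<open>Convolution with a weakly singular kernel\<close>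

text \<open>Only times up to 1 enter the bound because solutions are constructed on short intervals.
  The value \<open>K 0 = 0\<close> is a convention that makes the integrand of the convolution total
  at s = t.\<close>

locale volterra_kernel = growth_semigroup E M \<omega>
  for E :: "real \<Rightarrow> 'a::banach \<Rightarrow>\<^sub>L 'a" and M \<omega> +
  fixes K :: "real \<Rightarrow> 'a \<Rightarrow>\<^sub>L 'a" and \<alpha> c :: real
  assumes \<alpha>: "0 < \<alpha>" "\<alpha> < 1"
    and K_semigroup: "\<And>s t x. 0 < t \<Longrightarrow> 0 \<le> s \<Longrightarrow> K (t + s) x = E s (K t x)"
    and K_bound: "\<And>t. 0 < t \<Longrightarrow> t \<le> 1 \<Longrightarrow> norm (K t) \<le> c * t powr (- \<alpha>)"
    and K_0: "K 0 = 0"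
    and compact: "\<And>t. 0 < t \<Longrightarrow> compact_operator (E t)"
begin

lemma c_nonneg: "0 \<le> c"
  using K_bound[of 1] norm_ge_zero[of "K 1"] by (simp del: norm_ge_zero)

lemma K_apply_bound:
  assumes "0 \<le> t" "t \<le> 1" "norm x \<le> N"
  shows "norm (K t x) \<le> c * N * t powr (- \<alpha>)"
proof (cases "t = 0")
  case False
  have "norm (K t x) \<le> norm (K t) * norm x" by (rule norm_blinfun)
  also have "\<dots> \<le> (c * t powr (- \<alpha>)) * N"
    using K_bound[of t] False assms c_nonneg by (intro mult_mono) auto
  finally show ?thesis by (simp add: ac_simps)
qed (simp add: K_0)

text \<open>Near \<open>s\<close>, with q fixed between \<open>s\<close> and \<open>t\<close>, K (t
  - s) equals E (q - s) K (t - q): the kernel operator is now constant and joint continuity of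
  \<open>E\<close> applies.\<close>

lemma continuous_on_kernel:
  assumes h: "continuous_on {r..t} h"
  shows "continuous_on {r<..<t} (\<lambda>s. K (t - s) (h s))"
proof (rule continuous_at_imp_continuous_on, rule ballI)
  fix s assume s: "s \<in> {r<..<t}"
  define q where "q = (s + t) / 2"
  have q: "s < q" "q < t" using s by (auto simp: q_def)
  have "continuous_on {r..q} (\<lambda>s. E (q - s) (K (t - q) (h s)))"
    using q by (intro continuous_compose continuous_intros bounded_linear.continuous_on[OF blinfun.bounded_linear_right]
      continuous_on_subset[OF h]) auto
  moreover have "E (q - s) (K (t - q) (h s)) = K (t - s) (h s)" if "s \<in> {r..q}" for s
    using K_semigroup[of "t - q" "q - s" "h s"] that q by simp
  ultimately have "continuous_on {r..q} (\<lambda>s. K (t - s) (h s))"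
    by (rule continuous_on_eq)
  then have "continuous_on {r<..<q} (\<lambda>s. K (t - s) (h s))"
    by (rule continuous_on_subset) auto
  then show "isCont (\<lambda>s. K (t - s) (h s)) s"
    using s q by (simp add: continuous_on_eq_continuous_at)
qed

context
  fixes h :: "real \<Rightarrow> 'a" and r t N :: real
  assumes rt: "r \<le> t" "t - r \<le> 1"
    and h: "continuous_on {r..t} h" and hN: "\<And>s. s \<in> {r..t} \<Longrightarrow> norm (h s) \<le> N"
begin

lemma kernel_integrable: "(\<lambda>s. K (t - s) (h s)) integrable_on {r..t}"
proof (rule dominated_integrable_Icc[OF continuous_on_kernel[OF h]])
  show "(\<lambda>s. c * N * (t - s) powr (- \<alpha>)) integrable_on {r..t}"
    using has_integral_mult_right[OF has_integral_kernel_weight[OF \<alpha> rt(1)]] by (auto simp: integrable_on_def)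
  show "norm (K (t - s) (h s)) \<le> c * N * (t - s) powr (- \<alpha>)" if "s \<in> {r<..<t}" for s
    using that rt by (intro K_apply_bound hN) auto
qed

lemma kernel_integral_bound:
  "norm (integral {r..t} (\<lambda>s. K (t - s) (h s))) \<le> c * N * ((t - r) powr (1 - \<alpha>) / (1 - \<alpha>))"
proof -
  have w: "((\<lambda>s. c * N * (t - s) powr (- \<alpha>)) has_integral c * N * ((t - r) powr (1 - \<alpha>) / (1 - \<alpha>))) {r..t}"
    by (intro has_integral_mult_right has_integral_kernel_weight \<alpha> rt)
  show ?thesis
    unfolding integral_unique[OF w, symmetric]
  proof (rule integral_norm_bound_integral[OF kernel_integrable])
    show "norm (K (t - s) (h s)) \<le> c * N * (t - s) powr (- \<alpha>)" if "s \<in> {r..t}" for s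
      using that rt by (intro K_apply_bound hN) auto
  qed (use w in \<open>auto simp: integrable_on_def\<close>)
qed

end

definition conv :: "(real \<Rightarrow> 'a) \<Rightarrow> real \<Rightarrow> 'a" where
  "conv h t = integral {0..t} (\<lambda>s. K (t - s) (h s))"

lemma conv_0 [simp]: "conv h 0 = 0"
  by (simp add: conv_def)

lemma conv_cong: "(\<And>s. s \<in> {0..t} \<Longrightarrow> h s = g s) \<Longrightarrow> conv h t = conv g t"
  unfolding conv_def by (rule integral_cong) simp

lemma conv_bound:
  assumes "0 \<le> t" "t \<le> 1" "continuous_on {0..t} h" "\<And>s. s \<in> {0..t} \<Longrightarrow> norm (h s) \<le> N"
  shows "norm (conv h t) \<le> c * N * (t powr (1 - \<alpha>) / (1 - \<alpha>))"
  using kernel_integral_bound[of 0 t h N] assms by (simp add: conv_def)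

text \<open>The semigroup law turns the contribution of [0, r] into E (t - r) acting on the earlier
  value; only the integral over [r, t] is estimated. Compactness and equicontinuity both start from
  this splitting.\<close>

lemma conv_split:
  assumes rt: "0 \<le> r" "r \<le> t" "t \<le> 1" and h: "continuous_on {0..t} h"
    and hN: "\<And>s. s \<in> {0..t} \<Longrightarrow> norm (h s) \<le> N"
  shows "norm (conv h t - E (t - r) (conv h r)) \<le> c * N * ((t - r) powr (1 - \<alpha>) / (1 - \<alpha>))"
proof -
  have hr: "continuous_on {0..r} h" "continuous_on {r..t} h"
    using rt by (auto intro: continuous_on_subset[OF h])
  have int: "(\<lambda>s. K (t - s) (h s)) integrable_on {0..t}"
    by (rule kernel_integrable[OF _ _ h hN]) (use rt in auto)
  have intr: "(\<lambda>s. K (r - s) (h s)) integrable_on {0..r}"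
    by (rule kernel_integrable[OF _ _ hr(1) hN]) (use rt in auto)
  have "E (t - r) (conv h r) = integral {0..r} (\<lambda>s. E (t - r) (K (r - s) (h s)))"
    using integral_linear[OF intr blinfun.bounded_linear_right[of "E (t - r)"]] by (simp add: conv_def o_def)
  also have "\<dots> = integral {0..r} (\<lambda>s. K (t - s) (h s))"
  \<comment> \<open>The law for \<open>K\<close> requires a strictly positive time r - s, so s = r
    is discarded as a null set.\<close>
  proof (rule integral_spike[of "{r}"])
    fix s assume "s \<in> {0..r} - {r}"
    then show "K (t - s) (h s) = E (t - r) (K (r - s) (h s))"
      using K_semigroup[of "r - s" "t - r" "h s"] rt by simp
  qed simp
  finally have "conv h t - E (t - r) (conv h r) = integral {r..t} (\<lambda>s. K (t - s) (h s))"
    using Henstock_Kurzweil_Integration.integral_combine[OF rt(1,2) int] by (simp add: conv_def algebra_simps)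
  then show ?thesis
    using kernel_integral_bound[OF rt(2) _ hr(2) hN] rt by simp
qed

text \<open>All times and all continuous inputs bounded by \<open>N\<close> are collected, so that
  one compact set serves every approximant.\<close>

definition conv_range :: "real \<Rightarrow> real \<Rightarrow> 'a set" where
  "conv_range N b = {conv h t | h t. t \<in> {0..b} \<and> continuous_on {0..b} h \<and> (\<forall>s\<in>{0..b}. norm (h s) \<le> N)}"

lemma powr_small:
  assumes "0 < e"
  obtains d where "0 < d" "\<And>s. 0 \<le> s \<Longrightarrow> s < d \<Longrightarrow> c * N * (s powr (1 - \<alpha>) / (1 - \<alpha>)) < e"
proof -
  define f where "f s = c * N * (s powr (1 - \<alpha>) / (1 - \<alpha>))" for s
  have "continuous_on {0..} f"
    unfolding f_def using \<alpha> by (intro continuous_intros continuous_on_powr') auto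
  then obtain d where "0 < d" and d: "\<And>s. s \<in> {0..} \<Longrightarrow> dist s 0 < d \<Longrightarrow> dist (f s) (f 0) < e"
    unfolding continuous_on_iff using assms by (metis atLeast_iff order_refl)
  show thesis
  proof (rule that[OF \<open>0 < d\<close>])
    fix s :: real assume "0 \<le> s" "s < d"
    then have "\<bar>f s - f 0\<bar> < e" using d[of s] by (simp add: dist_real_def)
    moreover have "f 0 = 0" by (simp add: f_def)
    ultimately show "c * N * (s powr (1 - \<alpha>) / (1 - \<alpha>)) < e" unfolding f_def[symmetric] by linarith
  qed
qed

text \<open>The part of the convolution over \<open>[0, t - \<eta>]\<close> factors through the compact operator \<open>E \<eta>\<close>;
  the rest is small with \<open>\<eta>\<close>.\<close>

lemma compact_conv_range:
  assumes b: "b \<le> 1"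
  shows "compact (closure (conv_range N b))"
proof (cases "0 \<le> N \<and> 0 \<le> b")
  case False
  then have "conv_range N b = {}"
  proof (rule contrapos_np)
    assume "conv_range N b \<noteq> {}"
    then obtain h and t :: real where t: "t \<in> {0..b}" and N: "\<forall>s\<in>{0..b}. norm (h s :: 'a) \<le> N"
      by (auto simp: conv_range_def)
    then have "norm (h t) \<le> N" "0 \<le> b" by auto
    then show "0 \<le> N \<and> 0 \<le> b" using norm_ge_zero order_trans by blast
  qed
  then show ?thesis by simp
next
  case True
  show ?thesis
  proof (rule compact_closure_if_near_compact)
    fix e :: real assume "0 < e"
    then obtain d where d: "0 < d" "\<And>s. 0 \<le> s \<Longrightarrow> s < d \<Longrightarrow> c * N * (s powr (1 - \<alpha>) / (1 - \<alpha>)) < e"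
      using powr_small by metis
    define \<eta> where "\<eta> = d / 2"
    have \<eta>: "0 < \<eta>" "\<eta> < d" using d by (auto simp: \<eta>_def)
    \<comment> \<open>Bound for all convolutions on [0, b], where the power of the time is at most
      1.\<close>
    define R where "R = c * N * (1 / (1 - \<alpha>))"
    \<comment> \<open>The point 0 approximates the values at times t \<le> \<eta>, which have no
      past to factor through \<open>E \<eta>\<close>.\<close>
    define C where "C = insert 0 (closure (E \<eta> ` cball 0 R))"
    have "compact C"
      using compact[OF \<eta>(1)] unfolding C_def compact_operator_def by (simp add: compact_insert)
    moreover have "\<exists>y\<in>C. dist x y < e" if x_in: "x \<in> conv_range N b" for x
    proof -
      obtain h t where x: "x = conv h t" and t: "t \<in> {0..b}" and h: "continuous_on {0..b} h"
        and hN: "\<And>s. s \<in> {0..b} \<Longrightarrow> norm (h s) \<le> N"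
        using x_in unfolding conv_range_def by blast
      have ht: "continuous_on {0..t} h" "\<And>s. s \<in> {0..t} \<Longrightarrow> norm (h s) \<le> N"
        using t hN by (auto intro: continuous_on_subset[OF h])
      show ?thesis
      proof (cases "t \<le> \<eta>")
        case True
        have "norm x < e"
          using conv_bound[OF _ _ ht] d(2)[of t] t b True \<eta> unfolding x by fastforce
        then show ?thesis by (auto simp: C_def)
      next
        case False
        define r where "r = t - \<eta>"
        have r: "0 \<le> r" "r \<le> t" "t \<le> 1" "t - r = \<eta>" using False t b \<eta> by (auto simp: r_def)
        have "norm (conv h r) \<le> c * N * (r powr (1 - \<alpha>) / (1 - \<alpha>))"
          by (rule conv_bound) (use r ht in \<open>auto intro: continuous_on_subset[OF ht(1)]\<close>)
        also have "\<dots> \<le> R"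
          unfolding R_def using r \<alpha> c_nonneg True powr_mono2[of "1 - \<alpha>" r 1]
          by (intro mult_left_mono divide_right_mono) auto
        finally have "E \<eta> (conv h r) \<in> C"
          unfolding C_def using closure_subset by (intro insertI2) (auto intro!: subsetD[OF closure_subset] imageI)
        moreover have "dist x (E \<eta> (conv h r)) < e"
          using conv_split[OF r(1-3) ht] d(2)[of \<eta>] \<eta> unfolding x dist_norm r(4) by fastforce
        ultimately show ?thesis by blast
      qed
    qed
    ultimately show "\<exists>K. compact K \<and> (\<forall>x\<in>conv_range N b. \<exists>y\<in>K. dist x y < e)" by blast
  qed
qed

text \<open>A strongly continuous semigroup is near the identity uniformly on compact sets. The
  earlier values lie in one compact set, and the tail of the splitting is small independently of the
  input.\<close>

lemma conv_equicontinuous: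
  assumes b: "b \<le> 1" and e: "0 < e"
  obtains d where "0 < d" "\<And>h s t. continuous_on {0..b} h \<Longrightarrow> (\<And>s. s \<in> {0..b} \<Longrightarrow> norm (h s) \<le> N) \<Longrightarrow>
    s \<in> {0..b} \<Longrightarrow> t \<in> {0..b} \<Longrightarrow> \<bar>s - t\<bar> < d \<Longrightarrow> dist (conv h s) (conv h t) < e"
proof -
  define A where "A = {0..1::real} \<times> closure (conv_range N b)"
  have "compact A" unfolding A_def by (intro compact_Times compact_Icc compact_conv_range b)
  moreover have "continuous_on A (\<lambda>p. E (fst p) (snd p))"
    by (intro continuous_compose continuous_intros) (auto simp: A_def)
  ultimately have "uniformly_continuous_on A (\<lambda>p. E (fst p) (snd p))"
    by (intro compact_uniformly_continuous)
  then obtain d1 where d1: "0 < d1" "\<And>p q. p \<in> A \<Longrightarrow> q \<in> A \<Longrightarrow> dist q p < d1 \<Longrightarrow>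
      dist (E (fst q) (snd q)) (E (fst p) (snd p)) < e / 2"
    unfolding uniformly_continuous_on_def using e by (meson half_gt_zero)
  obtain d2 where d2: "0 < d2" "\<And>s. 0 \<le> s \<Longrightarrow> s < d2 \<Longrightarrow> c * N * (s powr (1 - \<alpha>) / (1 - \<alpha>)) < e / 2"
    using powr_small[of "e / 2"] e by (metis half_gt_zero)
  have main: "dist (conv h s) (conv h t) < e"
    if h: "continuous_on {0..b} h" and hN: "\<And>s. s \<in> {0..b} \<Longrightarrow> norm (h s) \<le> N"
      and st: "0 \<le> s" "s \<le> t" "t \<le> b" "t - s < min d1 d2" for h s t
  proof -
    have x: "conv h s \<in> conv_range N b" 
      unfolding conv_range_def
      by (intro CollectI exI[of _ h] exI[of _ s] conjI) (use h hN st in auto)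
    have "(t - s, conv h s) \<in> A" "(0, conv h s) \<in> A"
      using st b x closure_subset by (auto simp: A_def)
    moreover have "dist (t - s, conv h s) (0, conv h s) < d1" using st by (simp add: dist_Pair_Pair dist_real_def)
    ultimately have "dist (E (t - s) (conv h s)) (conv h s) < e / 2" using d1(2) by fastforce
    moreover have "dist (conv h t) (E (t - s) (conv h s)) < e / 2"
    proof -
      have "norm (conv h t - E (t - s) (conv h s)) \<le> c * N * ((t - s) powr (1 - \<alpha>) / (1 - \<alpha>))"
        by (rule conv_split) (use st b hN in \<open>auto intro: continuous_on_subset[OF h]\<close>)
      then show ?thesis using d2(2)[of "t - s"] st unfolding dist_norm by linarith
    qed
    ultimately show ?thesis
      using dist_triangle[of "conv h t" "conv h s" "E (t - s) (conv h s)"] by (simp add: dist_commute)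
  qed
  show thesis
  proof (rule that[of "min d1 d2"])
    show "0 < min d1 d2" using d1 d2 by simp
    fix h :: "real \<Rightarrow> 'a" and s t
    assume a: "continuous_on {0..b} h" "\<And>s. s \<in> {0..b} \<Longrightarrow> norm (h s) \<le> N"
      "s \<in> {0..b}" "t \<in> {0..b}" "\<bar>s - t\<bar> < min d1 d2"
    show "dist (conv h s) (conv h t) < e"
    proof (cases "s \<le> t")
      case True
      then show ?thesis using a by (intro main) auto
    next
      case False
      then have "dist (conv h t) (conv h s) < e" using a by (intro main) auto
      then show ?thesis by (simp add: dist_commute)
    qed
  qed
qed

lemma continuous_on_conv:
  assumes b: "b \<le> 1" and h: "continuous_on {0..b} h"
  shows "continuous_on {0..b} (conv h)"
  unfolding continuous_on_iff
proof (intro ballI allI impI)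
  fix t e :: real assume t: "t \<in> {0..b}" and e: "0 < e"
  have "bounded (h ` {0..b})" by (intro compact_imp_bounded compact_continuous_image h compact_Icc)
  then obtain N where N: "\<And>s. s \<in> {0..b} \<Longrightarrow> norm (h s) \<le> N" unfolding bounded_iff by blast
  obtain d where "0 < d" "\<And>s t. s \<in> {0..b} \<Longrightarrow> t \<in> {0..b} \<Longrightarrow> \<bar>s - t\<bar> < d \<Longrightarrow> dist (conv h s) (conv h t) < e"
    using conv_equicontinuous[OF b e, of N] h N by metis
  then show "\<exists>d>0. \<forall>s\<in>{0..b}. dist s t < d \<longrightarrow> dist (conv h s) (conv h t) < e"
    using t by (auto simp: dist_real_def)
qed

text \<open>Scalar dominated convergence is applied to the norm of the difference of the integrands;
  the kernel bound provides the majorant.\<close>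

lemma conv_tendsto:
  assumes t: "0 \<le> t" "t \<le> 1" and g: "\<And>n. continuous_on {0..t} (g n)" and h: "continuous_on {0..t} h"
    and gN: "\<And>n s. s \<in> {0..t} \<Longrightarrow> norm (g n s) \<le> N"
    and lim: "\<And>s. s \<in> {0..t} \<Longrightarrow> (\<lambda>n. g n s) \<longlonglongrightarrow> h s"
  shows "(\<lambda>n. conv (g n) t) \<longlonglongrightarrow> conv h t"
proof -
  have hN: "norm (h s) \<le> N" if "s \<in> {0..t}" for s
    using LIMSEQ_le_const2[OF tendsto_norm[OF lim[OF that]]] gN[OF that] by blast
  define w where "w s = c * (2 * N) * (t - s) powr (- \<alpha>)" for s
  have w: "w integrable_on {0..t}"
    unfolding w_def using has_integral_mult_right[OF has_integral_kernel_weight[OF \<alpha> t(1)]]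
    by (auto simp: integrable_on_def)
  have d: "norm (g n s - h s) \<le> 2 * N" if "s \<in> {0..t}" for n s
    using norm_triangle_ineq4[of "g n s" "h s"] gN[OF that, of n] hN[OF that] by linarith
  define k where "k n s = norm (K (t - s) (g n s - h s))" for n s
  have kw: "norm (k n s) \<le> w s" if "s \<in> {0..t}" for n s
    using K_apply_bound[of "t - s" "g n s - h s" "2 * N"] d[OF that] that t by (simp add: k_def w_def)
  have ki: "k n integrable_on {0..t}" for n
  proof (rule dominated_integrable_Icc[OF _ w])
    show "continuous_on {0<..<t} (k n)"
      unfolding k_def by (intro continuous_on_norm continuous_on_kernel continuous_on_diff g h)
    show "norm (k n s) \<le> w s" if "s \<in> {0<..<t}" for s using kw[of s] that by auto
  qed
  have "(\<lambda>n. integral {0..t} (k n)) \<longlonglongrightarrow> integral {0..t} (\<lambda>s. 0)"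
  proof (rule dominated_convergence(2)[OF ki w kw])
    show "(\<lambda>n. k n s) \<longlonglongrightarrow> 0" if "s \<in> {0..t}" for s
    proof -
      have "(\<lambda>n. K (t - s) (g n s - h s)) \<longlonglongrightarrow> K (t - s) (h s - h s)"
        by (intro bounded_linear.tendsto[OF blinfun.bounded_linear_right] tendsto_diff lim[OF that] tendsto_const)
      then show ?thesis unfolding k_def by (auto intro: tendsto_norm_zero simp: blinfun.zero_right)
    qed
  qed
  then have lim0: "(\<lambda>n. integral {0..t} (k n)) \<longlonglongrightarrow> 0" by simp
  have "norm (conv (g n) t - conv h t) \<le> integral {0..t} (k n)" for n
  proof -
    have i: "(\<lambda>s. K (t - s) (g n s)) integrable_on {0..t}" "(\<lambda>s. K (t - s) (h s)) integrable_on {0..t}"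
      using t by (auto intro!: kernel_integrable[OF _ _ g gN] kernel_integrable[OF _ _ h hN])
    have "conv (g n) t - conv h t = integral {0..t} (\<lambda>s. K (t - s) (g n s - h s))"
      using integral_diff[OF i] by (simp add: conv_def blinfun.diff_right)
    also have "norm \<dots> \<le> integral {0..t} (k n)"
      by (rule integral_norm_bound_integral[OF _ ki])
        (use integrable_diff[OF i] in \<open>auto simp: blinfun.diff_right k_def\<close>)
    finally show ?thesis .
  qed
  then show ?thesis
    by (intro LIM_zero_cancel[OF Lim_null_comparison[OF _ lim0]] always_eventually allI)
qed

end

section \<open>Local construction below a given solution\<close>

lemma integral_mono_cone:
  fixes f g :: "real \<Rightarrow> 'a::{banach, ordered_real_vector}"
  assumes cl: "closed {x::'a. 0 \<le> x}" and f: "f integrable_on {a..b}" and g: "g integrable_on {a..b}"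
    and le: "\<And>s. s \<in> {a..b} \<Longrightarrow> f s \<le> g s"
  shows "integral {a..b} f \<le> integral {a..b} g"
proof -
  have "integral (cbox a b) (\<lambda>s. g s - f s) \<in> {x. 0 \<le> x}"
    by (rule integral_in_closed_cone[OF cl]) (use le in \<open>auto simp: scaleR_nonneg_nonneg\<close>)
  then show ?thesis using integral_diff[OF g f] by simp
qed

text \<open>The approximants solve the equation with the nonlinearity evaluated at
  \<open>y (s - d) + z s - z (s - d)\<close>: the delay makes them explicit, and the correction by the
  increment of the given solution \<open>z\<close> keeps the argument below \<open>z s\<close> whenever \<open>y \<le> z\<close> at
  time \<open>s - d\<close>.\<close>

proposition volterra_local_existence_below:
  fixes E K :: "real \<Rightarrow> 'a::{banach, ordered_real_vector} \<Rightarrow>\<^sub>L 'a"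
  assumes VK: "volterra_kernel E M \<omega> K \<alpha> c"
    and P: "bounded_linear P" and PK: "\<And>t x. 0 < t \<Longrightarrow> P (K t x) = E t x"
    and PE: "\<And>t x. 0 \<le> t \<Longrightarrow> P (E t x) = E t (P x)"
    and cl: "closed {x::'a. 0 \<le> x}" and Epos: "\<And>t x. 0 \<le> t \<Longrightarrow> 0 \<le> x \<Longrightarrow> 0 \<le> E t x"
    and F: "continuous_on UNIV F"
    and \<tau>: "0 < \<tau>" and z: "continuous_on {0..\<tau>} z" and H: "continuous_on {0..\<tau>} H"
    and zH: "\<And>t. t \<in> {0..\<tau>} \<Longrightarrow> P (z t) = E t (P (z 0)) + integral {0..t} (\<lambda>s. E (t - s) (H s))"
    and y0: "P y0 \<le> P (z 0)"
    and FH: "\<And>x s. s \<in> {0..\<tau>} \<Longrightarrow> P x \<le> P (z s) \<Longrightarrow> F x \<le> H s"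
  obtains \<epsilon> y where "0 < \<epsilon>" "\<epsilon> \<le> \<tau>" "continuous_on {0..\<epsilon>} y"
    "\<And>t. t \<in> {0..\<epsilon>} \<Longrightarrow> P (y t) = E t (P y0) + integral {0..t} (\<lambda>s. E (t - s) (F (y s)))"
    "\<And>t. t \<in> {0..\<epsilon>} \<Longrightarrow> P (y t) \<le> P (z t)"
proof -
  interpret volterra_kernel E M \<omega> K \<alpha> c by fact
  note Padd = linear_add[OF bounded_linear.linear[OF P]] and Pdiff = linear_diff[OF bounded_linear.linear[OF P]]
  \<comment> \<open>A bound for \<open>F\<close> is available only near \<open>y0\<close>, by
    continuity there, since balls need not be compact. The approximants must therefore be kept close
    to \<open>y0\<close>.\<close>
  define N where "N = norm (F y0) + 1"
  have "isCont F y0" using F by (simp add: continuous_on_eq_continuous_at)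
  then have "\<exists>d>0. \<forall>x. dist x y0 < d \<longrightarrow> dist (F x) (F y0) < 1"
    unfolding continuous_at_eps_delta by (simp add: dist_commute)
  then obtain \<rho> where \<rho>: "0 < \<rho>" "\<And>x. dist x y0 < \<rho> \<Longrightarrow> dist (F x) (F y0) < 1" by blast
  have FN: "norm (F x) \<le> N" if "norm (x - y0) < \<rho>" for x
    using \<rho>(2)[of x] that norm_triangle_ineq2[of "F x" "F y0"] by (simp add: dist_norm N_def)
  obtain d1 where d1: "0 < d1" "\<And>s. s \<in> {0..} \<Longrightarrow> dist s 0 < d1 \<Longrightarrow> dist (E s y0) (E 0 y0) < \<rho> / 4"
    using continuous[of y0, unfolded continuous_on_iff, rule_format, of 0 "\<rho> / 4"] \<rho>(1) by auto
  obtain d2 where d2: "0 < d2" "\<And>s. s \<in> {0..\<tau>} \<Longrightarrow> dist s 0 < d2 \<Longrightarrow> dist (z s) (z 0) < \<rho> / 8"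
    using z[unfolded continuous_on_iff, rule_format, of 0 "\<rho> / 8"] \<rho>(1) \<tau> by auto
  obtain d3 where d3: "0 < d3" "\<And>s. 0 \<le> s \<Longrightarrow> s < d3 \<Longrightarrow> c * N * (s powr (1 - \<alpha>) / (1 - \<alpha>)) < \<rho> / 4"
    using powr_small[of "\<rho> / 4"] \<rho>(1) by (metis divide_pos_pos zero_less_numeral)
  \<comment> \<open>The orbit of \<open>y0\<close> and the convolution move by at most \<rho>/4
    each, which gives the \<rho>/2 in \<open>G\<close>; an increment of \<open>z\<close> adds less
    than \<rho>/4, so the arguments of \<open>F\<close> stay within \<rho> of \<open>y0\<close>.
    Halving makes the comparisons with \<open>d1\<close>, \<open>d2\<close>, \<open>d3\<close>
    strict.\<close>
  define \<epsilon> where "\<epsilon> = min (min 1 \<tau>) (min d1 (min d2 d3)) / 2"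
  have \<epsilon>: "0 < \<epsilon>" "\<epsilon> \<le> 1" "\<epsilon> \<le> \<tau>" "\<epsilon> < d1" "\<epsilon> < d2" "\<epsilon> < d3"
    using d1(1) d2(1) d3(1) \<tau> by (auto simp: \<epsilon>_def)
  have Ey: "norm (E t y0 - y0) < \<rho> / 4" if "t \<in> {0..\<epsilon>}" for t
    using d1(2)[of t] that \<epsilon> by (simp add: dist_norm)
  have z0: "norm (z t - z 0) < \<rho> / 8" if "t \<in> {0..\<epsilon>}" for t
    using d2(2)[of t] that \<epsilon> by (simp add: dist_norm)
  have zz: "norm (z t - z s) < \<rho> / 4" if "t \<in> {0..\<epsilon>}" "s \<in> {0..\<epsilon>}" for s t
    using z0[OF that(1)] z0[OF that(2)] norm_triangle_ineq4[of "z t - z 0" "z s - z 0"] by simp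
  have z\<epsilon>: "continuous_on {0..\<epsilon>} z" using \<epsilon> by (intro continuous_on_subset[OF z]) auto
  define G where "G = {y. continuous_on {0..\<epsilon>} y \<and> y 0 = y0 \<and>
      (\<forall>t\<in>{0..\<epsilon>}. norm (y t - y0) \<le> \<rho> / 2 \<and> P (y t) \<le> P (z t))}"
  \<comment> \<open>For s < d the delayed time is held at 0, where the value \<open>y0\<close> and
    its inequality are given.\<close>
  define X where "X d y s = y (max 0 (s - d)) + (z s - z (max 0 (s - d)))" for d :: real and y s
  define \<Phi> where "\<Phi> d y t = E t y0 + conv (\<lambda>s. F (X d y s)) t" for d y t
  have delay_in: "max 0 (s - d) \<in> {0..\<epsilon>}" if "s \<in> {0..\<epsilon>}" "0 \<le> d" for s d
    using that by auto
  have Xc: "continuous_on {0..\<epsilon>} (X d y)" if "continuous_on {0..\<epsilon>} y" "0 \<le> d" for d y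
    unfolding X_def
    by (intro continuous_intros z\<epsilon> continuous_on_compose2[OF that(1)] continuous_on_compose2[OF z\<epsilon>])
      (use that(2) in auto)
  have FXc: "continuous_on {0..\<epsilon>} (\<lambda>s. F (X d y s))" if "continuous_on {0..\<epsilon>} y" "0 \<le> d" for d y
    by (rule continuous_on_compose2[OF F Xc[OF that]]) simp
  have FXN: "norm (F (X d y s)) \<le> N" if y: "y \<in> G" and d: "0 \<le> d" and s: "s \<in> {0..\<epsilon>}" for d y s
  proof (rule FN)
    have "norm (y (max 0 (s - d)) - y0) \<le> \<rho> / 2" using y delay_in[OF s d] by (auto simp: G_def)
    moreover have "norm (z s - z (max 0 (s - d))) < \<rho> / 4" by (rule zz[OF s delay_in[OF s d]])
    ultimately have "norm ((y (max 0 (s - d)) - y0) + (z s - z (max 0 (s - d)))) < \<rho>"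
      using norm_triangle_ineq[of "y (max 0 (s - d)) - y0" "z s - z (max 0 (s - d))"] \<rho>(1) by linarith
    then show "norm (X d y s - y0) < \<rho>" by (simp add: X_def algebra_simps)
  qed
  have Pconv: "((\<lambda>s. E (t - s) (h s)) has_integral P (conv h t)) {0..t}"
    if "t \<in> {0..\<epsilon>}" "continuous_on {0..\<epsilon>} h" for h t
  proof -
    have h: "continuous_on {0..t} h" using that by (auto intro: continuous_on_subset)
    then have "bounded (h ` {0..t})" by (intro compact_imp_bounded compact_continuous_image compact_Icc)
    then obtain B where B: "\<And>s. s \<in> {0..t} \<Longrightarrow> norm (h s) \<le> B" unfolding bounded_iff by blast
    have "(\<lambda>s. K (t - s) (h s)) integrable_on {0..t}"
      by (rule kernel_integrable[OF _ _ h B]) (use that \<epsilon> in auto)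
    then have "((\<lambda>s. K (t - s) (h s)) has_integral conv h t) {0..t}"
      by (simp add: conv_def integrable_integral)
    from has_integral_linear[OF this P] have "((\<lambda>s. P (K (t - s) (h s))) has_integral P (conv h t)) {0..t}"
      by (simp add: o_def)
    then show ?thesis
      by (rule has_integral_spike[of "{t}", rotated 2]) (use that PK in auto)
  qed
  have P\<Phi>: "P (\<Phi> d y t) \<le> P (z t)" if y: "y \<in> G" and d: "0 \<le> d" and t: "t \<in> {0..\<epsilon>}" for d y t
  proof -
    have yc: "continuous_on {0..\<epsilon>} y" using y by (simp add: G_def)
    note I = Pconv[OF t FXc[OF yc d]]
    have "P (conv (\<lambda>s. F (X d y s)) t) = integral {0..t} (\<lambda>s. E (t - s) (F (X d y s)))"
      using integral_unique[OF I] by simp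
    also have "\<dots> \<le> integral {0..t} (\<lambda>s. E (t - s) (H s))"
    proof (rule integral_mono_cone[OF cl])
      show "(\<lambda>s. E (t - s) (F (X d y s))) integrable_on {0..t}" using I by (auto simp: integrable_on_def)
      show "(\<lambda>s. E (t - s) (H s)) integrable_on {0..t}"
        by (rule integrable_continuous_real, intro continuous_compose continuous_intros continuous_on_subset[OF H])
          (use t \<epsilon> in auto)
      fix s assume s: "s \<in> {0..t}"
      then have s': "s \<in> {0..\<epsilon>}" "s \<in> {0..\<tau>}" using t \<epsilon> by auto
      have "P (y (max 0 (s - d))) \<le> P (z (max 0 (s - d)))" using y delay_in[OF s'(1) d] by (auto simp: G_def)
      then have "P (X d y s) \<le> P (z s)" by (simp add: X_def Padd Pdiff algebra_simps)
      then have "F (X d y s) \<le> H s" by (rule FH[OF s'(2)])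
      then have "0 \<le> E (t - s) (H s - F (X d y s))" using s by (intro Epos) auto
      then show "E (t - s) (F (X d y s)) \<le> E (t - s) (H s)" by (simp add: blinfun.diff_right)
    qed
    finally have 1: "P (conv (\<lambda>s. F (X d y s)) t) \<le> integral {0..t} (\<lambda>s. E (t - s) (H s))" .
    have "0 \<le> E t (P (z 0) - P y0)" using t y0 by (intro Epos) auto
    then have "E t (P y0) \<le> E t (P (z 0))" by (simp add: blinfun.diff_right)
    from add_mono[OF this 1] show ?thesis
      using zH[of t] t \<epsilon> by (simp add: \<Phi>_def Padd PE)
  qed
  have \<Phi>c: "continuous_on {0..\<epsilon>} (\<Phi> d y)" if "continuous_on {0..\<epsilon>} y" "0 \<le> d" for d y
    unfolding \<Phi>_def
    by (intro continuous_on_add continuous_on_conv \<epsilon> FXc that continuous_on_subset[OF continuous]) auto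
  have \<Phi>G: "\<Phi> d y \<in> G" if y: "y \<in> G" and d: "0 \<le> d" for d y
  proof -
    have yc: "continuous_on {0..\<epsilon>} y" using y by (simp add: G_def)
    have "norm (\<Phi> d y t - y0) \<le> \<rho> / 2" if t: "t \<in> {0..\<epsilon>}" for t
    proof -
      have "norm (conv (\<lambda>s. F (X d y s)) t) \<le> c * N * (t powr (1 - \<alpha>) / (1 - \<alpha>))"
        by (rule conv_bound) (use t \<epsilon> FXN[OF y d] in \<open>auto intro: continuous_on_subset[OF FXc[OF yc d]]\<close>)
      also have "\<dots> < \<rho> / 4" using d3(2)[of t] t \<epsilon> by auto
      finally have "norm ((E t y0 - y0) + conv (\<lambda>s. F (X d y s)) t) < \<rho> / 2"
        using norm_triangle_ineq[of "E t y0 - y0" "conv (\<lambda>s. F (X d y s)) t"] Ey[OF t] by linarith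
      then show ?thesis by (simp add: \<Phi>_def algebra_simps)
    qed
    moreover have "\<Phi> d y 0 = y0" by (simp add: \<Phi>_def)
    ultimately show ?thesis using \<Phi>c[OF yc d] P\<Phi>[OF y d] by (simp add: G_def)
  qed
  \<comment> \<open>The iteration starts from the translate of \<open>z\<close> through
    \<open>y0\<close>; it lies below \<open>z\<close> exactly because \<open>P y0\<close> lies below
    \<open>P (z 0)\<close>.\<close>
  define Y where "Y d m = (\<Phi> d ^^ m) (\<lambda>t. y0 + (z t - z 0))" for d m
  have YG: "Y d m \<in> G" if d: "0 \<le> d" for d m
  proof (induction m)
    case 0
    have "norm (z t - z 0) \<le> \<rho> / 2" if "t \<in> {0..\<epsilon>}" for t using z0[OF that] \<rho>(1) by linarith
    moreover have "P (y0 + (z t - z 0)) \<le> P (z t)" for t using y0 by (simp add: Padd Pdiff algebra_simps)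
    ultimately show ?case
      unfolding G_def Y_def by (auto intro!: continuous_intros z\<epsilon>)
  next
    case (Suc m)
    then show ?case using \<Phi>G[OF _ d] by (simp add: Y_def)
  qed
  \<comment> \<open>At time \<open>t\<close> the map reads its input only at times up to t - d and
    at 0, so each application settles the function on a further stretch of length \<open>d\<close>.
    For m = 0 only t = 0 is claimed.\<close>
  have Ystep: "\<Phi> d (Y d m) t = Y d m t" if d: "0 < d" and "t \<in> {0..\<epsilon>}" "t \<le> real m * d" for d m t
    using that(2,3)
  proof (induction m arbitrary: t)
    case 0
    then show ?case by (simp add: \<Phi>_def Y_def)
  next
    case (Suc m)
    have "conv (\<lambda>s. F (X d (Y d (Suc m)) s)) t = conv (\<lambda>s. F (X d (Y d m) s)) t"
    proof (rule conv_cong)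
      fix s assume "s \<in> {0..t}"
      then have "max 0 (s - d) \<in> {0..\<epsilon>}" "max 0 (s - d) \<le> real m * d"
        using Suc.prems d by (auto simp: algebra_simps)
      then have "Y d (Suc m) (max 0 (s - d)) = Y d m (max 0 (s - d))"
        using Suc.IH[of "max 0 (s - d)"] by (simp add: Y_def)
      then show "F (X d (Y d (Suc m)) s) = F (X d (Y d m) s)" by (simp add: X_def)
    qed
    then have "\<Phi> d (Y d (Suc m)) t = \<Phi> d (Y d m) t" unfolding \<Phi>_def by simp
    also have "\<dots> = Y d (Suc m) t" by (simp add: Y_def)
    finally show ?case .
  qed
  \<comment> \<open>\<open>Suc n\<close> delays of this length exactly cover [0, \<epsilon>], so the
    iterate number \<open>Suc n\<close> solves the delayed equation on the whole interval.\<close>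
  define \<delta> where "\<delta> n = \<epsilon> / real (Suc n)" for n
  have \<delta>: "0 < \<delta> n" for n using \<epsilon> by (simp add: \<delta>_def)
  define f where "f n = Y (\<delta> n) (Suc n)" for n
  define h where "h n s = F (X (\<delta> n) (f n) s)" for n s
  have fG: "f n \<in> G" for n unfolding f_def using \<delta>[of n] by (intro YG) simp
  then have fc: "continuous_on {0..\<epsilon>} (f n)" for n by (simp add: G_def)
  have hc: "continuous_on {0..\<epsilon>} (h n)" for n
    unfolding h_def using \<delta>[of n] by (intro FXc fc) simp
  have hN: "norm (h n s) \<le> N" if "s \<in> {0..\<epsilon>}" for n s
    unfolding h_def using \<delta>[of n] that by (intro FXN fG) auto
  have f_eq: "f n t = E t y0 + conv (h n) t" if t: "t \<in> {0..\<epsilon>}" for n t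
  proof -
    have "real (Suc n) * \<delta> n = \<epsilon>" by (simp add: \<delta>_def del: of_nat_Suc)
    then have "\<Phi> (\<delta> n) (f n) t = f n t"
      unfolding f_def using t by (intro Ystep \<delta>) auto
    then show ?thesis by (simp add: \<Phi>_def h_def[abs_def])
  qed
  have Ec: "continuous_on {0..\<epsilon>} (\<lambda>t. E t y0)" by (intro continuous_on_subset[OF continuous]) auto
  have equi: "\<exists>d>0. \<forall>n. \<forall>s\<in>{0..\<epsilon>}. \<forall>t\<in>{0..\<epsilon>}. \<bar>s - t\<bar> < d \<longrightarrow> dist (f n s) (f n t) < e" if e: "0 < e" for e
  proof -
    have "uniformly_continuous_on {0..\<epsilon>} (\<lambda>t. E t y0)"
      by (intro compact_uniformly_continuous Ec compact_Icc)
    then obtain e1 where e1: "0 < e1" "\<And>s t. s \<in> {0..\<epsilon>} \<Longrightarrow> t \<in> {0..\<epsilon>} \<Longrightarrow> dist s t < e1 \<Longrightarrow> dist (E s y0) (E t y0) < e / 2"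
      unfolding uniformly_continuous_on_def using e by (meson half_gt_zero)
    obtain e2 where e2: "0 < e2" "\<And>h s t. continuous_on {0..\<epsilon>} h \<Longrightarrow> (\<And>s. s \<in> {0..\<epsilon>} \<Longrightarrow> norm (h s) \<le> N) \<Longrightarrow>
        s \<in> {0..\<epsilon>} \<Longrightarrow> t \<in> {0..\<epsilon>} \<Longrightarrow> \<bar>s - t\<bar> < e2 \<Longrightarrow> dist (conv h s) (conv h t) < e / 2"
      using conv_equicontinuous[OF \<epsilon>(2), of "e / 2" N] e by (metis half_gt_zero)
    have "dist (f n s) (f n t) < e" if st: "s \<in> {0..\<epsilon>}" "t \<in> {0..\<epsilon>}" "\<bar>s - t\<bar> < min e1 e2" for n s t
    proof -
      have "dist (E s y0) (E t y0) < e / 2" using st by (intro e1) (auto simp: dist_real_def)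
      moreover have "dist (conv (h n) s) (conv (h n) t) < e / 2" using st hN by (intro e2 hc) auto
      ultimately show ?thesis
        using dist_triangle_add[of "E s y0" "conv (h n) s" "E t y0" "conv (h n) t"] st by (simp add: f_eq)
    qed
    then show ?thesis using e1(1) e2(1) by (intro exI[of _ "min e1 e2"]) auto
  qed
  \<comment> \<open>Compact orbit of \<open>y0\<close> plus the compact closure of all convolutions:
    it contains every value of every approximant.\<close>
  define C where "C = {u + v | u v. u \<in> (\<lambda>t. E t y0) ` {0..\<epsilon>} \<and> v \<in> closure (conv_range N \<epsilon>)}"
  have "compact C"
    unfolding C_def
    by (intro compact_sums compact_continuous_image Ec compact_Icc compact_conv_range \<epsilon>)
  moreover have "f n t \<in> C" if t: "t \<in> {0..\<epsilon>}" for n t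
  proof -
    have "conv (h n) t \<in> conv_range N \<epsilon>"
      unfolding conv_range_def
      by (intro CollectI exI[of _ "h n"] exI[of _ t] conjI ballI hc hN t refl)
    then show ?thesis unfolding C_def f_eq[OF t] using t closure_subset by blast
  qed
  ultimately obtain r y where r: "strict_mono (r :: nat \<Rightarrow> nat)"
    and lim: "\<And>t. t \<in> {0..\<epsilon>} \<Longrightarrow> (\<lambda>n. f (r n) t) \<longlonglongrightarrow> y t" and yc: "continuous_on {0..\<epsilon>} y"
    using equicontinuous_pointwise_convergent_subseq[of \<epsilon> C f] equi \<epsilon>(1) by (metis less_imp_le)
  have \<delta>0: "(\<lambda>n. \<delta> (r n)) \<longlonglongrightarrow> 0"
  proof -
    have "\<delta> \<longlonglongrightarrow> 0" unfolding \<delta>_def using LIMSEQ_Suc[OF lim_const_over_n[of \<epsilon>]] by simp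
    from LIMSEQ_subseq_LIMSEQ[OF this r] show ?thesis by (simp add: o_def)
  qed
  \<comment> \<open>The delayed times tend to \<open>s\<close>. Equicontinuity of the approximants
    removes the delay in \<open>f\<close>, continuity of \<open>z\<close> removes the correction,
    and continuity of \<open>F\<close> finishes.\<close>
  have hlim: "(\<lambda>n. h (r n) s) \<longlonglongrightarrow> F (y s)" if s: "s \<in> {0..\<epsilon>}" for s
  proof -
    define b where "b n = max 0 (s - \<delta> (r n))" for n
    have bI: "b n \<in> {0..\<epsilon>}" for n unfolding b_def using \<delta>[of "r n"] by (intro delay_in s) simp
    have "(\<lambda>n. max 0 (s - \<delta> (r n))) \<longlonglongrightarrow> max 0 (s - 0)" by (intro tendsto_intros \<delta>0)
    then have blim: "b \<longlonglongrightarrow> s" using s by (simp add: b_def[abs_def])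
    have "(\<lambda>n. z (b n)) \<longlonglongrightarrow> z s"
      by (rule continuous_on_tendsto_compose[OF z\<epsilon> blim s]) (use bI in auto)
    then have zl: "(\<lambda>n. z s - z (b n)) \<longlonglongrightarrow> z s - z s" by (intro tendsto_intros)
    have "(\<lambda>n. f (r n) (b n) - f (r n) s) \<longlonglongrightarrow> 0"
    proof (rule tendstoI)
      fix e :: real assume "0 < e"
      then obtain d where d: "0 < d" "\<And>n s t. s \<in> {0..\<epsilon>} \<Longrightarrow> t \<in> {0..\<epsilon>} \<Longrightarrow> \<bar>s - t\<bar> < d \<Longrightarrow> dist (f n s) (f n t) < e"
        using equi by meson
      have "\<forall>\<^sub>F n in sequentially. dist (b n) s < d" using tendstoD[OF blim d(1)] .
      then show "\<forall>\<^sub>F n in sequentially. dist (f (r n) (b n) - f (r n) s) 0 < e"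
      proof eventually_elim
        case (elim n)
        then show ?case using d(2)[OF bI s, of n "r n"] by (simp add: dist_real_def dist_norm)
      qed
    qed
    from tendsto_add[OF this lim[OF s]] have "(\<lambda>n. f (r n) (b n)) \<longlonglongrightarrow> y s" by simp
    from tendsto_add[OF this zl] have "(\<lambda>n. X (\<delta> (r n)) (f (r n)) s) \<longlonglongrightarrow> y s"
      by (simp add: X_def b_def)
    then show ?thesis
      unfolding h_def by (rule continuous_on_tendsto_compose[OF F]) auto
  qed
  have Fyc: "continuous_on {0..\<epsilon>} (\<lambda>s. F (y s))"
    by (rule continuous_on_compose2[OF F yc]) simp
  have y_eq: "y t = E t y0 + conv (\<lambda>s. F (y s)) t" if t: "t \<in> {0..\<epsilon>}" for t
  proof -
    have "(\<lambda>n. conv (h (r n)) t) \<longlonglongrightarrow> conv (\<lambda>s. F (y s)) t"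
      by (rule conv_tendsto[of t _ _ N])
        (use t \<epsilon> hN hlim in \<open>auto intro: continuous_on_subset[OF hc] continuous_on_subset[OF Fyc]\<close>)
    then have "(\<lambda>n. f (r n) t) \<longlonglongrightarrow> E t y0 + conv (\<lambda>s. F (y s)) t"
      unfolding f_eq[OF t] by (intro tendsto_intros)
    with lim[OF t] show ?thesis by (rule LIMSEQ_unique)
  qed
  show thesis
  proof (rule that[OF \<epsilon>(1,3) yc])
    fix t assume t: "t \<in> {0..\<epsilon>}"
    show "P (y t) = E t (P y0) + integral {0..t} (\<lambda>s. E (t - s) (F (y s)))"
      using integral_unique[OF Pconv[OF t Fyc]] y_eq[OF t] t by (simp add: Padd PE)
    have "(\<lambda>n. P (z t) - P (f (r n) t)) \<longlonglongrightarrow> P (z t) - P (y t)"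
      by (intro tendsto_diff tendsto_const bounded_linear.tendsto[OF P] lim t)
    moreover have "P (z t) - P (f n t) \<in> {x. 0 \<le> x}" for n using fG[of n] t by (simp add: G_def)
    ultimately have "P (z t) - P (y t) \<in> {x. 0 \<le> x}"
      by (intro Lim_in_closed_set[OF cl]) auto
    then show "P (y t) \<le> P (z t)" by simp
  qed
qed

section \<open>Mild solutions in the fractional power space\<close>

text \<open>For exponent 0 the fractional power is the identity; this turns closedness of the cone
  of exponent 0 into closedness in norm.\<close>

lemma frac_topology_0:
  fixes T :: "real \<Rightarrow> 'a::banach \<Rightarrow>\<^sub>L 'a"
  shows "frac_topology T a 0 = euclidean"
proof -
  have n: "neg_frac_power T a 0 = (\<lambda>x. x)" by (simp add: neg_frac_power_def fun_eq_iff)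
  have inv: "inv (\<lambda>x::'a. x) = (\<lambda>x. x)" by (simp add: inv_equality)
  have "(\<lambda>x y. frac_norm T a 0 (x - y)) = (dist :: 'a \<Rightarrow> _)"
    by (simp add: frac_norm_def frac_power_def n inv dist_norm fun_eq_iff)
  then show ?thesis
    by (simp add: frac_topology_def frac_space_def n)
qed

lemma closed_positive_cone:
  fixes T :: "real \<Rightarrow> 'a::{banach, ordered_real_vector} \<Rightarrow>\<^sub>L 'a"
  assumes "closedin (frac_topology T a 0) (positive_cone T a 0)"
  shows "closed {x::'a. 0 \<le> x}"
proof -
  have "positive_cone T a 0 = {x. 0 \<le> x}"
    by (auto simp: positive_cone_def frac_space_def neg_frac_power_def)
  then show ?thesis using assms by (simp add: frac_topology_0)
qed

text \<open>Passing between the generators \<open>-A\<close> and \<open>-A - k\<close>: integrate the derivative of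
  \<open>s \<mapsto> e\<^bsup>-k(t-s)\<^esup> T(t-s) u(s)\<close>.\<close>

lemma (in growth_semigroup) mild_formula_exp_shift:
  assumes f: "continuous_on {0..\<tau>} f" and u: "continuous_on {0..\<tau>} u"
    and eq: "\<And>t. t \<in> {0..\<tau>} \<Longrightarrow> u t = T t w + integral {0..t} (\<lambda>s. T (t - s) (f s))"
    and t: "t \<in> {0..\<tau>}"
  shows "u t = exp (- k * t) *\<^sub>R T t w
    + integral {0..t} (\<lambda>s. exp (- k * (t - s)) *\<^sub>R T (t - s) (f s + k *\<^sub>R u s))"
proof -
  have cf: "continuous_on {0..s} (\<lambda>r. T (s' - r) (f r))" if "s \<in> {0..\<tau>}" "s \<le> s'" for s s'
    by (intro continuous_compose continuous_intros continuous_on_subset[OF f]) (use that in auto)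
  \<comment> \<open>With \<open>t\<close> fixed, T (t - s) (u s) depends on \<open>s\<close> only
    through the upper limit of this integral. It is thus differentiable although a mild solution
    itself may not be.\<close>
  define m where "m s = integral {0..s} (\<lambda>r. T (t - r) (f r))" for s
  have Tu: "T (t - s) (u s) = T t w + m s" if s: "s \<in> {0..t}" for s
  proof -
    have s': "s \<in> {0..\<tau>}" using s t by auto
    have "T (t - s) (T s w) = T t w" using semigroup[of "t - s" s w] s by simp
    moreover have "T (t - s) (integral {0..s} (\<lambda>r. T (s - r) (f r))) = integral {0..s} (\<lambda>r. T (t - s) (T (s - r) (f r)))"
      using integral_linear[OF integrable_continuous_real[OF cf[OF s' order_refl]] blinfun.bounded_linear_right[of "T (t - s)"]]
      by (simp add: o_def)
    moreover have "\<dots> = m s"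
      unfolding m_def by (rule integral_cong) (use s semigroup[of "t - s"] in \<open>simp flip: semigroup\<close>)
    ultimately show ?thesis using eq[OF s'] by (simp add: blinfun.add_right)
  qed
  define \<psi> where "\<psi> s = exp (- k * (t - s)) *\<^sub>R (T t w + m s)" for s
  have d: "(\<psi> has_vector_derivative exp (- k * (t - s)) *\<^sub>R T (t - s) (f s + k *\<^sub>R u s)) (at s within {0..t})"
    if s: "s \<in> {0..t}" for s
  proof -
    have "(m has_vector_derivative T (t - s) (f s)) (at s within {0..t})"
      unfolding m_def by (rule integral_has_vector_derivative[OF cf[OF t order_refl] s])
    then have 1: "((\<lambda>s. T t w + m s) has_vector_derivative 0 + T (t - s) (f s)) (at s within {0..t})"
      by (intro has_vector_derivative_add has_vector_derivative_const)
    have "((\<lambda>s. exp (- k * (t - s))) has_real_derivative k * exp (- k * (t - s))) (at s within {0..t})"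
      by (auto intro!: derivative_eq_intros)
    from has_vector_derivative_scaleR[OF this 1]
    show ?thesis
      unfolding \<psi>_def using Tu[OF s]
      by (simp add: blinfun.add_right blinfun.scaleR_right scaleR_add_right mult.commute)
  qed
  have "((\<lambda>s. exp (- k * (t - s)) *\<^sub>R T (t - s) (f s + k *\<^sub>R u s)) has_integral (\<psi> t - \<psi> 0)) {0..t}"
    by (rule fundamental_theorem_of_calculus[OF _ d]) (use t in auto)
  moreover have "\<psi> t = u t" using eq[OF t] by (simp add: \<psi>_def m_def)
  moreover have "\<psi> 0 = exp (- k * t) *\<^sub>R T t w" by (simp add: \<psi>_def m_def)
  ultimately show ?thesis by (simp add: integral_unique)
qed

section \<open>Lifting mild solutions through the isometry \<open>P\<close>\<close>

text \<open>The data the comparison argument works with once generator and resolvent have been used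
  up. \<open>P\<close> is an isometry of X onto the fractional space of exponent \<alpha>, and order
  is always tested after applying \<open>P\<close>.\<close>

locale mild_setting = volterra_kernel T M \<omega> K \<alpha> c
  for T :: "real \<Rightarrow> 'a::{banach, ordered_real_vector} \<Rightarrow>\<^sub>L 'a" and M \<omega> K \<alpha> c +
  fixes a :: real and P :: "'a \<Rightarrow> 'a"
  assumes P_def: "P = neg_frac_power T a \<alpha>"
    and P_linear: "bounded_linear P" and P_inj: "inj P"
    and P_K: "\<And>t x. 0 < t \<Longrightarrow> P (K t x) = T t x"
    and P_T: "\<And>t x. 0 \<le> t \<Longrightarrow> P (T t x) = T t (P x)"
    and cone_closed: "closed {x::'a. 0 \<le> x}"
    and T_pos: "\<And>t x. 0 \<le> t \<Longrightarrow> 0 \<le> x \<Longrightarrow> 0 \<le> T t x"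
begin

lemmas P_diff = linear_diff[OF bounded_linear.linear[OF P_linear]]
  and P_neg = linear_neg[OF bounded_linear.linear[OF P_linear]]

lemma frac_space_eq: "frac_space T a \<alpha> = range P"
  by (simp add: frac_space_def P_def)

lemma frac_norm_P: "frac_norm T a \<alpha> (P x - P y) = norm (x - y)"
  by (simp add: frac_norm_def frac_power_def P_def[symmetric] P_diff[symmetric] P_inj)

lemma Metric_space_frac: "Metric_space (range P) (\<lambda>x y. frac_norm T a \<alpha> (x - y))"
proof
  show "0 \<le> frac_norm T a \<alpha> (x - y)" for x y by (simp add: frac_norm_def)
  have inv_neg: "inv P (- x) = - inv P x" if "x \<in> range P" for x
    using that P_neg P_inj by (metis f_inv_into_f inv_f_f)
  show "frac_norm T a \<alpha> (x - y) = frac_norm T a \<alpha> (y - x)" for x y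
  proof (cases "x - y \<in> range P")
    case True
    then have "inv P (- (x - y)) = - inv P (x - y)" by (rule inv_neg)
    then have "norm (inv P (y - x)) = norm (inv P (x - y))" by simp
    then show ?thesis by (simp add: frac_norm_def frac_power_def P_def[symmetric])
  next
    case False
    have "y - x \<notin> range P"
    proof
      assume "y - x \<in> range P"
      then obtain z where "y - x = P z" by auto
      then have "x - y = P (- z)" by (simp add: P_neg algebra_simps)
      with False show False by blast
    qed
    \<comment> \<open>Symmetry is demanded also when the difference is outside the range of
      \<open>P\<close> and \<open>inv P\<close> is an arbitrary choice. Neither difference has a
      preimage, so both choices are made from the same empty predicate and agree.\<close>
    with False have "(\<lambda>w. P w = x - y) = (\<lambda>w. P w = y - x)" by (metis rangeI)
    then show ?thesis
      unfolding frac_norm_def frac_power_def P_def[symmetric] inv_def by simp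
  qed
  show "(frac_norm T a \<alpha> (x - y) = 0) = (x = y)" if xy: "x \<in> range P" "y \<in> range P" for x y
  proof -
    obtain x' y' where e: "x = P x'" "y = P y'" using xy by (elim imageE)
    show ?thesis unfolding e frac_norm_P using P_inj by (simp add: inj_eq)
  qed
  show "frac_norm T a \<alpha> (x - z) \<le> frac_norm T a \<alpha> (x - y) + frac_norm T a \<alpha> (y - z)"
    if xyz: "x \<in> range P" "y \<in> range P" "z \<in> range P" for x y z
  proof -
    obtain x' y' z' where e: "x = P x'" "y = P y'" "z = P z'"
      using xyz by (elim imageE)
    show ?thesis unfolding e frac_norm_P using norm_triangle_ineq[of "x' - y'" "y' - z'"] by simp
  qed
qed

lemma frac_topology_eq: "frac_topology T a \<alpha> = Metric_space.mtopology (range P) (\<lambda>x y. frac_norm T a \<alpha> (x - y))"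
  by (simp add: frac_topology_def frac_space_eq)

lemma topspace_frac: "topspace (frac_topology T a \<alpha>) = range P"
  using Metric_space.topspace_mtopology[OF Metric_space_frac] by (simp add: frac_topology_eq)

lemma openin_frac:
  "openin (frac_topology T a \<alpha>) U \<longleftrightarrow> U \<subseteq> range P \<and> (\<forall>x. P x \<in> U \<longrightarrow> (\<exists>r>0. \<forall>y. norm (x - y) < r \<longrightarrow> P y \<in> U))"
proof -
  interpret Metric_space "range P" "\<lambda>x y. frac_norm T a \<alpha> (x - y)" by (rule Metric_space_frac)
  have mb: "mball (P x) r \<subseteq> U \<longleftrightarrow> (\<forall>y. norm (x - y) < r \<longrightarrow> P y \<in> U)" for x r
    by (auto simp: mball_def frac_norm_P)
  have "(\<forall>x. x \<in> U \<longrightarrow> (\<exists>r>0. mball x r \<subseteq> U)) \<longleftrightarrow> (\<forall>x. P x \<in> U \<longrightarrow> (\<exists>r>0. mball (P x) r \<subseteq> U))"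
    if U: "U \<subseteq> range P"
  proof (intro iffI allI impI)
    fix u assume *: "\<forall>x. P x \<in> U \<longrightarrow> (\<exists>r>0. mball (P x) r \<subseteq> U)" and u: "u \<in> U"
    obtain x where "u = P x" using U u by (elim subsetD[elim_format] rangeE)
    then show "\<exists>r>0. mball u r \<subseteq> U" using * u by simp
  qed simp
  then show ?thesis unfolding frac_topology_eq openin_mtopology mb[symmetric] by blast
qed

lemma continuous_map_P: "continuous_map euclidean (frac_topology T a \<alpha>) P"
  unfolding continuous_map_def
proof (intro conjI allI impI)
  show "P \<in> topspace euclidean \<rightarrow> topspace (frac_topology T a \<alpha>)" by (simp add: topspace_frac)
  fix U assume U: "openin (frac_topology T a \<alpha>) U"
  have "open {x. P x \<in> U}"
    unfolding open_dist
  proof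
    fix x assume "x \<in> {x. P x \<in> U}"
    then obtain r where "0 < r" "\<And>y. norm (x - y) < r \<Longrightarrow> P y \<in> U"
      using U unfolding openin_frac by blast
    then show "\<exists>e>0. \<forall>y. dist y x < e \<longrightarrow> y \<in> {x. P x \<in> U}"
      by (auto simp: dist_norm norm_minus_commute)
  qed
  then show "openin euclidean {x \<in> topspace euclidean. P x \<in> U}" by simp
qed

lemma continuous_map_inv_P: "continuous_map (frac_topology T a \<alpha>) euclidean (inv P)"
  unfolding continuous_map_def
proof (intro conjI allI impI)
  fix U :: "'a set" assume "openin euclidean U"
  then have U: "open U" by simp
  show "openin (frac_topology T a \<alpha>) {x \<in> topspace (frac_topology T a \<alpha>). inv P x \<in> U}"
    unfolding openin_frac topspace_frac
  proof (intro conjI allI impI)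
    fix x assume "P x \<in> {x \<in> range P. inv P x \<in> U}"
    then have "x \<in> U" by (simp add: P_inj)
    then obtain r where "0 < r" "ball x r \<subseteq> U" using U open_contains_ball by blast
    then show "\<exists>r>0. \<forall>y. norm (x - y) < r \<longrightarrow> P y \<in> {x \<in> range P. inv P x \<in> U}"
      by (auto simp: P_inj dist_norm subset_eq)
  qed auto
qed simp

text \<open>\<open>P\<close> is a homeomorphism onto the fractional space, so the fractional
  topology can be traded for a continuous lift \<open>y\<close> into X.\<close>

lemma continuous_map_frac_iff:
  "continuous_map (top_of_set I) (frac_topology T a \<alpha>) u \<longleftrightarrow>
    (\<exists>y. continuous_on I y \<and> (\<forall>t\<in>I. u t = P (y t)))"
proof
  assume u: "continuous_map (top_of_set I) (frac_topology T a \<alpha>) u"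
  then have "continuous_map (top_of_set I) euclidean (inv P \<circ> u)"
    by (rule continuous_map_compose[OF _ continuous_map_inv_P])
  then have "continuous_on I (inv P \<circ> u)" by simp
  moreover have "u t = P ((inv P \<circ> u) t)" if "t \<in> I" for t
  proof -
    have "u t \<in> range P" using continuous_map_funspace[OF u] that by (auto simp: topspace_frac)
    then show ?thesis by (simp add: f_inv_into_f)
  qed
  ultimately show "\<exists>y. continuous_on I y \<and> (\<forall>t\<in>I. u t = P (y t))" by blast
next
  assume "\<exists>y. continuous_on I y \<and> (\<forall>t\<in>I. u t = P (y t))"
  then obtain y where y: "continuous_on I y" "\<And>t. t \<in> I \<Longrightarrow> u t = P (y t)" by blast
  have "continuous_map (top_of_set I) (frac_topology T a \<alpha>) (P \<circ> y)"
    by (rule continuous_map_compose[OF _ continuous_map_P]) (use y(1) in simp)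
  then show "continuous_map (top_of_set I) (frac_topology T a \<alpha>) u"
    by (rule continuous_map_eq) (use y(2) in simp)
qed

lemma continuous_on_comp_P:
  assumes "continuous_map (frac_topology T a \<alpha>) euclidean g"
  shows "continuous_on UNIV (\<lambda>x. g (P x))"
  using continuous_map_compose[OF continuous_map_P assms] by (simp add: o_def)

abbreviation mild where "mild \<equiv> mild_solution T a \<alpha>"

lemma mild_iff:
  "mild g w \<tau> u \<longleftrightarrow> (\<exists>y. continuous_on {0..\<tau>} y \<and> (\<forall>t\<in>{0..\<tau>}. u t = P (y t))) \<and>
    (\<forall>t\<in>{0..\<tau>}. u t = T t w + integral {0..t} (\<lambda>s. T (t - s) (g (u s))))"
  by (simp add: mild_solution_def continuous_map_frac_iff)

lemma mild_initial: "mild g w \<tau> u \<Longrightarrow> 0 \<le> \<tau> \<Longrightarrow> u 0 = w"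
  by (auto simp: mild_iff)

lemma mild_cong:
  assumes u: "mild g w \<tau> u" and eq: "\<And>t. t \<in> {0..\<tau>} \<Longrightarrow> v t = u t"
  shows "mild g w \<tau> v"
proof -
  obtain y where y: "continuous_on {0..\<tau>} y" "\<And>t. t \<in> {0..\<tau>} \<Longrightarrow> u t = P (y t)"
    using u unfolding mild_iff by blast
  show ?thesis
    unfolding mild_iff
  proof (intro conjI ballI exI[of _ y])
    fix t assume t: "t \<in> {0..\<tau>}"
    have "integral {0..t} (\<lambda>s. T (t - s) (g (v s))) = integral {0..t} (\<lambda>s. T (t - s) (g (u s)))"
      by (rule integral_cong) (use t eq in auto)
    moreover have "u t = T t w + integral {0..t} (\<lambda>s. T (t - s) (g (u s)))"
      using u t unfolding mild_iff by blast
    ultimately show "v t = T t w + integral {0..t} (\<lambda>s. T (t - s) (g (v s)))"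
      using eq[OF t] by simp
  qed (use y eq in auto)
qed

lemma mild_restrict: "mild g w \<tau> u \<Longrightarrow> \<sigma> \<le> \<tau> \<Longrightarrow> mild g w \<sigma> u"
  unfolding mild_iff by (fastforce intro: continuous_on_subset)

lemma mild_continuous:
  assumes "mild g w \<tau> u"
  shows "continuous_on {0..\<tau>} u"
proof -
  obtain y where y: "continuous_on {0..\<tau>} y" "\<And>t. t \<in> {0..\<tau>} \<Longrightarrow> u t = P (y t)"
    using assms unfolding mild_iff by blast
  have "continuous_on {0..\<tau>} (\<lambda>t. P (y t))" by (rule bounded_linear.continuous_on[OF P_linear y(1)])
  then show ?thesis by (rule continuous_on_eq) (use y(2) in simp)
qed

context
  fixes g :: "'a \<Rightarrow> 'a"
  assumes g: "continuous_on UNIV (\<lambda>x. g (P x))"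
begin

lemma mild_continuous_comp:
  assumes "mild g w \<tau> u"
  shows "continuous_on {0..\<tau>} (\<lambda>t. g (u t))"
proof -
  obtain y where y: "continuous_on {0..\<tau>} y" "\<And>t. t \<in> {0..\<tau>} \<Longrightarrow> u t = P (y t)"
    using assms unfolding mild_iff by blast
  have "continuous_on {0..\<tau>} (\<lambda>t. g (P (y t)))" by (rule continuous_on_compose2[OF g y(1)]) simp
  then show ?thesis by (rule continuous_on_eq) (use y(2) in simp)
qed

lemma mild_integrand:
  assumes u: "mild g w \<tau> u" and "0 \<le> r" "r \<le> \<tau>" "r \<le> t"
  shows "continuous_on {0..r} (\<lambda>s. T (t - s) (g (u s)))"
  by (intro continuous_compose continuous_intros continuous_on_subset[OF mild_continuous_comp[OF u]])
    (use assms in auto)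

text \<open>Transports the formula from time \<open>\<sigma>\<close> to time \<open>t\<close> by the
  semigroup law; restarting and gluing of solutions both reduce to it.\<close>

lemma mild_split:
  assumes u: "mild g w \<tau> u" and s: "0 \<le> \<sigma>" "\<sigma> \<le> \<tau>" "\<sigma> \<le> t"
  shows "T (t - \<sigma>) (u \<sigma>) = T t w + integral {0..\<sigma>} (\<lambda>s. T (t - s) (g (u s)))"
proof -
  have "T (t - \<sigma>) (integral {0..\<sigma>} (\<lambda>s. T (\<sigma> - s) (g (u s))))
      = integral {0..\<sigma>} (\<lambda>s. T (t - \<sigma>) (T (\<sigma> - s) (g (u s))))"
    using integral_linear[OF integrable_continuous_real[OF mild_integrand[OF u s(1,2) order_refl]]
        blinfun.bounded_linear_right[of "T (t - \<sigma>)"]]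
    by (simp add: o_def)
  also have "\<dots> = integral {0..\<sigma>} (\<lambda>s. T (t - s) (g (u s)))"
    by (rule integral_cong) (use s in \<open>simp flip: semigroup\<close>)
  finally show ?thesis
    using u s semigroup[of "t - \<sigma>" \<sigma> w] unfolding mild_iff by (simp add: blinfun.add_right)
qed

lemma mild_shift:
  assumes u: "mild g w \<tau> u" and s: "0 \<le> \<sigma>" "\<sigma> \<le> \<tau>"
  shows "mild g (u \<sigma>) (\<tau> - \<sigma>) (\<lambda>t. u (\<sigma> + t))"
  unfolding mild_iff
proof (intro conjI ballI)
  obtain y where y: "continuous_on {0..\<tau>} y" "\<And>t. t \<in> {0..\<tau>} \<Longrightarrow> u t = P (y t)"
    using u unfolding mild_iff by blast
  show "\<exists>y. continuous_on {0..\<tau> - \<sigma>} y \<and> (\<forall>t\<in>{0..\<tau> - \<sigma>}. u (\<sigma> + t) = P (y t))"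
    by (intro exI[of _ "\<lambda>t. y (\<sigma> + t)"] conjI continuous_on_compose2[OF y(1)] continuous_intros)
      (use y(2) s in auto)
  fix t assume t: "t \<in> {0..\<tau> - \<sigma>}"
  have "integral {0..t} (\<lambda>r. T (t - r) (g (u (\<sigma> + r)))) = integral {\<sigma>..\<sigma> + t} (\<lambda>r. T (\<sigma> + t - r) (g (u r)))"
    using integral_shift_Icc_real[of 0 t "\<lambda>r. T (\<sigma> + t - r) (g (u r))" \<sigma>] by (simp add: o_def add.commute)
  moreover have "(\<lambda>r. T (\<sigma> + t - r) (g (u r))) integrable_on {0..\<sigma> + t}"
    by (rule integrable_continuous_real[OF mild_integrand[OF u]]) (use s t in auto)
  then have "integral {0..\<sigma>} (\<lambda>r. T (\<sigma> + t - r) (g (u r))) + integral {\<sigma>..\<sigma> + t} (\<lambda>r. T (\<sigma> + t - r) (g (u r)))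
      = integral {0..\<sigma> + t} (\<lambda>r. T (\<sigma> + t - r) (g (u r)))"
    by (intro Henstock_Kurzweil_Integration.integral_combine) (use s t in auto)
  moreover have "u (\<sigma> + t) = T (\<sigma> + t) w + integral {0..\<sigma> + t} (\<lambda>r. T (\<sigma> + t - r) (g (u r)))"
    using u s t unfolding mild_iff by simp
  ultimately show "u (\<sigma> + t) = T t (u \<sigma>) + integral {0..t} (\<lambda>r. T (t - r) (g (u (\<sigma> + r))))"
    using mild_split[OF u s, of "\<sigma> + t"] t by simp
qed

lemma mild_concat:
  assumes u: "mild g w \<sigma> u" and s: "0 \<le> \<sigma>" and v: "mild g (u \<sigma>) \<epsilon> v" and e: "0 \<le> \<epsilon>"
  shows "mild g w (\<sigma> + \<epsilon>) (\<lambda>t. if t \<le> \<sigma> then u t else v (t - \<sigma>))" (is "mild g w _ ?q")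
  unfolding mild_iff
proof (intro conjI ballI)
  obtain y where y: "continuous_on {0..\<sigma>} y" "\<And>t. t \<in> {0..\<sigma>} \<Longrightarrow> u t = P (y t)"
    using u unfolding mild_iff by blast
  obtain z where z: "continuous_on {0..\<epsilon>} z" "\<And>t. t \<in> {0..\<epsilon>} \<Longrightarrow> v t = P (z t)"
    using v unfolding mild_iff by blast
  \<comment> \<open>Continuity in the fractional space requires the lifts to match at
    \<open>\<sigma>\<close>, not just \<open>u\<close> and \<open>v\<close>; injectivity of
    \<open>P\<close> provides it.\<close>
  have "P (z 0) = P (y \<sigma>)" using mild_initial[OF v e] y(2)[of \<sigma>] z(2)[of 0] s e by simp
  then have yz: "z 0 = y \<sigma>" using P_inj by (simp add: inj_eq)
  have "continuous_on ({0..\<sigma>} \<union> {\<sigma>..\<sigma> + \<epsilon>}) (\<lambda>t. if t \<le> \<sigma> then y t else z (t - \<sigma>))"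
  proof (rule continuous_on_If[OF _ _ y(1)])
    show "continuous_on {\<sigma>..\<sigma> + \<epsilon>} (\<lambda>t. z (t - \<sigma>))"
      by (intro continuous_on_compose2[OF z(1)] continuous_intros) auto
    show "y t = z (t - \<sigma>)" if "t \<in> {0..\<sigma>}" "\<not> t \<le> \<sigma>" for t using that by simp
    show "y t = z (t - \<sigma>)" if "t \<in> {\<sigma>..\<sigma> + \<epsilon>}" "t \<le> \<sigma>" for t using that yz by simp
  qed auto
  moreover have "{0..\<sigma>} \<union> {\<sigma>..\<sigma> + \<epsilon>} = {0..\<sigma> + \<epsilon>}" using s e by auto
  ultimately show "\<exists>y. continuous_on {0..\<sigma> + \<epsilon>} y \<and> (\<forall>t\<in>{0..\<sigma> + \<epsilon>}. ?q t = P (y t))"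
    using y(2) z(2) by (intro exI[of _ "\<lambda>t. if t \<le> \<sigma> then y t else z (t - \<sigma>)"]) auto
  fix t assume t: "t \<in> {0..\<sigma> + \<epsilon>}"
  show "?q t = T t w + integral {0..t} (\<lambda>s. T (t - s) (g (?q s)))"
  proof (cases "t \<le> \<sigma>")
    case True
    have "integral {0..t} (\<lambda>s. T (t - s) (g (?q s))) = integral {0..t} (\<lambda>s. T (t - s) (g (u s)))"
      by (rule integral_cong) (use True in auto)
    then show ?thesis using u t True unfolding mild_iff by simp
  next
    case False
    define r where "r = t - \<sigma>"
    have r: "0 \<le> r" "r \<le> \<epsilon>" "t = \<sigma> + r" using False t by (auto simp: r_def)
    define F where "F s = T (t - s) (g (?q s))" for s
    have F1: "F s = T (t - s) (g (u s))" if "s \<in> {0..\<sigma>}" for s using that by (simp add: F_def)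
    have F2: "F (\<sigma> + s) = T (r - s) (g (v s))" if "s \<in> {0..r}" for s
      using that mild_initial[OF v e] r by (cases "s = 0") (auto simp: F_def)
    have c1: "continuous_on {0..\<sigma>} F"
      by (rule continuous_on_eq[OF mild_integrand[OF u s order_refl]]) (use F1 r in auto)
    then have i1: "(F has_integral integral {0..\<sigma>} F) {0..\<sigma>}"
      by (intro integrable_integral integrable_continuous_real)
    have "((\<lambda>s. T (r - s) (g (v s))) has_integral integral {0..r} (\<lambda>s. T (r - s) (g (v s)))) {0..r}"
      by (intro integrable_integral integrable_continuous_real mild_integrand[OF v] r) simp
    then have "((F \<circ> ((+) \<sigma>)) has_integral integral {0..r} (\<lambda>s. T (r - s) (g (v s)))) {0..r}"
      by (rule has_integral_eq[rotated]) (use F2 in auto)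
    then have i2: "(F has_integral integral {0..r} (\<lambda>s. T (r - s) (g (v s)))) {\<sigma>..t}"
      using r(3) by (simp add: has_integral_shift_Icc_real add.commute)
    have "integral {0..t} F = integral {0..\<sigma>} F + integral {0..r} (\<lambda>s. T (r - s) (g (v s)))"
      by (rule integral_unique, rule has_integral_combine[OF s _ i1 i2]) (use r in auto)
    also have "integral {0..\<sigma>} F = integral {0..\<sigma>} (\<lambda>s. T (t - s) (g (u s)))"
      by (rule integral_cong) (rule F1)
    finally have "T t w + integral {0..t} F = T r (u \<sigma>) + integral {0..r} (\<lambda>s. T (r - s) (g (v s)))"
      using mild_split[OF u s order_refl, of t] r by simp
    also have "\<dots> = v r" using v r unfolding mild_iff by simp
    finally show ?thesis using False unfolding F_def r_def by simp
  qed
qed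

end

section \<open>Local and maximal solutions below a given one\<close>

text \<open>The kernel bound concerns times up to 1, where the exponential factor is at most exp
  \<bar>k\<bar> for either sign of \<open>k\<close>.\<close>

lemma volterra_kernel_exp_shift:
  "volterra_kernel (\<lambda>t. exp (- k * t) *\<^sub>R T t) M (\<omega> - k) (\<lambda>t. exp (- k * t) *\<^sub>R K t) \<alpha> (exp \<bar>k\<bar> * c)"
proof -
  interpret E: growth_semigroup "\<lambda>t. exp (- k * t) *\<^sub>R T t" M "\<omega> - k" by (rule exp_shift)
  show ?thesis
  proof
    show "0 < \<alpha>" "\<alpha> < 1" using \<alpha> by auto
    show "(exp (- k * (t + s)) *\<^sub>R K (t + s)) x = (exp (- k * s) *\<^sub>R T s) ((exp (- k * t) *\<^sub>R K t) x)"
      if "0 < t" "0 \<le> s" for s t x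
      using that
      by (simp add: K_semigroup blinfun.scaleR_left blinfun.scaleR_right exp_add[symmetric] distrib_left)
    show "norm (exp (- k * t) *\<^sub>R K t) \<le> exp \<bar>k\<bar> * c * t powr - \<alpha>" if t: "0 < t" "t \<le> 1" for t
    proof -
      have "- k * t \<le> \<bar>k\<bar> * 1" using t by (intro mult_mono) auto
      then have "exp (- k * t) * norm (K t) \<le> exp \<bar>k\<bar> * (c * t powr - \<alpha>)"
        using K_bound[OF t] by (intro mult_mono) auto
      then show ?thesis by simp
    qed
    show "exp (- k * 0) *\<^sub>R K 0 = 0" by (simp add: K_0)
    show "compact_operator (exp (- k * t) *\<^sub>R T t)" if t: "0 < t" for t
      unfolding compact_operator_def
    proof (intro allI impI)
      fix S :: "'a set" assume "bounded S"
      then have K: "compact ((\<lambda>x. exp (- k * t) *\<^sub>R x) ` closure (T t ` S))" (is "compact ?K")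
        using compact[OF t] by (intro compact_scaling) (simp add: compact_operator_def)
      have "(exp (- k * t) *\<^sub>R T t) ` S \<subseteq> ?K"
        using closure_subset by (fastforce simp: blinfun.scaleR_left)
      then have "closure ((exp (- k * t) *\<^sub>R T t) ` S) \<subseteq> ?K"
        by (rule closure_minimal[OF _ compact_imp_closed[OF K]])
      then show "compact (closure ((exp (- k * t) *\<^sub>R T t) ` S))"
        using compact_Int_closed[OF K closed_closure] by (metis inf.absorb2)
    qed
  qed
qed

text \<open>The term with \<open>k\<close> is moved into the nonlinearity and compensated in the
  semigroup. For P x \<le> u s this gives gv (P x) + k P x \<le> gu (P x) + k P x \<le> gu (u s) + k
  u s: first the ordering of the nonlinearities, then monotonicity.\<close>

lemma mild_local_existence_below:
  assumes gu: "continuous_on UNIV (\<lambda>x. gu (P x))" and gv: "continuous_on UNIV (\<lambda>x. gv (P x))"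
    and le: "\<And>x. gv (P x) \<le> gu (P x)"
    and mono: "mono_on (range P) (\<lambda>x. gu x + k *\<^sub>R x)"
    and u: "mild gu wu \<tau> u" and \<tau>: "0 < \<tau>"
    and wv: "wv \<in> range P" "wv \<le> wu"
  obtains \<epsilon> v where "0 < \<epsilon>" "\<epsilon> \<le> \<tau>" "mild gv wv \<epsilon> v" "\<And>t. t \<in> {0..\<epsilon>} \<Longrightarrow> v t \<le> u t"
proof -
  define E where "E t = exp (- k * t) *\<^sub>R T t" for t
  interpret E: growth_semigroup E M "\<omega> - k" unfolding E_def[abs_def] by (rule exp_shift)
  obtain z where z: "continuous_on {0..\<tau>} z" "\<And>t. t \<in> {0..\<tau>} \<Longrightarrow> u t = P (z t)"
    using u unfolding mild_iff by blast
  obtain y0 where y0: "wv = P y0" using wv(1) by blast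
  have wu: "wu = P (z 0)" using mild_initial[OF u] z(2)[of 0] \<tau> by simp
  define H where "H s = gu (u s) + k *\<^sub>R u s" for s
  define F where "F x = gv (P x) + k *\<^sub>R P x" for x
  have Pc: "continuous_on S P" for S
    using bounded_linear.continuous_on[OF P_linear continuous_on_id] by simp
  have Fc: "continuous_on UNIV F" unfolding F_def by (intro continuous_intros gv Pc)
  have Hc: "continuous_on {0..\<tau>} H"
    unfolding H_def by (intro continuous_intros mild_continuous_comp[OF gu u] mild_continuous[OF u])
  have VK: "volterra_kernel E M (\<omega> - k) (\<lambda>t. exp (- k * t) *\<^sub>R K t) \<alpha> (exp \<bar>k\<bar> * c)"
    unfolding E_def[abs_def] by (rule volterra_kernel_exp_shift)
  have scale: "P (b *\<^sub>R x) = b *\<^sub>R P x" for b x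
    using P_linear by (simp add: linear_scale bounded_linear.linear)
  have "\<exists>\<epsilon> y. 0 < \<epsilon> \<and> \<epsilon> \<le> \<tau> \<and> continuous_on {0..\<epsilon>} y \<and>
    (\<forall>t\<in>{0..\<epsilon>}. P (y t) = E t (P y0) + integral {0..t} (\<lambda>s. E (t - s) (F (y s)))) \<and>
    (\<forall>t\<in>{0..\<epsilon>}. P (y t) \<le> P (z t))"
  proof (rule volterra_local_existence_below[OF VK P_linear _ _ cone_closed _ Fc \<tau> z(1) Hc])
    show "P ((exp (- k * t) *\<^sub>R K t) x) = E t x" if "0 < t" for t x
      using that by (simp add: E_def blinfun.scaleR_left scale P_K)
    show "P (E t x) = E t (P x)" if "0 \<le> t" for t x
      using that by (simp add: E_def blinfun.scaleR_left scale P_T)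
    show "0 \<le> E t x" if "0 \<le> t" "0 \<le> x" for t x
      using T_pos[OF that] by (simp add: E_def blinfun.scaleR_left scaleR_nonneg_nonneg)
    show "P (z t) = E t (P (z 0)) + integral {0..t} (\<lambda>s. E (t - s) (H s))" if "t \<in> {0..\<tau>}" for t
    proof -
      have "u t = exp (- k * t) *\<^sub>R T t wu
          + integral {0..t} (\<lambda>s. exp (- k * (t - s)) *\<^sub>R T (t - s) (gu (u s) + k *\<^sub>R u s))"
        by (rule mild_formula_exp_shift[OF mild_continuous_comp[OF gu u] mild_continuous[OF u] _ that])
          (use u in \<open>simp add: mild_iff\<close>)
      then show ?thesis using z(2)[OF that] wu by (simp add: E_def H_def blinfun.scaleR_left)
    qed
    show "P y0 \<le> P (z 0)" using wv(2) by (simp add: wu y0)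
    show "F x \<le> H s" if s: "s \<in> {0..\<tau>}" and x: "P x \<le> P (z s)" for x s
    proof -
      have "F x \<le> gu (P x) + k *\<^sub>R P x" using le[of x] by (simp add: F_def)
      also have "\<dots> \<le> gu (P (z s)) + k *\<^sub>R P (z s)" using mono_onD[OF mono _ _ x] by simp
      finally show ?thesis using z(2)[OF s] by (simp add: H_def)
    qed
  qed blast
  then obtain \<epsilon> y where e: "0 < \<epsilon>" "\<epsilon> \<le> \<tau>" and yc: "continuous_on {0..\<epsilon>} y"
    and yE: "\<And>t. t \<in> {0..\<epsilon>} \<Longrightarrow> P (y t) = E t (P y0) + integral {0..t} (\<lambda>s. E (t - s) (F (y s)))"
    and yz: "\<And>t. t \<in> {0..\<epsilon>} \<Longrightarrow> P (y t) \<le> P (z t)"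
    by blast
  define v where "v t = P (y t)" for t
  have vc: "continuous_on {0..\<epsilon>} v"
    unfolding v_def by (rule bounded_linear.continuous_on[OF P_linear yc])
  have gvc: "continuous_on {0..\<epsilon>} (\<lambda>s. gv (v s))"
    unfolding v_def by (rule continuous_on_compose2[OF gv yc]) simp
  have "v t = T t wv + integral {0..t} (\<lambda>s. T (t - s) (gv (v s)))" if t: "t \<in> {0..\<epsilon>}" for t
  proof -
    \<comment> \<open>Shifting back by \<open>- k\<close> cancels the added term and restores the
      original semigroup.\<close>
    have "v t = exp (- (- k) * t) *\<^sub>R E t wv
        + integral {0..t} (\<lambda>s. exp (- (- k) * (t - s)) *\<^sub>R E (t - s) (F (y s) + (- k) *\<^sub>R v s))"
    proof (rule E.mild_formula_exp_shift[OF _ vc _ t])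
      show "continuous_on {0..\<epsilon>} (\<lambda>s. F (y s))" by (rule continuous_on_compose2[OF Fc yc]) simp
      show "v t = E t wv + integral {0..t} (\<lambda>s. E (t - s) (F (y s)))" if "t \<in> {0..\<epsilon>}" for t
        using yE[OF that] by (simp add: v_def y0)
    qed
    moreover have "exp (- (- k) * r) *\<^sub>R E r x = T r x" for r x
      by (simp add: E_def blinfun.scaleR_left exp_add[symmetric])
    moreover have "F (y s) + (- k) *\<^sub>R v s = gv (v s)" for s by (simp add: F_def v_def)
    ultimately show ?thesis by simp
  qed
  then have "mild gv wv \<epsilon> v" unfolding mild_iff using yc by (auto simp: v_def)
  moreover have "v t \<le> u t" if "t \<in> {0..\<epsilon>}" for t
    using yz[OF that] z(2)[of t] that e by (simp add: v_def)
  ultimately show thesis using that e by blast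
qed

lemma maximal_mild_below:
  assumes gu: "continuous_on UNIV (\<lambda>x. gu (P x))" and gv: "continuous_on UNIV (\<lambda>x. gv (P x))"
    and le: "\<And>x. gv (P x) \<le> gu (P x)"
    and mono: "mono_on (range P) (\<lambda>x. gu x + k *\<^sub>R x)"
    and u: "mild_solution_on T a \<alpha> gu wu J u"
    and wv: "wv \<in> range P" "wv \<le> wu"
  obtains J' v where "maximal_mild_solution_on T a \<alpha> gv wv J' v" "\<And>t. t \<in> J \<inter> J' \<Longrightarrow> v t \<le> u t"
proof -
  \<comment> \<open>The inequality is imposed only where both functions are defined, so a candidate
    may outlast \<open>u\<close>.\<close>
  define below where "below J' v \<longleftrightarrow> mild_solution_on T a \<alpha> gv wv J' v \<and> (\<forall>t\<in>J \<inter> J'. v t \<le> u t)" for J' v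
  \<comment> \<open>Inclusion of graphs is extension of solutions, and values outside the domain are
    forgotten; so Zorn's lemma for inclusion applies.\<close>
  define graph where "graph J' v = (\<lambda>t. (t, v t)) ` J'" for J' and v :: "real \<Rightarrow> 'a"
  define \<A> where "\<A> = {graph J' v | J' v. below J' v}"
  have J: "is_interval J" "0 \<in> J" "J \<subseteq> {0..}" "J \<noteq> {0}" and uJ: "\<And>\<tau>. \<tau> \<in> J \<Longrightarrow> mild gu wu \<tau> u"
    using u by (auto simp: mild_solution_on_def)
  have down: "s \<in> I" if "is_interval I" "0 \<in> I" "t \<in> I" "0 \<le> s" "s \<le> t" for I and s t :: real
    using that unfolding is_interval_1 by blast
  have local: "below {0..\<epsilon>} v" if "0 < \<epsilon>" "mild gv wv \<epsilon> v" "\<And>t. t \<in> {0..\<epsilon>} \<Longrightarrow> t \<in> J \<Longrightarrow> v t \<le> u t" for \<epsilon> v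
    using that by (auto simp: below_def mild_solution_on_Icc)
  obtain \<tau> where \<tau>: "\<tau> \<in> J" "0 < \<tau>"
  proof -
    obtain \<tau> where "\<tau> \<in> J" "\<tau> \<noteq> 0" using J(2,4) by blast
    then show thesis using that[of \<tau>] J(3) by force
  qed
  obtain \<epsilon> v where ev: "0 < \<epsilon>" "mild gv wv \<epsilon> v" "\<And>t. t \<in> {0..\<epsilon>} \<Longrightarrow> v t \<le> u t"
    using mild_local_existence_below[OF gu gv le mono uJ[OF \<tau>(1)] \<tau>(2) wv] by metis
  have "\<exists>M\<in>\<A>. \<forall>X\<in>\<A>. M \<subseteq> X \<longrightarrow> X = M"
  proof (rule subset_Zorn_nonempty)
    show "\<A> \<noteq> {}" using local[OF ev(1,2)] ev(3) unfolding \<A>_def by blast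
    fix \<C> assume ne: "\<C> \<noteq> {}" and "subset.chain \<A> \<C>"
    then have CA: "\<C> \<subseteq> \<A>" and ch: "\<And>X Y. X \<in> \<C> \<Longrightarrow> Y \<in> \<C> \<Longrightarrow> X \<subseteq> Y \<or> Y \<subseteq> X"
      by (auto simp: subset_chain_def)
    define I where "I = fst ` \<Union>\<C>"
    \<comment> \<open>Members of the chain are comparable graphs, so on \<open>I\<close> the time
      determines the value and the choice is forced.\<close>
    define q where "q t = (SOME x. (t, x) \<in> \<Union>\<C>)" for t
    have val: "q t = x" if tx: "(t, x) \<in> \<Union>\<C>" for t x
    proof -
      have "(t, q t) \<in> \<Union>\<C>" unfolding q_def by (rule someI[of "\<lambda>x. (t, x) \<in> \<Union>\<C>", OF tx])
      then obtain X Y where XY: "X \<in> \<C>" "(t, x) \<in> X" "Y \<in> \<C>" "(t, q t) \<in> Y" using tx by blast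
      then obtain Z where "Z \<in> \<C>" "(t, x) \<in> Z" "(t, q t) \<in> Z" using ch[OF XY(1,3)] by blast
      then show ?thesis using CA by (auto simp: \<A>_def graph_def)
    qed
    have fst_graph: "fst ` graph J' v = J'" for J' v by (simp add: graph_def image_image)
    have dom: "J' \<subseteq> I" if "X \<in> \<C>" "X = graph J' v" for X J' v
    proof -
      have "fst ` X \<subseteq> I" unfolding I_def using that(1) by blast
      then show ?thesis using that(2) fst_graph by simp
    qed
    have piece: "\<exists>J' v. below J' v \<and> t \<in> J' \<and> J' \<subseteq> I \<and> (\<forall>s\<in>J'. q s = v s)" if t: "t \<in> I" for t
    proof -
      obtain x X where X: "X \<in> \<C>" "(t, x) \<in> X" using t by (auto simp: I_def)
      then obtain J' v where b: "below J' v" "X = graph J' v" using CA by (auto simp: \<A>_def)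
      have "t \<in> J'" using X b by (auto simp: graph_def)
      moreover have "J' \<subseteq> I" using dom[OF X(1) b(2)] .
      moreover have "q s = v s" if "s \<in> J'" for s
        by (rule val[OF UnionI[OF X(1)]]) (use that b(2) in \<open>simp add: graph_def\<close>)
      ultimately show ?thesis using b by blast
    qed
    have union: "\<Union>\<C> = graph I q"
    proof (intro set_eqI iffI)
      fix p assume p: "p \<in> \<Union>\<C>"
      then have "q (fst p) = snd p" by (intro val) simp
      then show "p \<in> graph I q" using p by (auto simp: graph_def I_def image_iff intro!: bexI[of _ p])
    next
      fix p assume "p \<in> graph I q"
      then obtain t where t: "t \<in> I" "p = (t, q t)" by (auto simp: graph_def)
      then obtain r where "r \<in> \<Union>\<C>" "t = fst r" unfolding I_def by blast
      then have "(t, snd r) \<in> \<Union>\<C>" by simp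
      then show "p \<in> \<Union>\<C>" using val t by simp
    qed
    have "below I q"
      unfolding below_def mild_solution_on_def
    proof (intro conjI ballI)
      have I0: "I \<subseteq> {0..}"
      proof
        fix t assume "t \<in> I"
        then obtain J' v where "below J' v" "t \<in> J'" using piece by blast
        then show "t \<in> {0..}" unfolding below_def mild_solution_on_def by blast
      qed
      show "is_interval I"
        unfolding is_interval_1
      proof (intro ballI allI impI)
        fix s t x assume st: "s \<in> I" "t \<in> I" "s \<le> x \<and> x \<le> t"
        obtain J' v where b: "below J' v" "t \<in> J'" "J' \<subseteq> I" using piece[OF st(2)] by blast
        have "0 \<le> x" using st I0 by (meson atLeast_iff order_trans subsetD)
        then have "x \<in> J'" using b st by (intro down[of J' t x]) (auto simp: below_def mild_solution_on_def)
        then show "x \<in> I" using b by blast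
      qed
      obtain X where "X \<in> \<C>" using ne by blast
      then obtain J' v where b: "below J' v" "X = graph J' v" using CA by (auto simp: \<A>_def)
      have "J' \<subseteq> I" using dom[OF \<open>X \<in> \<C>\<close> b(2)] .
      moreover have "0 \<in> J'" "J' \<noteq> {0}" using b by (auto simp: below_def mild_solution_on_def)
      ultimately show "0 \<in> I" "I \<noteq> {0}" by (auto simp: subset_singleton_iff)
      show "I \<subseteq> {0..}" by fact
      show "mild gv wv \<tau> q" if \<tau>: "\<tau> \<in> I" for \<tau>
      proof -
        obtain J' v where b: "below J' v" "\<tau> \<in> J'" "\<And>s. s \<in> J' \<Longrightarrow> q s = v s" using piece[OF \<tau>] by blast
        have "mild gv wv \<tau> v" using b by (simp add: below_def mild_solution_on_def)
        moreover have "q s = v s" if "s \<in> {0..\<tau>}" for s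
          by (rule b(3), rule down[of J' \<tau> s]) (use that b in \<open>auto simp: below_def mild_solution_on_def\<close>)
        ultimately show ?thesis by (rule mild_cong)
      qed
      show "q t \<le> u t" if t: "t \<in> J \<inter> I" for t
      proof -
        obtain J' v where b: "below J' v" "t \<in> J'" "\<And>s. s \<in> J' \<Longrightarrow> q s = v s" using piece[of t] t by blast
        then show ?thesis using t by (simp add: below_def)
      qed
    qed
    then show "\<Union>\<C> \<in> \<A>" unfolding union \<A>_def by blast
  qed
  then obtain G where G: "G \<in> \<A>" "\<And>X. X \<in> \<A> \<Longrightarrow> G \<subseteq> X \<Longrightarrow> X = G" by blast
  obtain J' v where b: "below J' v" and Gv: "G = graph J' v" using G(1) unfolding \<A>_def by blast
  have max: "graph I q = graph J' v" if "below I q" "graph J' v \<subseteq> graph I q" for I q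
  proof -
    have "graph I q \<in> \<A>" using that(1) unfolding \<A>_def by blast
    from G(2)[OF this] show ?thesis using that(2) Gv by simp
  qed
  have max': "\<not> (below I q \<and> J' \<subset> I \<and> (\<forall>t\<in>J'. q t = v t))" for I q
  proof
    assume *: "below I q \<and> J' \<subset> I \<and> (\<forall>t\<in>J'. q t = v t)"
    then have I: "below I q" "J' \<subseteq> I" and qv: "\<And>t. t \<in> J' \<Longrightarrow> q t = v t" by auto
    have "graph J' v = (\<lambda>t. (t, q t)) ` J'" unfolding graph_def by (rule image_cong) (simp_all add: qv)
    also have "\<dots> \<subseteq> graph I q" unfolding graph_def by (rule image_mono[OF I(2)])
    finally have "graph I q = graph J' v" by (rule max[OF I(1)])
    then have "fst ` graph I q = fst ` graph J' v" by (rule arg_cong)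
    then have "I = J'" by (simp add: graph_def image_image)
    then show False using * by simp
  qed
  have v: "mild_solution_on T a \<alpha> gv wv J' v" and vu: "\<And>t. t \<in> J \<inter> J' \<Longrightarrow> v t \<le> u t"
    using b by (auto simp: below_def)
  have J': "is_interval J'" "0 \<in> J'" "J' \<subseteq> {0..}" "J' \<noteq> {0}" using v by (auto simp: mild_solution_on_def)
  \<comment> \<open>A solution \<open>q\<close> properly extending \<open>v\<close> must violate the
    inequality at some \<open>t\<close> of \<open>J\<close> beyond \<open>J'\<close>. Following
    \<open>q\<close> up to the end of \<open>J'\<close> and restarting below \<open>u\<close> from
    there contradicts maximality among the solutions below \<open>u\<close>.\<close>
  have "False" if JI: "J' \<subset> I" and q: "mild_solution_on T a \<alpha> gv wv I q" and qv: "\<And>t. t \<in> J' \<Longrightarrow> q t = v t" for I q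
  proof -
    have I: "is_interval I" "0 \<in> I" and qI: "\<And>\<tau>. \<tau> \<in> I \<Longrightarrow> mild gv wv \<tau> q"
      using q by (auto simp: mild_solution_on_def)
    have "\<not> below I q" using max' JI qv by blast
    then obtain t where t: "t \<in> J" "t \<in> I" "\<not> q t \<le> u t" using q by (auto simp: below_def)
    have "t \<notin> J'" using t vu[of t] qv[of t] by auto
    have t0: "0 \<le> t" using t J(3) by auto
    have ub: "s < t" if "s \<in> J'" for s
      using down[OF J'(1,2) that, of t] t0 \<open>t \<notin> J'\<close> by force
    define \<sigma> where "\<sigma> = Sup J'"
    have bdd: "bdd_above J'" using ub by (auto simp: bdd_above_def intro: less_imp_le)
    have s\<sigma>: "s \<le> \<sigma>" if "s \<in> J'" for s unfolding \<sigma>_def by (rule cSup_upper[OF that bdd])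
    have "\<sigma> \<le> t" unfolding \<sigma>_def by (rule cSup_least) (use J'(2) ub in \<open>auto intro: less_imp_le\<close>)
    have inJ': "s \<in> J'" if s: "0 \<le> s" "s < \<sigma>" for s
    proof -
      obtain r where "r \<in> J'" "s < r" using less_cSupD[of J' s] J'(2) s unfolding \<sigma>_def by blast
      then show ?thesis using down[OF J'(1,2), of r s] s by simp
    qed
    have "0 < \<sigma>"
    proof -
      obtain r where "r \<in> J'" "r \<noteq> 0" using J'(2,4) by blast
      then show ?thesis using s\<sigma>[of r] J'(3) by force
    qed
    have qt: "mild gv wv t q" and ut: "mild gu wu t u" using qI uJ t by auto
    \<comment> \<open>Before \<open>\<sigma>\<close> the inequality is inherited from
      \<open>v\<close>; closedness of the cone carries it to \<open>\<sigma>\<close>, whether or not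
      \<open>\<sigma>\<close> belongs to \<open>J'\<close>.\<close>
    have le\<sigma>: "q s \<le> u s" if s: "s \<in> {0..\<sigma>}" for s
    proof -
      have c: "continuous_on {0..\<sigma>} (\<lambda>s. u s - q s)"
        by (intro continuous_on_diff continuous_on_subset[OF mild_continuous[OF ut]]
            continuous_on_subset[OF mild_continuous[OF qt]]) (use \<open>\<sigma> \<le> t\<close> in auto)
      have "closed {s \<in> {0..\<sigma>}. u s - q s \<in> {x. 0 \<le> x}}"
        using continuous_closed_preimage[OF c _ cone_closed] by (simp add: vimage_def Int_def)
      moreover have "{0..<\<sigma>} \<subseteq> {s \<in> {0..\<sigma>}. u s - q s \<in> {x. 0 \<le> x}}"
      proof
        fix s assume s: "s \<in> {0..<\<sigma>}"
        then have "s \<in> J'" using inJ' by simp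
        moreover have "s \<in> J" using down[OF J(1,2) t(1), of s] s \<open>\<sigma> \<le> t\<close> by simp
        ultimately have "q s \<le> u s" using vu[of s] qv[of s] by simp
        then show "s \<in> {s \<in> {0..\<sigma>}. u s - q s \<in> {x. 0 \<le> x}}" using s by simp
      qed
      ultimately have "closure {0..<\<sigma>} \<subseteq> {s \<in> {0..\<sigma>}. u s - q s \<in> {x. 0 \<le> x}}"
        by (intro closure_minimal)
      then show ?thesis using s \<open>0 < \<sigma>\<close> by auto
    qed
    then have "\<sigma> \<noteq> t" using t(3) t0 by auto
    with \<open>\<sigma> \<le> t\<close> have "\<sigma> < t" by simp
    have u\<sigma>: "mild gu (u \<sigma>) (t - \<sigma>) (\<lambda>s. u (\<sigma> + s))"
      using mild_shift[OF gu ut] \<open>0 < \<sigma>\<close> \<open>\<sigma> \<le> t\<close> by simp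
    have "q \<sigma> \<in> range P"
    proof -
      obtain y where "\<forall>t\<in>{0..t}. q t = P (y t)" using qt unfolding mild_iff by blast
      then have "q \<sigma> = P (y \<sigma>)" using \<open>0 < \<sigma>\<close> \<open>\<sigma> \<le> t\<close> by simp
      then show ?thesis by (rule range_eqI)
    qed
    moreover have "q \<sigma> \<le> u \<sigma>" using le\<sigma> \<open>0 < \<sigma>\<close> by simp
    ultimately obtain \<epsilon> r where e: "0 < \<epsilon>" "\<epsilon> \<le> t - \<sigma>" "mild gv (q \<sigma>) \<epsilon> r"
      and ru: "\<And>s. s \<in> {0..\<epsilon>} \<Longrightarrow> r s \<le> u (\<sigma> + s)"
      using mild_local_existence_below[OF gu gv le mono u\<sigma>, of "q \<sigma>"] \<open>\<sigma> < t\<close> by auto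
    \<comment> \<open>Up to \<open>\<sigma>\<close> the extension \<open>q\<close> is used and not
      \<open>v\<close>, since \<open>v\<close> carries no information at \<open>\<sigma>\<close>
      when \<open>J'\<close> is half-open.\<close>
    define q' where "q' s = (if s \<le> \<sigma> then q s else r (s - \<sigma>))" for s
    have "mild gv wv (\<sigma> + \<epsilon>) q'"
      unfolding q'_def
      by (rule mild_concat[OF gv mild_restrict[OF qt \<open>\<sigma> \<le> t\<close>] _ e(3)]) (use \<open>0 < \<sigma>\<close> e in auto)
    moreover have "q' s \<le> u s" if "s \<in> {0..\<sigma> + \<epsilon>}" for s
      using le\<sigma>[of s] ru[of "s - \<sigma>"] that by (auto simp: q'_def)
    ultimately have "below {0..\<sigma> + \<epsilon>} q'" using \<open>0 < \<sigma>\<close> e by (intro local) auto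
    moreover have "J' \<subseteq> {0..\<sigma> + \<epsilon>}" using s\<sigma> J'(3) e by force
    moreover have "\<sigma> + \<epsilon> \<notin> J'" using s\<sigma>[of "\<sigma> + \<epsilon>"] e by auto
    moreover have "q' s = v s" if "s \<in> J'" for s using qv[OF that] s\<sigma>[OF that] by (simp add: q'_def)
    ultimately show False
      using max'[of "{0..\<sigma> + \<epsilon>}" q'] \<open>0 < \<sigma>\<close> e by fastforce
  qed
  then have "maximal_mild_solution_on T a \<alpha> gv wv J' v"
    unfolding maximal_mild_solution_on_def using v by blast
  with vu show thesis using that by blast
qed

section \<open>Reversal of the order\<close>

lemma mild_solution_on_uminus:
  assumes "mild_solution_on T a \<alpha> g w J u"
  shows "mild_solution_on T a \<alpha> (\<lambda>x. - g (- x)) (- w) J (\<lambda>t. - u t)"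
proof -
  have "mild (\<lambda>x. - g (- x)) (- w) \<tau> (\<lambda>t. - u t)" if u: "mild g w \<tau> u" for \<tau>
    unfolding mild_iff
  proof (intro conjI ballI)
    obtain y where y: "continuous_on {0..\<tau>} y" "\<And>t. t \<in> {0..\<tau>} \<Longrightarrow> u t = P (y t)"
      using u unfolding mild_iff by blast
    show "\<exists>y. continuous_on {0..\<tau>} y \<and> (\<forall>t\<in>{0..\<tau>}. - u t = P (y t))"
      by (intro exI[of _ "\<lambda>t. - y t"] conjI continuous_on_minus y) (use y in \<open>simp add: P_neg\<close>)
    fix t assume "t \<in> {0..\<tau>}"
    then have "u t = T t w + integral {0..t} (\<lambda>s. T (t - s) (g (u s)))" using u unfolding mild_iff by blast
    then show "- u t = T t (- w) + integral {0..t} (\<lambda>s. T (t - s) (- g (- (- u s))))"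
      by (simp add: blinfun.minus_right)
  qed
  then show ?thesis using assms by (simp add: mild_solution_on_def)
qed

lemma maximal_mild_solution_on_uminus:
  assumes "maximal_mild_solution_on T a \<alpha> g w J u"
  shows "maximal_mild_solution_on T a \<alpha> (\<lambda>x. - g (- x)) (- w) J (\<lambda>t. - u t)"
  unfolding maximal_mild_solution_on_def
proof (intro conjI notI)
  show "mild_solution_on T a \<alpha> (\<lambda>x. - g (- x)) (- w) J (\<lambda>t. - u t)"
    using assms by (intro mild_solution_on_uminus) (simp add: maximal_mild_solution_on_def)
  assume "\<exists>J' u'. J \<subset> J' \<and> mild_solution_on T a \<alpha> (\<lambda>x. - g (- x)) (- w) J' u' \<and> (\<forall>t\<in>J. u' t = - u t)"
  then obtain J' u' where *: "J \<subset> J'" "mild_solution_on T a \<alpha> (\<lambda>x. - g (- x)) (- w) J' u'" "\<forall>t\<in>J. u' t = - u t"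
    by blast
  have "mild_solution_on T a \<alpha> g w J' (\<lambda>t. - u' t)" using mild_solution_on_uminus[OF *(2)] by simp
  moreover have "\<forall>t\<in>J. - u' t = u t" using *(3) by simp
  ultimately show False using assms *(1) unfolding maximal_mild_solution_on_def by blast
qed

lemma continuous_on_uminus_P:
  assumes "continuous_on UNIV (\<lambda>x. g (P x))"
  shows "continuous_on UNIV (\<lambda>x. - g (- P x) :: 'a)"
proof -
  have "continuous_on UNIV (\<lambda>x. g (P (- x)))"
    using continuous_on_compose2[OF assms, of UNIV uminus] by (simp add: continuous_on_minus)
  then have "continuous_on UNIV (\<lambda>x. - g (P (- x)))" by (rule continuous_on_minus)
  then show ?thesis by (simp add: P_neg)
qed

text \<open>Conjugating the nonlinearities by negation reverses both inequalities but keeps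
  monotonicity, with the same \<open>k\<close>.\<close>

lemma maximal_mild_above:
  assumes gu: "continuous_on UNIV (\<lambda>x. gu (P x))" and gv: "continuous_on UNIV (\<lambda>x. gv (P x))"
    and le: "\<And>x. gu (P x) \<le> gv (P x)"
    and mono: "mono_on (range P) (\<lambda>x. gu x + k *\<^sub>R x)"
    and u: "mild_solution_on T a \<alpha> gu wu J u"
    and wv: "wv \<in> range P" "wu \<le> wv"
  obtains J' v where "maximal_mild_solution_on T a \<alpha> gv wv J' v" "\<And>t. t \<in> J \<inter> J' \<Longrightarrow> u t \<le> v t"
proof -
  have rn: "- x \<in> range P" if x: "x \<in> range P" for x
  proof -
    obtain y where "x = P y" using x by (rule rangeE)
    then have "- x = P (- y)" by (simp add: P_neg)
    then show ?thesis by (rule range_eqI)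
  qed
  note c = continuous_on_uminus_P
  have "\<exists>J' v. maximal_mild_solution_on T a \<alpha> (\<lambda>x. - gv (- x)) (- wv) J' v \<and> (\<forall>t\<in>J \<inter> J'. v t \<le> - u t)"
  proof (rule maximal_mild_below[OF c[OF gu] c[OF gv] _ _ mild_solution_on_uminus[OF u], of k "- wv"])
    show "- gv (- P x) \<le> - gu (- P x)" for x using le[of "- x"] by (simp add: P_neg)
    show "mono_on (range P) (\<lambda>x. - gu (- x) + k *\<^sub>R x)"
    proof (rule mono_onI)
      fix x y assume "x \<in> range P" "y \<in> range P" "x \<le> y"
      then have "gu (- y) + k *\<^sub>R (- y) \<le> gu (- x) + k *\<^sub>R (- x)"
        by (intro mono_onD[OF mono] rn) auto
      then show "- gu (- x) + k *\<^sub>R x \<le> - gu (- y) + k *\<^sub>R y" by (simp add: algebra_simps)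
    qed
    show "- wv \<in> range P" "- wv \<le> - wu" using wv rn by auto
  qed blast
  then obtain J' v where v: "maximal_mild_solution_on T a \<alpha> (\<lambda>x. - gv (- x)) (- wv) J' v"
    and vu: "\<And>t. t \<in> J \<inter> J' \<Longrightarrow> v t \<le> - u t"
    by blast
  have "maximal_mild_solution_on T a \<alpha> gv wv J' (\<lambda>t. - v t)"
    using maximal_mild_solution_on_uminus[OF v] by simp
  moreover have "u t \<le> - v t" if "t \<in> J \<inter> J'" for t using vu[OF that] by (simp add: le_minus_iff)
  ultimately show thesis using that by blast
qed

end

section \<open>The comparison theorem\<close>

text \<open>The fractional powers belong to the shifted semigroup; multiplying by exp (a t) undoes
  the shift in semigroup and kernel alike, at the cost of a factor exp \<bar>a\<bar> for times up to
  1.\<close>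

lemma mild_setting_if_analytic:
  fixes T :: "real \<Rightarrow> 'a::{banach, ordered_real_vector} \<Rightarrow>\<^sub>L 'a"
  assumes T: "analytic_semigroup T" and gen: "infinitesimal_generator T D B"
    and cr: "compact_resolvent D B" and a: "admissible_shift T a"
    and \<alpha>: "0 < \<alpha>" "\<alpha> < 1"
    and cl: "closedin (frac_topology T a 0) (positive_cone T a 0)"
    and pos: "positive_resolvent T a D B"
  obtains M \<omega> K c where "mild_setting T M \<omega> K \<alpha> c a (neg_frac_power T a \<alpha>)"
proof -
  obtain M \<delta> W C where AD: "analytic_decay (\<lambda>t. exp (- a * t) *\<^sub>R T t) M \<delta> W C"
    using analytic_semigroup_imp_analytic_decay[OF T a] by metis
  define S where "S t = exp (- a * t) *\<^sub>R T t" for t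
  interpret S: analytic_decay S M \<delta> W C using AD unfolding S_def[abs_def] .
  have TS: "T t = exp (a * t) *\<^sub>R S t" for t
    by (simp add: S_def exp_add[symmetric])
  have T_growth: "growth_semigroup T M (- \<delta> - - a)"
    using S.exp_shift[of "- a"] by (simp add: TS[symmetric])
  interpret T: growth_semigroup T M "- \<delta> - - a" by (rule T_growth)
  obtain V :: "real \<Rightarrow> 'a \<Rightarrow>\<^sub>L 'a" and C' \<rho> where
    V: "\<And>t x. 0 < t \<Longrightarrow> ((\<lambda>t. T t x) has_vector_derivative V t x) (at t)"
    using analytic_semigroup_derivative[OF T] by metis
  have closed: "closed {x::'a. 0 \<le> x}" using closed_positive_cone[OF cl] .
  have P: "neg_frac_power T a \<alpha> = fpow S \<alpha>"
    using \<alpha> neg_frac_power_eq_fpow[of \<alpha> T a] by (simp add: S_def[abs_def])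
  note scale = linear_scale[OF bounded_linear.linear[OF S.bounded_linear_fpow[OF \<alpha>(1)]]]
  define K where "K t = exp (a * t) *\<^sub>R S.frac_kernel \<alpha> t" for t
  define c where "c = exp \<bar>a\<bar> * (C / Gamma (1 - \<alpha>) * (1 / (1 - \<alpha>) + 1 / \<alpha>))"
  have VK: "volterra_kernel T M (- \<delta> - - a) K \<alpha> c"
  proof
    show "0 < \<alpha>" "\<alpha> < 1" by (rule \<alpha>)+
    show "K (t + s) x = T s (K t x)" if "0 < t" "0 \<le> s" for s t x
      using that
      by (simp add: K_def TS S.frac_kernel_semigroup[OF \<alpha>] blinfun.scaleR_left blinfun.scaleR_right
          exp_add distrib_left mult.commute)
    show "norm (K t) \<le> c * t powr - \<alpha>" if t: "0 < t" "t \<le> 1" for t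
    proof -
      have "a * t \<le> \<bar>a\<bar> * 1" using t by (intro mult_mono) auto
      then have "exp (a * t) * norm (S.frac_kernel \<alpha> t)
          \<le> exp \<bar>a\<bar> * (C / Gamma (1 - \<alpha>) * (1 / (1 - \<alpha>) + 1 / \<alpha>) * t powr - \<alpha>)"
        using S.frac_kernel_bound[OF \<alpha> t(1)] by (intro mult_mono) auto
      then show ?thesis by (simp add: K_def c_def mult.assoc)
    qed
    show "K 0 = 0" by (simp add: K_def S.frac_kernel_0[OF \<alpha>])
    show "compact_operator (T t)" if "0 < t" for t
      by (rule compact_orbit_operator[OF T_growth gen V cr that])
  qed
  have "mild_setting T M (- \<delta> - - a) K \<alpha> c a (fpow S \<alpha>)"
  proof (rule mild_setting.intro[OF VK], rule mild_setting_axioms.intro)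
    show "fpow S \<alpha> = neg_frac_power T a \<alpha>" by (simp add: P)
    show "bounded_linear (fpow S \<alpha>)" by (rule S.bounded_linear_fpow[OF \<alpha>(1)])
    show "inj (fpow S \<alpha>)" by (rule S.fpow_inj[OF \<alpha>])
    show "fpow S \<alpha> (K t x) = T t x" if "0 < t" for t x
      using S.fpow_frac_kernel[OF \<alpha> that, of x] by (simp add: K_def TS blinfun.scaleR_left scale)
    show "fpow S \<alpha> (T t x) = T t (fpow S \<alpha> x)" if "0 \<le> t" for t x
      using S.fpow_apply[OF \<alpha>(1) that, of x] by (simp add: TS blinfun.scaleR_left scale)
    show "closed {x::'a. 0 \<le> x}" by (rule closed)
    show "0 \<le> T t x" if "0 \<le> t" "0 \<le> x" for t x
      by (rule semigroup_positive[OF T_growth gen V _ pos closed that])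
        (use S.decaying_semigroup_axioms in \<open>simp_all add: S_def[abs_def]\<close>)
  qed
  then show thesis using that unfolding P by blast
qed

theorem theorem4p1:
  fixes T :: "real \<Rightarrow> 'a::{banach, ordered_real_vector} \<Rightarrow>\<^sub>L 'a"
    and D :: "'a set"
    and A :: "'a \<Rightarrow> 'a"
    and a \<alpha> :: real
    and gp gm :: "'a \<Rightarrow> 'a"
  assumes "analytic_semigroup T"
    and "infinitesimal_generator T D (\<lambda>x. - A x)"
    and "compact_resolvent D (\<lambda>x. - A x)"
    and "admissible_shift T a"
    and "0 < \<alpha>" and "\<alpha> < 1"
    and "\<And>\<gamma>. 0 \<le> \<gamma> \<Longrightarrow> closedin (frac_topology T a \<gamma>) (positive_cone T a \<gamma>)"
    and "positive_resolvent T a D (\<lambda>x. - A x)"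
    and "continuous_map (frac_topology T a \<alpha>) euclidean gp"
    and "continuous_map (frac_topology T a \<alpha>) euclidean gm"
    and "\<And>u. u \<in> frac_space T a \<alpha> \<Longrightarrow> gm u \<le> gp u"
  shows
    "((\<exists>k::real. mono_on (frac_space T a \<alpha>) (\<lambda>u. gp u + k *\<^sub>R u)) \<longrightarrow>
       (\<forall>w\<in>frac_space T a \<alpha>. \<forall>J u. mild_solution_on T a \<alpha> gp w J u \<longrightarrow>
          (\<exists>J' v. maximal_mild_solution_on T a \<alpha> gm w J' v \<and> (\<forall>t\<in>J \<inter> J'. v t \<le> u t))) \<and>
       (\<forall>up\<in>frac_space T a \<alpha>. \<forall>um\<in>frac_space T a \<alpha>. \<forall>J u.
          um \<le> up \<longrightarrow> mild_solution_on T a \<alpha> gp up J u \<longrightarrow>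
          (\<exists>J' v. maximal_mild_solution_on T a \<alpha> gp um J' v \<and> (\<forall>t\<in>J \<inter> J'. v t \<le> u t)))) \<and>
     ((\<exists>k::real. mono_on (frac_space T a \<alpha>) (\<lambda>u. gm u + k *\<^sub>R u)) \<longrightarrow>
       (\<forall>w\<in>frac_space T a \<alpha>. \<forall>J u. mild_solution_on T a \<alpha> gm w J u \<longrightarrow>
          (\<exists>J' v. maximal_mild_solution_on T a \<alpha> gp w J' v \<and> (\<forall>t\<in>J \<inter> J'. u t \<le> v t))) \<and>
       (\<forall>um\<in>frac_space T a \<alpha>. \<forall>up\<in>frac_space T a \<alpha>. \<forall>J u.
          um \<le> up \<longrightarrow> mild_solution_on T a \<alpha> gm um J u \<longrightarrow>
          (\<exists>J' v. maximal_mild_solution_on T a \<alpha> gm up J' v \<and> (\<forall>t\<in>J \<inter> J'. u t \<le> v t))))"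
proof -
  define P where "P = neg_frac_power T a \<alpha>"
  obtain M \<omega> K c where "mild_setting T M \<omega> K \<alpha> c a P"
    using mild_setting_if_analytic[OF assms(1-6) assms(7)[OF order_refl] assms(8)]
    unfolding P_def by metis
  then interpret mild_setting T M \<omega> K \<alpha> c a P .
  note gp = continuous_on_comp_P[OF assms(9)] and gm = continuous_on_comp_P[OF assms(10)]
  have le: "gm (P x) \<le> gp (P x)" for x using assms(11)[of "P x"] by (simp add: frac_space_eq)
  \<comment> \<open>In each of the four claims either the initial values or the nonlinearities
    coincide, and the corresponding order hypothesis holds by reflexivity.\<close>
  show ?thesis
    unfolding frac_space_eq
  proof (intro conjI impI ballI allI; elim exE)
    fix k w J u
    assume k: "mono_on (range P) (\<lambda>u. gp u + k *\<^sub>R u)" and "w \<in> range P"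
      and u: "mild_solution_on T a \<alpha> gp w J u"
    then show "\<exists>J' v. maximal_mild_solution_on T a \<alpha> gm w J' v \<and> (\<forall>t\<in>J \<inter> J'. v t \<le> u t)"
      by (metis maximal_mild_below[OF gp gm le k u _ order_refl])
  next
    fix k up um J u
    assume k: "mono_on (range P) (\<lambda>u. gp u + k *\<^sub>R u)" and um: "um \<in> range P" "um \<le> up"
      and u: "mild_solution_on T a \<alpha> gp up J u"
    show "\<exists>J' v. maximal_mild_solution_on T a \<alpha> gp um J' v \<and> (\<forall>t\<in>J \<inter> J'. v t \<le> u t)"
      by (metis maximal_mild_below[OF gp gp order_refl k u um])
  next
    fix k w J u
    assume k: "mono_on (range P) (\<lambda>u. gm u + k *\<^sub>R u)" and "w \<in> range P"
      and u: "mild_solution_on T a \<alpha> gm w J u"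
    then show "\<exists>J' v. maximal_mild_solution_on T a \<alpha> gp w J' v \<and> (\<forall>t\<in>J \<inter> J'. u t \<le> v t)"
      by (metis maximal_mild_above[OF gm gp le k u _ order_refl])
  next
    fix k um up J u
    assume k: "mono_on (range P) (\<lambda>u. gm u + k *\<^sub>R u)" and up: "up \<in> range P" "um \<le> up"
      and u: "mild_solution_on T a \<alpha> gm um J u"
    show "\<exists>J' v. maximal_mild_solution_on T a \<alpha> gm up J' v \<and> (\<forall>t\<in>J \<inter> J'. u t \<le> v t)"
      by (metis maximal_mild_above[OF gm gm order_refl k u up])
  qed
qed

end
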